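(* Let $d$ and $m\leq n$ be positive integers, $\varepsilon\in(0,1)$ and $I=\varepsilon mn$. Then $$\mathrm{rs}_d(m,n,I),\ \mathrm{rs}_d(n,m,I)=\begin{cases}\Theta_d(\varepsilon^{d-1}mn) & \text{if } \varepsilon>100\max\{m^{-\frac{1}{d-1}},n^{-\frac{1}{d}}\},\\ \Theta_d(\varepsilon n) & \text{if } \varepsilon<\frac14\max\{m^{-\frac{1}{d-1}},n^{-\frac{1}{d}}\}.\end{cases}$$ That is, the stated estimate holds for both quantities $\mathrm{rs}_d(m,n,I)$ and $\mathrm{rs}_d(n,m,I)$.
   Context: For a set of points $\mathcal{P}$ and a set of (affine) hyperplanes $\mathcal{H}$ in $\mathbb{F}^d$, where $\mathbb{F}$ is a field, the incidence graph is the bipartite graph with vertex classes $\mathcal{P}$ and $\mathcal{H}$ in which $x\in\mathcal{P}$ and $H\in\mathcal{H}$ are adjacent iff $x\in H$; $I(\mathcal{P},\mathcal{H})$ is its number of edges, and $\mathrm{rs}(\mathcal{P},\mathcal{H})$ is the maximum number of edges in a complete bipartite subgraph of it, i.e. the maximum of $r\cdot s$ over all $r,s$ such that $K_{r,s}$ is a subgraph of the incidence graph. Define $\mathrm{rs}_d(n,m,I)=\min\mathrm{rs}(\mathcal{P},\mathcal{H})$, where the minimum is taken over all fields $\mathbb{F}$, all sets $\mathcal{P}\subset\mathbb{F}^d$ of at most $m$ points and all sets $\mathcal{H}$ of at most $n$ hyperplanes in $\mathbb{F}^d$ that satisfy $I(\mathcal{P},\mathcal{H})\geq I$; $\mathrm{rs}_d(m,n,I)$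 is obtained by exchanging the roles of $m$ and $n$. The notation $\Theta_d$ means equality up to positive multiplicative constants depending only on $d$.
   Formalization: The second case is proved as Θ_d(max(1, εn)), since Θ_d(εn) fails when εn is far below 1 (rs ≥ 1 always); for d = 1, and d = 2 in the first case, the estimate is claimed only when some configuration has I incidences; for d = 1, m^{-1/(d-1)} is read as 1. *)

theory Defs
  imports Complex_Main "HOL-Library.FuncSet" "HOL-Library.Countable_Set" "HOL-Algebra.Algebra"
begin

definition aff_space :: "('a, 'b) ring_scheme \<Rightarrow> nat \<Rightarrow> (nat \<Rightarrow> 'a) set" where
  "aff_space F d = {..<d} \<rightarrow>\<^sub>E carrier F"

definition hyperplane :: "('a, 'b) ring_scheme \<Rightarrow> nat \<Rightarrow> (nat \<Rightarrow> 'a) \<Rightarrow> 'a \<Rightarrow> (nat \<Rightarrow> 'a) set" where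
  "hyperplane F d a b = {x \<in> aff_space F d. (\<Oplus>\<^bsub>F\<^esub>i\<in>{..<d}. a i \<otimes>\<^bsub>F\<^esub> x i) = b}"

definition hyperplanes :: "('a, 'b) ring_scheme \<Rightarrow> nat \<Rightarrow> (nat \<Rightarrow> 'a) set set" where
  "hyperplanes F d =
     {hyperplane F d a b | a b. a \<in> aff_space F d \<and> b \<in> carrier F \<and> (\<exists>i<d. a i \<noteq> \<zero>\<^bsub>F\<^esub>)}"

text \<open>The edge set of the incidence graph; \<open>I(P,H)\<close> is its cardinality.\<close>

definition incidences :: "'p set \<Rightarrow> 'p set set \<Rightarrow> ('p \<times> 'p set) set" where
  "incidences P H = {(x, h). x \<in> P \<and> h \<in> H \<and> x \<in> h}"

definition rs :: "'p set \<Rightarrow> 'p set set \<Rightarrow> nat" where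
  "rs P H = Max {card A * card B | A B. A \<subseteq> P \<and> B \<subseteq> H \<and> A \<times> B \<subseteq> incidences P H}"

definition config :: "('a, 'b) ring_scheme \<Rightarrow> nat \<Rightarrow> nat \<Rightarrow> nat \<Rightarrow> real
    \<Rightarrow> (nat \<Rightarrow> 'a) set \<Rightarrow> (nat \<Rightarrow> 'a) set set \<Rightarrow> bool" where
  "config F d n m I P H \<longleftrightarrow>
     field F \<and>
     P \<subseteq> aff_space F d \<and> finite P \<and> card P \<le> m \<and>
     H \<subseteq> hyperplanes F d \<and> finite H \<and> card H \<le> n \<and>
     I \<le> real (card (incidences P H))"

text \<open>
  A set cannot be formed over fields of all types at once.  The fields below are those whose
  carrier is a (finite or infinite) set of natural numbers, that is, all countable fields up to
  isomorphism. Lemma \<open>rs_in_rs_values\<close> shows that nothing is lost: a configuration over any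
  field of any type uses finitely many field elements, so it lives over a countable subfield, and
  its value of \<open>rs\<close> is attained here as well.

  As in the notation \<open>rs\<^sub>d(n,m,I)\<close>, the first of the two bounds is for the
  hyperplanes and the second one for the points.
\<close>

definition rs_values :: "nat \<Rightarrow> nat \<Rightarrow> nat \<Rightarrow> real \<Rightarrow> nat set" where
  "rs_values d n m I = {rs P H | (F :: nat ring) P H. config F d n m I P H}"

text \<open>
  The minimum of \<open>rs_values d n m I\<close> if this set is nonempty. If no configuration has
  \<open>I\<close> incidences, there is no minimum and the value \<open>0\<close> is meaningless.
\<close>

definition rs_min :: "nat \<Rightarrow> nat \<Rightarrow> nat \<Rightarrow> real \<Rightarrow> nat" where
  "rs_min d n m I = Inf (rs_values d n m I)"

text \<open>For \<open>d = 1\<close> the first exponent is \<open>-1/0 = 0\<close> in HOL, so the threshold is \<open>1\<close>.\<close>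

definition threshold :: "nat \<Rightarrow> nat \<Rightarrow> nat \<Rightarrow> real" where
  "threshold d m n = max (real m powr (- 1 / (real d - 1))) (real n powr (- 1 / real d))"


subsection \<open>Countable fields suffice\<close>

lemma rs_min_in_rs_values: "rs_values d n m I \<noteq> {} \<Longrightarrow> rs_min d n m I \<in> rs_values d n m I"
  unfolding rs_min_def by (rule Inf_nat_def1)

lemma rs_min_le: "v \<in> rs_values d n m I \<Longrightarrow> rs_min d n m I \<le> v"
  unfolding rs_min_def by (rule cInf_lower) auto

lemma incidences_image:
  assumes "\<And>x h. x \<in> P \<Longrightarrow> h \<in> H \<Longrightarrow> \<phi> x \<in> \<psi> h \<longleftrightarrow> x \<in> h"
  shows "incidences (\<phi> ` P) (\<psi> ` H) = map_prod \<phi> \<psi> ` incidences P H"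
  using assms unfolding incidences_def by (force simp: map_prod_def image_iff)

lemma card_incidences_image:
  assumes "inj_on \<phi> P" "inj_on \<psi> H"
    and "\<And>x h. x \<in> P \<Longrightarrow> h \<in> H \<Longrightarrow> \<phi> x \<in> \<psi> h \<longleftrightarrow> x \<in> h"
  shows "card (incidences (\<phi> ` P) (\<psi> ` H)) = card (incidences P H)"
proof -
  have "inj_on (map_prod \<phi> \<psi>) (P \<times> H)"
    using assms(1,2) by (rule map_prod_inj_on)
  then have "inj_on (map_prod \<phi> \<psi>) (incidences P H)"
    by (rule inj_on_subset) (auto simp: incidences_def)
  then show ?thesis
    by (simp add: incidences_image[of P H \<phi> \<psi>, OF assms(3)] card_image)
qed

lemma rs_image:
  assumes "inj_on \<phi> P" "inj_on \<psi> H"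
    and inc: "\<And>x h. x \<in> P \<Longrightarrow> h \<in> H \<Longrightarrow> \<phi> x \<in> \<psi> h \<longleftrightarrow> x \<in> h"
  shows "rs (\<phi> ` P) (\<psi> ` H) = rs P H"
proof -
  let ?S = "{card A * card B | A B. A \<subseteq> P \<and> B \<subseteq> H \<and> A \<times> B \<subseteq> incidences P H}"
  let ?T = "{card A * card B | A B. A \<subseteq> \<phi> ` P \<and> B \<subseteq> \<psi> ` H \<and>
              A \<times> B \<subseteq> incidences (\<phi> ` P) (\<psi> ` H)}"
  have cards: "card (\<phi> ` A) = card A" "card (\<psi> ` B) = card B" if "A \<subseteq> P" "B \<subseteq> H" for A B
    using that assms(1,2) by (metis card_image inj_on_subset)+
  have iff: "\<phi> ` A \<times> \<psi> ` B \<subseteq> incidences (\<phi> ` P) (\<psi> ` H) \<longleftrightarrow> A \<times> B \<subseteq> incidences P H"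
    if "A \<subseteq> P" "B \<subseteq> H" for A B
  proof -
    have "\<phi> ` A \<times> \<psi> ` B \<subseteq> incidences (\<phi> ` P) (\<psi> ` H) \<longleftrightarrow> (\<forall>x\<in>A. \<forall>h\<in>B. \<phi> x \<in> \<psi> h)"
      using that unfolding incidences_def by blast
    also have "\<dots> \<longleftrightarrow> (\<forall>x\<in>A. \<forall>h\<in>B. x \<in> h)"
      using that inc by blast
    also have "\<dots> \<longleftrightarrow> A \<times> B \<subseteq> incidences P H"
      using that unfolding incidences_def by blast
    finally show ?thesis .
  qed
  have "?T \<subseteq> ?S"
  proof
    fix k assume "k \<in> ?T"
    then obtain A B where k: "k = card A * card B" "A \<subseteq> \<phi> ` P" "B \<subseteq> \<psi> ` H"
      "A \<times> B \<subseteq> incidences (\<phi> ` P) (\<psi> ` H)" by blast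
    then obtain A' B' where "A' \<subseteq> P" "A = \<phi> ` A'" "B' \<subseteq> H" "B = \<psi> ` B'"
      by (metis subset_imageE)
    with k iff[of A' B'] cards[of A' B']
    have "k = card A' * card B'" "A' \<subseteq> P" "B' \<subseteq> H" "A' \<times> B' \<subseteq> incidences P H"
      by simp_all
    then show "k \<in> ?S" by blast
  qed
  moreover have "?S \<subseteq> ?T"
  proof
    fix k assume "k \<in> ?S"
    then obtain A B where k: "k = card A * card B" "A \<subseteq> P" "B \<subseteq> H"
      "A \<times> B \<subseteq> incidences P H" by blast
    then have "k = card (\<phi> ` A) * card (\<psi> ` B)" "\<phi> ` A \<subseteq> \<phi> ` P" "\<psi> ` B \<subseteq> \<psi> ` H"
      "\<phi> ` A \<times> \<psi> ` B \<subseteq> incidences (\<phi> ` P) (\<psi> ` H)"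
      using cards iff by auto
    then show "k \<in> ?T" by blast
  qed
  ultimately show ?thesis unfolding rs_def by (simp add: subset_antisym)
qed

lemma countable_generate_field:
  assumes "countable G"
  shows "countable (generate_field F G)"
proof -
  define g where "g = rec_nat (insert \<one>\<^bsub>F\<^esub> G) (\<lambda>_ S. S \<union> (\<lambda>x. \<ominus>\<^bsub>F\<^esub> x) ` S \<union> (\<lambda>x. inv\<^bsub>F\<^esub> x) ` S
      \<union> (\<lambda>(x, y). x \<oplus>\<^bsub>F\<^esub> y) ` (S \<times> S) \<union> (\<lambda>(x, y). x \<otimes>\<^bsub>F\<^esub> y) ` (S \<times> S))"
  have g0: "g 0 = insert \<one>\<^bsub>F\<^esub> G" by (simp add: g_def)
  have gS: "g (Suc k) = g k \<union> (\<lambda>x. \<ominus>\<^bsub>F\<^esub> x) ` g k \<union> (\<lambda>x. inv\<^bsub>F\<^esub> x) ` g k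
      \<union> (\<lambda>(x, y). x \<oplus>\<^bsub>F\<^esub> y) ` (g k \<times> g k) \<union> (\<lambda>(x, y). x \<otimes>\<^bsub>F\<^esub> y) ` (g k \<times> g k)" for k
    by (simp add: g_def)
  have "countable (g k)" for k
    by (induction k) (use assms in \<open>simp_all add: g0 gS\<close>)
  moreover have "mono g"
    by (rule incseq_SucI) (auto simp: gS)
  moreover have "generate_field F G \<subseteq> (\<Union>k. g k)"
  proof
    fix x assume "x \<in> generate_field F G"
    then have "\<exists>k. x \<in> g k"
    proof induction
      case one
      show ?case by (rule exI[of _ 0]) (simp add: g0)
    next
      case (incl h)
      then show ?case by (intro exI[of _ 0]) (simp add: g0)
    next
      case (a_inv h)
      then obtain k where "h \<in> g k" by blast
      then show ?case by (intro exI[of _ "Suc k"]) (auto simp: gS)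
    next
      case (m_inv h)
      then obtain k where "h \<in> g k" by blast
      then show ?case by (intro exI[of _ "Suc k"]) (auto simp: gS)
    next
      case (eng_add h1 h2)
      then obtain k l where "h1 \<in> g k" "h2 \<in> g l" by blast
      then have "h1 \<in> g (max k l)" "h2 \<in> g (max k l)"
        using \<open>mono g\<close> by (meson max.cobounded1 max.cobounded2 monoD subsetD)+
      then show ?case by (intro exI[of _ "Suc (max k l)"]) (force simp: gS)
    next
      case (eng_mult h1 h2)
      then obtain k l where "h1 \<in> g k" "h2 \<in> g l" by blast
      then have "h1 \<in> g (max k l)" "h2 \<in> g (max k l)"
        using \<open>mono g\<close> by (meson max.cobounded1 max.cobounded2 monoD subsetD)+
      then show ?case by (intro exI[of _ "Suc (max k l)"]) (force simp: gS)
    qed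
    then show "x \<in> (\<Union>k. g k)" by blast
  qed
  ultimately show ?thesis
    by (meson countable_UN countable_subset countableI_type)
qed

lemma linear_form_hom:
  assumes "ring_hom_cring S T f" "inj_on f (carrier S)"
    and "\<And>i. i < d \<Longrightarrow> a i \<in> carrier S" "\<And>i. i < d \<Longrightarrow> x i \<in> carrier S" "b \<in> carrier S"
  shows "(\<Oplus>\<^bsub>T\<^esub>i\<in>{..<d}. f (a i) \<otimes>\<^bsub>T\<^esub> f (x i)) = f b \<longleftrightarrow> (\<Oplus>\<^bsub>S\<^esub>i\<in>{..<d}. a i \<otimes>\<^bsub>S\<^esub> x i) = b"
proof -
  interpret ring_hom_cring S T f by fact
  have closed: "(\<lambda>i. a i \<otimes>\<^bsub>S\<^esub> x i) \<in> {..<d} \<rightarrow> carrier S"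
    using assms(3,4) by auto
  have "f (\<Oplus>\<^bsub>S\<^esub>i\<in>{..<d}. a i \<otimes>\<^bsub>S\<^esub> x i) = (\<Oplus>\<^bsub>T\<^esub>i\<in>{..<d}. f (a i \<otimes>\<^bsub>S\<^esub> x i))"
    using hom_finsum[OF closed] by (simp add: comp_def)
  also have "\<dots> = (\<Oplus>\<^bsub>T\<^esub>i\<in>{..<d}. f (a i) \<otimes>\<^bsub>T\<^esub> f (x i))"
    by (rule S.finsum_cong') (use assms(3,4) in auto)
  finally have "(\<Oplus>\<^bsub>T\<^esub>i\<in>{..<d}. f (a i) \<otimes>\<^bsub>T\<^esub> f (x i)) = f (\<Oplus>\<^bsub>S\<^esub>i\<in>{..<d}. a i \<otimes>\<^bsub>S\<^esub> x i)" ..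
  moreover have "(\<Oplus>\<^bsub>S\<^esub>i\<in>{..<d}. a i \<otimes>\<^bsub>S\<^esub> x i) \<in> carrier S"
    using closed by (rule R.finsum_closed)
  ultimately show ?thesis
    using assms(2,5) by (auto dest: inj_onD)
qed

lemma rs_in_rs_values:
  fixes F :: "('a, 'b) ring_scheme"
  assumes "config F d n m I P H"
  shows "rs P H \<in> rs_values d n m I"
proof -
  interpret field F using assms by (simp add: config_def)
  have P: "P \<subseteq> aff_space F d" "finite P" "card P \<le> m"
    and H: "H \<subseteq> hyperplanes F d" "finite H" "card H \<le> n"
    and I: "I \<le> real (card (incidences P H))"
    using assms by (simp_all add: config_def)
  have "\<forall>h\<in>H. \<exists>a b. h = hyperplane F d a b \<and> a \<in> aff_space F d \<and> b \<in> carrier F \<and> (\<exists>i<d. a i \<noteq> \<zero>\<^bsub>F\<^esub>)"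
    using H(1) unfolding hyperplanes_def by blast
  then obtain a b where ab: "\<And>h. h \<in> H \<Longrightarrow> h = hyperplane F d (a h) (b h) \<and> a h \<in> aff_space F d
      \<and> b h \<in> carrier F \<and> (\<exists>i<d. a h i \<noteq> \<zero>\<^bsub>F\<^esub>)"
    by metis
  have Hsub: "h \<subseteq> aff_space F d" if "h \<in> H" for h
    using ab[OF that] unfolding hyperplane_def by blast
  \<comment> \<open>points separating the hyperplanes, so that distinct ones stay distinct over the subfield\<close>
  define w where "w h k = (SOME x. x \<in> h \<longleftrightarrow> x \<notin> k)" for h k :: "(nat \<Rightarrow> 'a) set"
  have w: "w h k \<in> aff_space F d \<and> (w h k \<in> h \<longleftrightarrow> w h k \<notin> k)"
    if "h \<in> H" "k \<in> H" "h \<noteq> k" for h k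
  proof -
    have "\<exists>x. x \<in> h \<longleftrightarrow> x \<notin> k" using that(3) by blast
    then have "w h k \<in> h \<longleftrightarrow> w h k \<notin> k" unfolding w_def by (rule someI_ex)
    then show ?thesis using Hsub that(1,2) by blast
  qed
  define W where "W = case_prod w ` {(h, k). h \<in> H \<and> k \<in> H \<and> h \<noteq> k}"
  have W: "finite W" "W \<subseteq> aff_space F d"
  proof -
    have "{(h, k). h \<in> H \<and> k \<in> H \<and> h \<noteq> k} \<subseteq> H \<times> H" by blast
    then show "finite W" unfolding W_def using H(2) by (meson finite_SigmaI finite_imageI finite_subset)
    show "W \<subseteq> aff_space F d" unfolding W_def using w by auto
  qed
  define G where "G = (\<lambda>(x, i). x i) ` ((P \<union> W \<union> a ` H) \<times> {..<d}) \<union> b ` H"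
  have "finite G" unfolding G_def using P(2) W(1) H(2) by simp
  have "P \<union> W \<union> a ` H \<subseteq> aff_space F d" using P W ab by auto
  then have "x i \<in> carrier F" if "x \<in> P \<union> W \<union> a ` H" "i < d" for x i
    using that unfolding aff_space_def by (auto simp: PiE_iff)
  then have Gc: "G \<subseteq> carrier F" unfolding G_def using ab by auto
  define K where "K = generate_field F G"
  have "subfield K F" unfolding K_def by (rule generate_field_is_subfield[OF Gc])
  have KF: "K \<subseteq> carrier F" unfolding K_def by (rule generate_field_incl[OF Gc])
  have GK: "G \<subseteq> K" unfolding K_def by (auto intro: generate_field.incl)
  define S where "S = F \<lparr> carrier := K \<rparr>"
  have S: "field S" unfolding S_def using \<open>subfield K F\<close> by (rule subfield_iff(2))
  have cS: "carrier S = K" by (simp add: S_def)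
  have "countable K"
    unfolding K_def using \<open>finite G\<close> by (intro countable_generate_field countable_finite)
  then obtain f :: "'a \<Rightarrow> nat" where f: "inj_on f K" by (auto simp: countable_def)
  define N where "N = image_ring f S"
  have N: "field N"
    unfolding N_def by (rule field.inj_imp_image_ring_is_field[OF S]) (simp add: cS f)
  have cN: "carrier N = f ` K" unfolding N_def image_ring_carrier cS ..
  have "f \<in> ring_iso S N"
    unfolding N_def by (rule inj_imp_image_ring_iso) (simp add: cS f)
  then have f_hom: "ring_hom_cring S N f"
    using S N
    by (intro ring_hom_cring.intro ring_hom_cring_axioms.intro)
      (auto simp: ring_iso_def fieldE)
  have id_hom: "ring_hom_cring S F id"
    using S
    by (intro ring_hom_cring.intro ring_hom_cring_axioms.intro)
      (auto simp: fieldE ring_hom_def S_def KF[THEN subsetD] is_cring)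
  have zero: "f \<zero>\<^bsub>F\<^esub> = \<zero>\<^bsub>N\<^esub>" unfolding N_def image_ring_zero by (simp add: S_def)
  have zeroK: "\<zero>\<^bsub>F\<^esub> \<in> K" unfolding K_def by (rule zero_in_generate)
  define \<phi> where "\<phi> x = (\<lambda>i\<in>{..<d}. f (x i))" for x
  define \<psi> where "\<psi> h = hyperplane N d (\<phi> (a h)) (f (b h))" for h
  define V where "V = aff_space F d \<inter> {x. \<forall>i<d. x i \<in> K}"
  have coords: "x i \<in> K" if "x \<in> P \<union> W \<union> a ` H" "i < d" for x i
  proof -
    have "x i \<in> G" unfolding G_def using that by force
    then show ?thesis using GK by blast
  qed
  have V: "P \<subseteq> V" "W \<subseteq> V"
    using coords P(1) W(2) unfolding V_def by blast+
  have aV: "a h \<in> V" if "h \<in> H" for h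
    using coords[of "a h"] ab[OF that] that unfolding V_def by blast
  have bK: "b h \<in> K" if "h \<in> H" for h
    using GK that unfolding G_def by blast
  have \<phi>V: "\<phi> x \<in> aff_space N d" if "x \<in> V" for x
    using that unfolding \<phi>_def V_def aff_space_def by (auto simp: cN)
  have inj: "inj_on \<phi> V"
  proof (rule inj_onI)
    fix x y assume xy: "x \<in> V" "y \<in> V" "\<phi> x = \<phi> y"
    show "x = y"
    proof (rule PiE_ext)
      show "x \<in> {..<d} \<rightarrow>\<^sub>E carrier F" "y \<in> {..<d} \<rightarrow>\<^sub>E carrier F"
        using xy unfolding V_def aff_space_def by auto
      fix i assume "i \<in> {..<d}"
      then have "f (x i) = f (y i)"
        using fun_cong[OF xy(3), of i] by (simp add: \<phi>_def)
      moreover have "x i \<in> K" "y i \<in> K"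
        using xy(1,2) \<open>i \<in> {..<d}\<close> by (auto simp: V_def)
      ultimately show "x i = y i" using f by (auto dest: inj_onD)
    qed
  qed
  have mem: "\<phi> x \<in> \<psi> h \<longleftrightarrow> x \<in> h" if "x \<in> V" "h \<in> H" for x h
  proof -
    have aK: "a h i \<in> carrier S" and xK: "x i \<in> carrier S" if "i < d" for i
      using aV[OF \<open>h \<in> H\<close>] \<open>x \<in> V\<close> that by (auto simp: V_def cS)
    have bS: "b h \<in> carrier S" using bK that(2) by (simp add: cS)
    interpret N: field N by (rule N)
    have fK: "f y \<in> carrier N" if "y \<in> carrier S" for y
      using that by (simp add: cN cS)
    have "\<phi> x \<in> \<psi> h \<longleftrightarrow> (\<Oplus>\<^bsub>N\<^esub>i\<in>{..<d}. \<phi> (a h) i \<otimes>\<^bsub>N\<^esub> \<phi> x i) = f (b h)"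
      using \<phi>V[OF that(1)] by (simp add: \<psi>_def hyperplane_def)
    also have "(\<Oplus>\<^bsub>N\<^esub>i\<in>{..<d}. \<phi> (a h) i \<otimes>\<^bsub>N\<^esub> \<phi> x i) = (\<Oplus>\<^bsub>N\<^esub>i\<in>{..<d}. f (a h i) \<otimes>\<^bsub>N\<^esub> f (x i))"
      by (rule N.finsum_cong') (use aK xK fK in \<open>auto simp: \<phi>_def\<close>)
    also have "\<dots> = f (b h) \<longleftrightarrow> (\<Oplus>\<^bsub>S\<^esub>i\<in>{..<d}. a h i \<otimes>\<^bsub>S\<^esub> x i) = b h"
      by (rule linear_form_hom[OF f_hom _ aK xK bS]) (simp_all add: cS f)
    also have "\<dots> \<longleftrightarrow> (\<Oplus>\<^bsub>F\<^esub>i\<in>{..<d}. a h i \<otimes>\<^bsub>F\<^esub> x i) = b h"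
      using linear_form_hom[OF id_hom _ aK xK bS, of d] by simp
    also have "\<dots> \<longleftrightarrow> x \<in> hyperplane F d (a h) (b h)"
      using that(1) by (simp add: hyperplane_def V_def)
    also have "\<dots> \<longleftrightarrow> x \<in> h"
      using ab[OF that(2)] by simp
    finally show ?thesis .
  qed
  have inj\<psi>: "inj_on \<psi> H"
  proof (rule inj_onI, rule ccontr)
    fix h k assume hk: "h \<in> H" "k \<in> H" "\<psi> h = \<psi> k" "h \<noteq> k"
    then have "w h k \<in> V" using V(2) unfolding W_def by auto
    then show False using mem[of "w h k"] w[of h k] hk by metis
  qed
  have inj\<phi>: "inj_on \<phi> P" using inj V(1) by (rule inj_on_subset)
  have memP: "\<And>x h. x \<in> P \<Longrightarrow> h \<in> H \<Longrightarrow> \<phi> x \<in> \<psi> h \<longleftrightarrow> x \<in> h"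
    using mem V(1) by blast
  have "\<psi> h \<in> hyperplanes N d" if h: "h \<in> H" for h
  proof -
    obtain i where i: "i < d" "a h i \<noteq> \<zero>\<^bsub>F\<^esub>" using ab[OF h] by blast
    then have "\<phi> (a h) i \<noteq> \<zero>\<^bsub>N\<^esub>"
      using aV[OF h] f zeroK unfolding zero[symmetric] \<phi>_def V_def by (auto dest: inj_onD)
    then show ?thesis
      using \<phi>V[OF aV[OF h]] bK[OF h] i(1) unfolding \<psi>_def hyperplanes_def cN by blast
  qed
  then have "config N d n m I (\<phi> ` P) (\<psi> ` H)"
    using card_incidences_image[of \<phi> P \<psi> H, OF inj\<phi> inj\<psi> memP]
      card_image[OF inj\<phi>] card_image[OF inj\<psi>] N P H I V(1) \<phi>V
    unfolding config_def by auto
  moreover have "rs P H = rs (\<phi> ` P) (\<psi> ` H)"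
    using rs_image[of \<phi> P \<psi> H, OF inj\<phi> inj\<psi> memP] by simp
  ultimately show ?thesis
    unfolding rs_values_def by blast
qed

end

theory Submission
  imports Defs "HOL-Algebra.Algebraic_Closure_Type" "HOL-Library.Z2"
begin

text \<open>
  Constructions.  Over a field with \<open>q\<close> elements, take all points and all hyperplanes
  \<open>a \<cdot> x + y = b\<close> of the \<open>e\<close>-dimensional space: the incidence density is \<open>1 / q\<close>, and a biclique
  has at most \<open>q ^ (e - 1)\<close> edges because it consists of two orthogonal sets.  An additional coordinate
  in an infinite extension field gives multiplicity to the points or to the hyperplanes.  In
  the sparse case \<open>e = d\<close> (without multiplicity) or \<open>e = d - 1\<close> (with multiplicity on the larger
  side), and \<open>t\<close> generic translates with \<open>t q\<close> about \<open>1 / \<epsilon>\<close> are used; in the dense case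
  \<open>e = d - 2\<close>, with multiplicities on both sides.  Discarding vertices of small degree fixes
  the numbers of points and of hyperplanes without lowering the density.

  Lower bound in the dense case.  Let \<open>y\<close> be a vertex of the larger side.  If no flat strictly
  inside \<open>y\<close> contains half of its neighbours, then many \<open>d\<close>-tuples of neighbours span \<open>y\<close>; there
  are too few tuples for such \<open>y\<close> to matter.  For the other \<open>y\<close> choose a flat \<open>w y\<close> of codimension
  at least 2 with half of the neighbours.  For a vertex \<open>x\<close> of the smaller side take a largest flat
  \<open>V x\<close> through \<open>x\<close> that lies in a positive proportion of the \<open>w y\<close> containing \<open>x\<close>.  Typical
  tuples of these \<open>w y\<close> intersect in \<open>V x\<close>, and one flat of the tuple is already of codimension 2, so
  there are few candidates for \<open>V x\<close>; it is rarely a single point, and otherwise the pigeonhole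
  principle yields a flat that lies in many hyperplanes and contains many points.
\<close>

text \<open>The passage to the flats \<open>w y\<close> is what yields the right exponents. A flat
  of rank \<open>k\<close> (dimension \<open>k - 1\<close>) is cut out by \<open>d + 1 - k\<close>
  hyperplanes, but by only \<open>d - k\<close> flats \<open>w y\<close>, because the first of them
  already costs two ranks. Hence there are about \<open>(1 / \<epsilon>) ^ (d - 2)\<close>
  candidates for a \<open>V x\<close> of rank at least 2, and sharing the incidences among them
  leaves \<open>\<epsilon> ^ (d - 1) m n\<close> for one biclique; tuples of hyperplanes would lose
  another factor \<epsilon>. The same saving shows that only about
  \<open>(1 / \<epsilon>) ^ (d - 1)\<close> vertices \<open>x\<close> of typical degree can have
  \<open>V x = {x}\<close>, whence the threshold for \<open>m\<close>; the threshold for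
  \<open>n\<close> comes from the \<open>d\<close>-tuples of neighbours that span a hyperplane.
  Points and hyperplanes may each be the larger side, so the lower bound is proved in an axiomatic
  geometry that is symmetric in the two sides. All constructions live over the algebraic closure of
  the field with two elements: the orders of its finite subfields approximate every large
  1/\<epsilon> up to a factor 2, and being infinite it has room for generic translates and
  multiplicities.\<close>

subsection \<open>Flats and large bicliques\<close>

text \<open>Only letters that lower the potential are taken, at least half of \<open>N\<close> in
  every state, until the absorbing state \<open>\<tau>\<close> is reached; each letter costs a
  factor 2. This serves two opposite processes: spans that grow to a hyperplane and intersections
  that shrink to a flat.\<close>

lemma card_lists_halving:
  fixes f :: "'s \<Rightarrow> 'c \<Rightarrow> 's" and pot :: "'s \<Rightarrow> nat"
  assumes N: "finite N"
    and fix_target: "\<And>c. c \<in> N \<Longrightarrow> f \<tau> c = \<tau>"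
    and Inv: "\<And>s c. Inv s \<Longrightarrow> c \<in> N \<Longrightarrow> Inv (f s c)"
    and zero: "\<And>s. Inv s \<Longrightarrow> pot s = 0 \<Longrightarrow> s = \<tau>"
    and half: "\<And>s. Inv s \<Longrightarrow> s \<noteq> \<tau> \<Longrightarrow> card N \<le> 2 * card {c \<in> N. pot (f s c) < pot s}"
  shows "Inv s \<Longrightarrow> pot s \<le> r \<Longrightarrow>
    card N ^ r \<le> 2 ^ r * card {l. set l \<subseteq> N \<and> length l = r \<and> foldl f s l = \<tau>}"
proof (induction r arbitrary: s)
  case 0
  then have "s = \<tau>" using zero by simp
  then have "{l. set l \<subseteq> N \<and> length l = 0 \<and> foldl f s l = \<tau>} = {[]}" by auto
  then show ?case by simp
next
  case (Suc r)
  let ?L = "\<lambda>r s. {l. set l \<subseteq> N \<and> length l = r \<and> foldl f s l = \<tau>}"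
  have fin: "finite (?L r s)" for r s
    by (rule finite_subset[OF _ finite_lists_length_eq[OF N, of r]]) auto
  show ?case
  proof (cases "s = \<tau>")
    case True
    have "foldl f \<tau> l = \<tau>" if "set l \<subseteq> N" for l
      using that by (induction l) (auto simp: fix_target)
    then have "?L (Suc r) s = {l. set l \<subseteq> N \<and> length l = Suc r}"
      using True by auto
    then show ?thesis
      using card_lists_length_eq[OF N, of "Suc r"] by simp
  next
    case False
    define G where "G = {c \<in> N. pot (f s c) < pot s}"
    have "finite G" using N by (simp add: G_def)
    have IH: "card N ^ r \<le> 2 ^ r * card (?L r (f s c))" if "c \<in> G" for c
      using that Suc.prems by (intro Suc.IH Inv) (auto simp: G_def)
    have "card G * card N ^ r = (\<Sum>c\<in>G. card N ^ r)" by simp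
    also have "\<dots> \<le> (\<Sum>c\<in>G. 2 ^ r * card (?L r (f s c)))"
      by (rule sum_mono) (rule IH)
    also have "\<dots> = 2 ^ r * (\<Sum>c\<in>G. card (?L r (f s c)))"
      by (simp add: sum_distrib_left)
    also have "(\<Sum>c\<in>G. card (?L r (f s c))) = (\<Sum>c\<in>G. card ((#) c ` ?L r (f s c)))"
      by (rule sum.cong) (simp_all add: card_image)
    also have "\<dots> = card (\<Union>c\<in>G. (#) c ` ?L r (f s c))"
      using \<open>finite G\<close> fin by (subst card_UN_disjoint) auto
    also have "\<dots> \<le> card (?L (Suc r) s)"
      by (rule card_mono[OF fin]) (auto simp: G_def)
    finally have "card G * card N ^ r \<le> 2 ^ r * card (?L (Suc r) s)" by simp
    moreover have "card N \<le> 2 * card G"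
      unfolding G_def using Suc.prems(1) False by (rule half)
    then have "card N * card N ^ r \<le> 2 * card G * card N ^ r" by (rule mult_right_mono) simp
    ultimately show ?thesis by (simp only: power_Suc mult.assoc)
  qed
qed

text \<open>For \<open>t > s\<close> the factor \<open>(t / s) ^ (k - 1)\<close> is at least 1.
  Bounds for power sums, as tuple counts supply them, thus bound the sum itself at a freely chosen
  cut-off \<open>s\<close>.\<close>

lemma power_interpolation:
  fixes s t :: real
  assumes "0 < s" "0 \<le> t" "1 \<le> k"
  shows "t \<le> s + t ^ k / s ^ (k - 1)"
proof (cases "t \<le> s")
  case True
  then show ?thesis using assms by (simp add: add_increasing2)
next
  case False
  obtain j where k: "k = Suc j" using assms(3) by (cases k) auto
  have "s ^ j \<le> t ^ j" using False assms by (intro power_mono) auto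
  then have "t * s ^ j \<le> t ^ k" using assms by (simp add: k mult_left_mono)
  then have "t \<le> t ^ k / s ^ j" using assms by (simp add: field_simps)
  then show ?thesis using assms k by simp
qed

text \<open>The losses in \<open>biclique_lower_bound\<close>: 16 for the share of the incidences
  that survives, \<open>2 ^ d\<close> for passing from the degree of \<open>x\<close> to the number
  of flats above \<open>V x\<close>, \<open>2 ^ (d - 2)\<close> from halving over tuples, and
  \<open>(16 * 2 ^ d) ^ (d - 2)\<close> from the cut-off \<open>s\<close> used there.\<close>

definition biclique_const :: "nat \<Rightarrow> real" where
  "biclique_const d = 16 * 2 ^ (d - 2) * 2 ^ d * (16 * 2 ^ d) ^ (d - 2)"

text \<open>The axioms are invariant under exchanging the sides. The last one replaces dimension: a
  non-incidence is a nonzero pairing of homogeneous coordinates, and a triangular matrix of pairings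
  with nonzero diagonal has full rank, which is at most \<open>d + 1\<close>.\<close>

locale incidence_geometry =
  fixes A :: "'a set" and B :: "'b set" and R :: "'a \<Rightarrow> 'b \<Rightarrow> bool" and d :: nat
  assumes separate_left: "\<And>a a'. a \<in> A \<Longrightarrow> a' \<in> A \<Longrightarrow> a \<noteq> a' \<Longrightarrow> \<exists>b\<in>B. R a b \<and> \<not> R a' b"
    and separate_right: "\<And>b b'. b \<in> B \<Longrightarrow> b' \<in> B \<Longrightarrow> b \<noteq> b' \<Longrightarrow> \<exists>a\<in>A. R a b \<and> \<not> R a b'"
    and miss_left: "\<And>a. a \<in> A \<Longrightarrow> \<exists>b\<in>B. \<not> R a b"
    and miss_right: "\<And>b. b \<in> B \<Longrightarrow> \<exists>a\<in>A. \<not> R a b"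
    and triangular: "\<And>r x y. \<forall>i<r. x i \<in> A \<and> y i \<in> B \<and> \<not> R (x i) (y i) \<Longrightarrow>
      \<forall>j<r. \<forall>i<j. R (x i) (y j) \<Longrightarrow> r \<le> Suc d"
begin

text \<open>Exchanging the sides transposes the triangular pattern; reversing the indices restores
  it.\<close>

lemma dual: "incidence_geometry B A (\<lambda>b a. R a b) d"
proof
  fix r :: nat and x y
  assume xy: "\<forall>i<r. x i \<in> B \<and> y i \<in> A \<and> \<not> R (y i) (x i)"
    and tri: "\<forall>j<r. \<forall>i<j. R (y j) (x i)"
  show "r \<le> Suc d"
    by (rule triangular[of r "\<lambda>i. y (r - Suc i)" "\<lambda>i. x (r - Suc i)"]) (use xy tri in auto)
qed (use separate_left separate_right miss_left miss_right in auto)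

section \<open>Flats, spans and ranks\<close>

definition nb :: "'b \<Rightarrow> 'a set" where
  "nb y = {a \<in> A. R a y}"

definition flat :: "'a set \<Rightarrow> bool" where
  "flat W \<longleftrightarrow> (\<exists>C\<subseteq>B. W = {a \<in> A. \<forall>b\<in>C. R a b})"

definition span :: "'a set \<Rightarrow> 'a set" where
  "span W = {a \<in> A. \<forall>b\<in>B. (\<forall>w\<in>W. R w b) \<longrightarrow> R a b}"

text \<open>Each point of a chain is separated by some \<open>y\<close> from all its predecessors.
  For affine flats the longest chain therefore has the affine dimension plus 1 as its length: 0 for
  the empty set, 1 for a point, \<open>d\<close> for a hyperplane.\<close>

definition chain :: "nat \<Rightarrow> 'a set \<Rightarrow> bool" where
  "chain r W \<longleftrightarrow> (\<exists>x y. (\<forall>i<r. x i \<in> A \<inter> W \<and> y i \<in> B \<and> \<not> R (x i) (y i)) \<and>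
     (\<forall>j<r. \<forall>i<j. R (x i) (y j)))"

definition rk :: "'a set \<Rightarrow> nat" where
  "rk W = Max {r. chain r W}"

lemma chain_le: "chain r W \<Longrightarrow> r \<le> Suc d"
  unfolding chain_def using triangular by blast

lemma finite_chain: "finite {r. chain r W}"
  by (rule finite_subset[of _ "{..Suc d}"]) (auto simp: chain_le)

lemma chain_0: "chain 0 W"
  by (simp add: chain_def)

lemma chain_rk: "chain (rk W) W"
  using Max_in[OF finite_chain[of W]] chain_0[of W] unfolding rk_def by blast

lemma rk_ge: "chain r W \<Longrightarrow> r \<le> rk W"
  unfolding rk_def by (simp add: finite_chain)

text \<open>The pair of \<open>z\<close> and \<open>h\<close> prolongs a longest chain of
  \<open>W\<close>, since \<open>h\<close> contains \<open>W\<close> but misses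
  \<open>z\<close>.\<close>

lemma rk_less:
  assumes "W \<subseteq> V" "z \<in> V" "z \<in> A" "h \<in> B" "\<And>w. w \<in> W \<Longrightarrow> R w h" "\<not> R z h"
  shows "rk W < rk V"
proof -
  obtain x y where xy: "\<forall>i<rk W. x i \<in> A \<inter> W \<and> y i \<in> B \<and> \<not> R (x i) (y i)"
    "\<forall>j<rk W. \<forall>i<j. R (x i) (y j)"
    using chain_rk[of W] unfolding chain_def by blast
  have "chain (Suc (rk W)) V"
    unfolding chain_def
    by (rule exI[of _ "x(rk W := z)"], rule exI[of _ "y(rk W := h)"])
      (use xy assms in \<open>auto simp: less_Suc_eq\<close>)
  from rk_ge[OF this] show ?thesis by simp
qed

lemma rk_strict:
  assumes "flat W" "W \<subset> V" "V \<subseteq> A"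
  shows "rk W < rk V"
proof -
  obtain C where C: "C \<subseteq> B" "W = {a \<in> A. \<forall>b\<in>C. R a b}" using assms(1) by (auto simp: flat_def)
  obtain z where "z \<in> V" "z \<notin> W" using assms by blast
  then obtain h where "h \<in> C" "\<not> R z h" using C assms(3) by auto
  then show ?thesis
    using \<open>z \<in> V\<close> assms C by (intro rk_less[of W V z h]) auto
qed

lemma rk_mono: "flat W \<Longrightarrow> W \<subseteq> V \<Longrightarrow> V \<subseteq> A \<Longrightarrow> rk W \<le> rk V"
  using rk_strict by (metis less_imp_le order_refl psubsetI)

lemma rk_le: "rk W \<le> Suc d"
  using chain_le chain_rk by blast

lemma rk_nb:
  assumes "y \<in> B"
  shows "rk (nb y) \<le> d"
proof -
  obtain z where "z \<in> A" "\<not> R z y" using miss_right assms by blast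
  then have "rk (nb y) < rk A" using assms by (intro rk_less[of _ _ z y]) (auto simp: nb_def)
  then show ?thesis using rk_le[of A] by simp
qed

lemma rk_pos:
  assumes "a \<in> W" "a \<in> A"
  shows "1 \<le> rk W"
proof -
  obtain h where "h \<in> B" "\<not> R a h" using miss_left assms by blast
  then have "rk {} < rk W" using assms by (intro rk_less[of _ _ a h]) auto
  then show ?thesis by simp
qed

lemma rk_two:
  assumes "a \<in> W" "a' \<in> W" "a \<noteq> a'" "a \<in> A" "a' \<in> A"
  shows "2 \<le> rk W"
proof -
  obtain h where "h \<in> B" "R a h" "\<not> R a' h" using separate_left assms by blast
  then have "rk {a} < rk W" using assms by (intro rk_less[of _ _ a' h]) auto
  then show ?thesis using rk_pos[of a "{a}"] assms by simp
qed

lemma flat_subset: "flat W \<Longrightarrow> W \<subseteq> A"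
  by (auto simp: flat_def)

lemma flat_nb: "y \<in> B \<Longrightarrow> flat (nb y)"
  unfolding flat_def nb_def by (rule exI[of _ "{y}"]) auto

lemma flat_ground: "flat A"
  unfolding flat_def by (rule exI[of _ "{}"]) auto

lemma flat_Int:
  assumes "flat V" "flat W"
  shows "flat (V \<inter> W)"
proof -
  obtain C D where "C \<subseteq> B" "D \<subseteq> B" "V = {a \<in> A. \<forall>b\<in>C. R a b}" "W = {a \<in> A. \<forall>b\<in>D. R a b}"
    using assms by (auto simp: flat_def)
  then show ?thesis unfolding flat_def by (intro exI[of _ "C \<union> D"]) auto
qed

lemma flat_span: "flat (span W)"
  unfolding flat_def span_def by (rule exI[of _ "{b \<in> B. \<forall>w\<in>W. R w b}"]) auto

lemma span_least: "flat V \<Longrightarrow> W \<subseteq> V \<Longrightarrow> span W \<subseteq> V"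
  unfolding flat_def span_def by blast

lemma span_superset: "W \<subseteq> A \<Longrightarrow> W \<subseteq> span W"
  by (auto simp: span_def)

lemma nb_inj: "inj_on nb B"
  using separate_right by (fastforce simp: inj_on_def nb_def)

section \<open>Tuples that span a hyperplane or cut out a flat\<close>

definition spread :: "'a set \<Rightarrow> 'b \<Rightarrow> bool" where
  "spread U y \<longleftrightarrow> (\<forall>W. flat W \<and> W \<subset> nb y \<longrightarrow> 2 * card (W \<inter> U) < card (nb y \<inter> U))"

text \<open>A spread hyperplane is spanned by a positive proportion of the \<open>d\<close>-tuples of its points.\<close>

lemma sum_spread_le:
  assumes U: "U \<subseteq> A" "finite U" and Y: "Y \<subseteq> B" "finite Y" and spread: "\<And>y. y \<in> Y \<Longrightarrow> spread U y"
  shows "(\<Sum>y\<in>Y. card (nb y \<inter> U) ^ d) \<le> 2 ^ d * card U ^ d"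
proof -
  \<comment> \<open>The state of the halving argument is the span of the points chosen so far, the
    potential is the rank missing to \<open>d\<close>. Every point outside a proper subflat raises
    the rank, and spreadness makes these points more than half.\<close>
  define f where "f W x = span (insert x W)" for W x
  define L where "L y = {l. set l \<subseteq> nb y \<inter> U \<and> length l = d \<and> foldl f (span {}) l = nb y}" for y
  have fin: "finite (L y)" for y
    by (rule finite_subset[OF _ finite_lists_length_eq[OF U(2), of d]]) (auto simp: L_def)
  have L: "card (nb y \<inter> U) ^ d \<le> 2 ^ d * card (L y)" if y: "y \<in> Y" for y
    unfolding L_def
  proof (rule card_lists_halving[where Inv = "\<lambda>W. flat W \<and> W \<subseteq> nb y" and pot = "\<lambda>W. d - rk W"])
    have yB: "y \<in> B" using y Y by auto
    have nbA: "nb y \<subseteq> A" by (auto simp: nb_def)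
    show "finite (nb y \<inter> U)" using U by simp
    show "f (nb y) c = nb y" if "c \<in> nb y \<inter> U" for c
      using that span_least[OF flat_nb[OF yB]] span_superset[OF nbA]
      by (auto simp: f_def insert_absorb)
    show "flat (f W c) \<and> f W c \<subseteq> nb y" if "flat W \<and> W \<subseteq> nb y" "c \<in> nb y \<inter> U" for W c
      using that span_least[OF flat_nb[OF yB], of "insert c W"] by (simp add: f_def flat_span)
    have less: "rk W < d" if "flat W" "W \<subset> nb y" for W
      using rk_strict[OF that nbA] rk_nb[OF yB] by simp
    show "W = nb y" if "flat W \<and> W \<subseteq> nb y" "d - rk W = 0" for W
      using less[of W] that by auto
    show "card (nb y \<inter> U) \<le> 2 * card {c \<in> nb y \<inter> U. d - rk (f W c) < d - rk W}"
      if W: "flat W \<and> W \<subseteq> nb y" "W \<noteq> nb y" for W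
    proof -
      have W': "flat W" "W \<subset> nb y" using W by auto
      have "nb y \<inter> U - W \<inter> U \<subseteq> {c \<in> nb y \<inter> U. d - rk (f W c) < d - rk W}"
      proof
        fix c assume c: "c \<in> nb y \<inter> U - W \<inter> U"
        have "insert c W \<subseteq> f W c" unfolding f_def using c W' nbA by (intro span_superset) auto
        then have "rk W < rk (f W c)"
          using c by (intro rk_strict W') (auto simp: f_def span_def)
        then show "c \<in> {c \<in> nb y \<inter> U. d - rk (f W c) < d - rk W}" using c less[OF W'] by auto
      qed
      then have "card (nb y \<inter> U - W \<inter> U) \<le> card {c \<in> nb y \<inter> U. d - rk (f W c) < d - rk W}"
        using U by (intro card_mono) auto
      moreover have "card (nb y \<inter> U - W \<inter> U) = card (nb y \<inter> U) - card (W \<inter> U)"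
        using W' U by (intro card_Diff_subset) auto
      moreover have "2 * card (W \<inter> U) < card (nb y \<inter> U)"
        using spread[OF y] W' by (simp add: spread_def)
      ultimately show ?thesis by simp
    qed
    show "flat (span {}) \<and> span {} \<subseteq> nb y"
      using flat_span span_least[OF flat_nb[OF yB]] by simp
    show "d - rk (span {}) \<le> d" by simp
  qed
  have "(\<Sum>y\<in>Y. card (nb y \<inter> U) ^ d) \<le> (\<Sum>y\<in>Y. 2 ^ d * card (L y))"
    by (rule sum_mono) (rule L)
  also have "\<dots> = 2 ^ d * (\<Sum>y\<in>Y. card (L y))" by (simp add: sum_distrib_left)
  also have "(\<Sum>y\<in>Y. card (L y)) = card (\<Union>y\<in>Y. L y)"
  proof (subst card_UN_disjoint)
    \<comment> \<open>A tuple that spans \<open>nb y\<close> determines \<open>y\<close>, so the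
      sets of tuples are disjoint.\<close>
    have "y = y'" if "y \<in> Y" "y' \<in> Y" "L y \<inter> L y' \<noteq> {}" for y y'
    proof -
      have "nb y = nb y'" using that by (auto simp: L_def)
      then show ?thesis using that(1,2) nb_inj Y(1) by (meson inj_onD subsetD)
    qed
    then show "\<forall>i\<in>Y. \<forall>j\<in>Y. i \<noteq> j \<longrightarrow> L i \<inter> L j = {}" by blast
  qed (use Y fin in auto)
  also have "\<dots> \<le> card {l. set l \<subseteq> U \<and> length l = d}"
    by (rule card_mono) (auto simp: L_def finite_lists_length_eq U)
  also have "\<dots> = card U ^ d" by (rule card_lists_length_eq[OF U(2)])
  finally show ?thesis by simp
qed

definition above :: "'b set \<Rightarrow> ('b \<Rightarrow> 'a set) \<Rightarrow> 'a set \<Rightarrow> 'b set" where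
  "above Y w V = {y \<in> Y. V \<subseteq> w y}"

text \<open>Dually, \<open>V\<close> is the intersection of a positive proportion of the tuples of flats \<open>w y\<close> above it.\<close>

lemma sum_above_le:
  assumes Y: "finite Y" and w: "\<And>y. y \<in> Y \<Longrightarrow> flat (w y) \<and> rk (w y) < d"
    and \<V>: "finite \<V>" "\<And>V. V \<in> \<V> \<Longrightarrow> flat V \<and> k \<le> rk V \<and> above Y w V \<noteq> {}"
    and max: "\<And>V V'. V \<in> \<V> \<Longrightarrow> flat V' \<Longrightarrow> V \<subset> V' \<Longrightarrow> 2 * card (above Y w V') \<le> card (above Y w V)"
  shows "(\<Sum>V\<in>\<V>. card (above Y w V) ^ (d - k)) \<le> 2 ^ (d - k) * card Y ^ (d - k)"
proof -
  \<comment> \<open>The potential below truncates the rank at \<open>d\<close>. The start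
    \<open>A\<close> may have rank \<open>d + 1\<close>, but the first intersection with some
    \<open>w y\<close> falls below \<open>d\<close> at once, so that \<open>d - k\<close> letters
    suffice instead of \<open>d + 1 - k\<close>.\<close>
  define f where "f s y = s \<inter> w y" for s y
  define L where "L V = {l. set l \<subseteq> above Y w V \<and> length l = d - k \<and> foldl f A l = V}" for V
  have fin: "finite (L V)" for V
    by (rule finite_subset[OF _ finite_lists_length_eq[OF Y, of "d - k"]]) (auto simp: L_def above_def)
  have L: "card (above Y w V) ^ (d - k) \<le> 2 ^ (d - k) * card (L V)" if V: "V \<in> \<V>" for V
    unfolding L_def
  proof (rule card_lists_halving[where Inv = "\<lambda>s. flat s \<and> V \<subseteq> s" and pot = "\<lambda>s. min (rk s) d - rk V"])
    have flatV: "flat V" "k \<le> rk V" using \<V>(2) V by auto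
    obtain y where y: "y \<in> Y" "V \<subseteq> w y" using \<V>(2) V by (auto simp: above_def)
    have "rk V \<le> rk (w y)" using rk_mono[OF flatV(1) y(2)] w[OF y(1)] flat_subset by auto
    then have rkV: "rk V < d" using w[OF y(1)] by simp
    show "finite (above Y w V)" using Y by (simp add: above_def)
    show "f V c = V" if "c \<in> above Y w V" for c using that by (auto simp: above_def f_def)
    show "flat (f s c) \<and> V \<subseteq> f s c" if "flat s \<and> V \<subseteq> s" "c \<in> above Y w V" for s c
      using that w by (auto simp: above_def f_def intro!: flat_Int)
    have less: "rk V < rk s" if "flat s" "V \<subset> s" for s
      using rk_strict[OF flatV(1) that(2)] flat_subset that by auto
    show "s = V" if "flat s \<and> V \<subseteq> s" "min (rk s) d - rk V = 0" for s
      using less[of s] that rkV by fastforce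
    show "card (above Y w V) \<le> 2 * card {c \<in> above Y w V. min (rk (f s c)) d - rk V < min (rk s) d - rk V}"
      if s: "flat s \<and> V \<subseteq> s" "s \<noteq> V" for s
    proof -
      have s': "flat s" "V \<subset> s" using s by auto
      have "above Y w V - above Y w s \<subseteq> {c \<in> above Y w V. min (rk (f s c)) d - rk V < min (rk s) d - rk V}"
      proof
        fix c assume c: "c \<in> above Y w V - above Y w s"
        then have cY: "c \<in> Y" "\<not> s \<subseteq> w c" by (auto simp: above_def)
        have fl: "flat (f s c)" unfolding f_def using w cY s' by (intro flat_Int) auto
        have "rk (f s c) < rk s"
          using cY flat_subset[OF s'(1)] by (intro rk_strict[OF fl]) (auto simp: f_def)
        moreover have "rk (f s c) \<le> rk (w c)"
          using w[OF cY(1)] flat_subset by (intro rk_mono fl) (auto simp: f_def)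
        ultimately show "c \<in> {c \<in> above Y w V. min (rk (f s c)) d - rk V < min (rk s) d - rk V}"
          using c w[OF cY(1)] less[OF s'] rkV by auto
      qed
      then have "card (above Y w V - above Y w s) \<le> card {c \<in> above Y w V. min (rk (f s c)) d - rk V < min (rk s) d - rk V}"
        using Y by (intro card_mono) (auto simp: above_def)
      moreover have "card (above Y w V - above Y w s) = card (above Y w V) - card (above Y w s)"
        using s' Y by (intro card_Diff_subset) (auto simp: above_def)
      moreover have "2 * card (above Y w s) \<le> card (above Y w V)" using max[OF V s'] .
      ultimately show ?thesis by linarith
    qed
    show "flat A \<and> V \<subseteq> A" using flat_ground flat_subset flatV by auto
    show "min (rk A) d - rk V \<le> d - k" using flatV by auto
  qed
  have "(\<Sum>V\<in>\<V>. card (above Y w V) ^ (d - k)) \<le> (\<Sum>V\<in>\<V>. 2 ^ (d - k) * card (L V))"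
    by (rule sum_mono) (rule L)
  also have "\<dots> = 2 ^ (d - k) * (\<Sum>V\<in>\<V>. card (L V))" by (simp add: sum_distrib_left)
  also have "(\<Sum>V\<in>\<V>. card (L V)) = card (\<Union>V\<in>\<V>. L V)"
    by (subst card_UN_disjoint) (use \<V> fin in \<open>auto simp: L_def\<close>)
  also have "\<dots> \<le> card {l. set l \<subseteq> Y \<and> length l = d - k}"
    by (rule card_mono) (auto simp: L_def above_def finite_lists_length_eq Y)
  also have "\<dots> = card Y ^ (d - k)" by (rule card_lists_length_eq[OF Y])
  finally show ?thesis by simp
qed

lemma card_diagonal_incidences:
  assumes "finite U" "finite Y"
  shows "(\<Sum>y\<in>Y. card (w y \<inter> U)) = (\<Sum>x\<in>U. card {y \<in> Y. x \<in> w y})"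
proof -
  have "(\<Sum>y\<in>Y. card (w y \<inter> U)) = (\<Sum>y\<in>Y. \<Sum>x\<in>U. if x \<in> w y then 1 else 0)"
    using assms by (intro sum.cong) (simp_all add: sum.If_cases Int_commute Int_def)
  also have "\<dots> = (\<Sum>x\<in>U. \<Sum>y\<in>Y. if x \<in> w y then 1 else 0)"
    by (rule sum.swap)
  also have "\<dots> = (\<Sum>x\<in>U. card {y \<in> Y. x \<in> w y})"
    using assms by (intro sum.cong) (simp_all add: sum.If_cases Int_def)
  finally show ?thesis .
qed

lemma sum_le_of_power_sum:
  fixes t :: "'c \<Rightarrow> real"
  assumes "finite F" "real (card F) \<le> N" "0 < s" "1 \<le> k" "\<And>x. x \<in> F \<Longrightarrow> 0 \<le> t x"
    and "(\<Sum>x\<in>F. t x ^ k) \<le> T"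
  shows "(\<Sum>x\<in>F. t x) \<le> N * s + T / s ^ (k - 1)"
proof -
  have "(\<Sum>x\<in>F. t x) \<le> (\<Sum>x\<in>F. s + t x ^ k / s ^ (k - 1))"
    using assms by (intro sum_mono power_interpolation) auto
  also have "\<dots> = real (card F) * s + (\<Sum>x\<in>F. t x ^ k) / s ^ (k - 1)"
    by (simp add: sum.distrib sum_divide_distrib)
  also have "\<dots> \<le> N * s + T / s ^ (k - 1)"
    using assms by (intro add_mono mult_right_mono divide_right_mono) auto
  finally show ?thesis .
qed

text \<open>The weight \<open>2 ^ (rk V - 1)\<close> permits a loss of a factor 2 per rank. The span
  of \<open>x\<close> satisfies the estimate, and for a solution of largest rank every larger flat
  violates it, which says that fewer than half of the flats above \<open>V\<close> contain the
  larger one.\<close>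

lemma thick_flat:
  assumes Y: "finite Y" and w: "\<And>y. y \<in> Y \<Longrightarrow> flat (w y)" and x: "x \<in> A"
  obtains V where "flat V" "x \<in> V" "card {y \<in> Y. x \<in> w y} \<le> 2 ^ (rk V - 1) * card (above Y w V)"
    "\<And>V'. flat V' \<Longrightarrow> V \<subset> V' \<Longrightarrow> 2 * card (above Y w V') \<le> card (above Y w V)"
proof -
  let ?D = "card {y \<in> Y. x \<in> w y}"
  define P where "P V \<longleftrightarrow> flat V \<and> x \<in> V \<and> ?D \<le> 2 ^ (rk V - 1) * card (above Y w V)" for V
  have "above Y w (span {x}) = {y \<in> Y. x \<in> w y}"
    using w span_least[of _ "{x}"] span_superset[of "{x}"] x by (auto simp: above_def)
  then have "P (span {x})"
    using span_superset[of "{x}"] x by (auto simp: P_def flat_span)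
  then obtain V where V: "P V" "\<And>V'. P V' \<Longrightarrow> rk V' \<le> rk V"
    using ex_has_greatest_nat[of P "span {x}" rk "Suc (Suc d)"] rk_le by (auto simp: less_Suc_eq_le)
  show ?thesis
  proof (rule that[of V])
    fix V' assume V': "flat V'" "V \<subset> V'"
    have flatV: "flat V" "x \<in> V" using V(1) by (auto simp: P_def)
    have less: "rk V < rk V'" using rk_strict V' flatV flat_subset by auto
    then have "\<not> P V'" using V(2)[of V'] by auto
    then have "2 ^ (rk V' - 1) * card (above Y w V') < ?D" using V' flatV by (auto simp: P_def)
    also have "?D \<le> 2 ^ (rk V - 1) * card (above Y w V)" using V(1) by (simp add: P_def)
    finally have 1: "2 ^ (rk V' - 1) * card (above Y w V') < 2 ^ (rk V - 1) * card (above Y w V)" .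
    have "1 \<le> rk V" using rk_pos flatV x by auto
    then have "Suc (rk V - 1) \<le> rk V' - 1" using less by auto
    then have "2 ^ Suc (rk V - 1) * card (above Y w V') \<le> 2 ^ (rk V' - 1) * card (above Y w V')"
      by (intro mult_right_mono power_increasing) auto
    with 1 have "2 ^ Suc (rk V - 1) * card (above Y w V') < 2 ^ (rk V - 1) * card (above Y w V)"
      by linarith
    then have "2 ^ (rk V - 1) * (2 * card (above Y w V')) < 2 ^ (rk V - 1) * card (above Y w V)"
      by (simp only: power_Suc2 mult.assoc)
    then show "2 * card (above Y w V') \<le> card (above Y w V)" by simp
  qed (use V(1) in \<open>auto simp: P_def\<close>)
qed

text \<open>\<open>U\<close> is the side with at most \<open>m\<close> vertices, be it points or
  hyperplanes. The budget: half of the incidences go to spread \<open>y\<close>, half of the rest to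
  the passage to \<open>w y\<close>, then an eighth of the total to vertices with
  \<open>V x = {x}\<close> and a sixteenth to flats with few \<open>w y\<close> above them; a
  sixteenth remains.\<close>

theorem biclique_lower_bound:
  fixes \<epsilon> :: real and m n M :: nat
  assumes d: "2 \<le> d" and U: "U \<subseteq> A" "finite U" "card U \<le> m" and Y: "Y \<subseteq> B" "finite Y" "card Y \<le> n"
    and \<epsilon>: "0 < \<epsilon>" and m: "(100 / \<epsilon>) ^ (d - 1) < real m" and n: "(100 / \<epsilon>) ^ d < real n"
    and inc: "\<epsilon> * real m * real n \<le> real (card {(x, y). x \<in> U \<and> y \<in> Y \<and> R x y})"
    and M: "\<And>A' B'. A' \<subseteq> U \<Longrightarrow> B' \<subseteq> Y \<Longrightarrow> (\<forall>a\<in>A'. \<forall>b\<in>B'. R a b) \<Longrightarrow> card A' * card B' \<le> M"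
  shows "\<epsilon> ^ (d - 1) * real m * real n \<le> biclique_const d * real M"
proof -
  let ?E = "\<epsilon> * real m * real n"
  have "{(x, y). x \<in> U \<and> y \<in> Y \<and> R x y} = prod.swap ` (SIGMA y:Y. nb y \<inter> U)"
    using U(1) by (auto simp: nb_def image_iff)
  then have "card {(x, y). x \<in> U \<and> y \<in> Y \<and> R x y} = (\<Sum>y\<in>Y. card (nb y \<inter> U))"
    using U Y by (simp add: card_image)
  with inc have inc: "?E \<le> real (\<Sum>y\<in>Y. card (nb y \<inter> U))" by simp
  have mpos: "0 < real m" using m \<epsilon> by (meson divide_pos_pos less_trans zero_less_numeral zero_less_power)
  have npos: "0 < real n" using n \<epsilon> by (meson divide_pos_pos less_trans zero_less_numeral zero_less_power)
  define Y0 where "Y0 = {y \<in> Y. spread U y}"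
  define Y1 where "Y1 = Y - Y0"
  have Y0: "Y0 \<subseteq> Y" "finite Y0" and Y1: "Y1 \<subseteq> Y" "finite Y1" "Y1 \<subseteq> B"
    using Y by (auto simp: Y0_def Y1_def)
  have c0: "card Y0 \<le> n" "card Y1 \<le> n"
    using card_mono[OF Y(2) Y0(1)] card_mono[OF Y(2) Y1(1)] Y(3) by auto
  have "(\<Sum>y\<in>Y0. card (nb y \<inter> U) ^ d) \<le> 2 ^ d * card U ^ d"
    by (rule sum_spread_le) (use U Y Y0 in \<open>auto simp: Y0_def\<close>)
  also have "\<dots> \<le> 2 ^ d * m ^ d" using U(3) by (intro mult_left_mono power_mono) auto
  finally have "real (\<Sum>y\<in>Y0. card (nb y \<inter> U) ^ d) \<le> real (2 ^ d * m ^ d)"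
    by (simp only: of_nat_le_iff)
  then have p0: "(\<Sum>y\<in>Y0. real (card (nb y \<inter> U)) ^ d) \<le> 2 ^ d * real m ^ d" by simp
  \<comment> \<open>Degrees up to the cut-off \<epsilon>m/4 contribute at most
    \<open>?E / 4\<close>. The tuple term contributes no more once \<open>n\<close> is at least
    \<open>(8 / \<epsilon>) ^ d\<close>, which the constant 100 covers.\<close>
  have "(\<Sum>y\<in>Y0. real (card (nb y \<inter> U))) \<le> n * (\<epsilon> / 4 * m) + 2 ^ d * real m ^ d / (\<epsilon> / 4 * m) ^ (d - 1)"
    by (rule sum_le_of_power_sum) (use Y0 c0 p0 \<epsilon> mpos d in auto)
  also have "2 ^ d * real m ^ d / (\<epsilon> / 4 * m) ^ (d - 1) \<le> ?E / 4"
  proof -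
    have "(8 / \<epsilon>) ^ d \<le> (100 / \<epsilon>) ^ d" using \<epsilon> by (intro power_mono divide_right_mono) auto
    then have "(8 / \<epsilon>) ^ d * (\<epsilon> / 4) ^ d \<le> n * (\<epsilon> / 4) ^ d" using n \<epsilon> by (intro mult_right_mono) auto
    moreover have "(8 / \<epsilon>) ^ d * (\<epsilon> / 4) ^ d = 2 ^ d" using \<epsilon> by (simp flip: power_mult_distrib)
    ultimately have "2 ^ d * real m ^ d \<le> n * (\<epsilon> / 4) ^ d * real m ^ d" by (intro mult_right_mono) auto
    also have "\<dots> = n * (\<epsilon> / 4 * m) ^ d" by (simp only: power_mult_distrib mult.assoc)
    also have "\<dots> = (?E / 4) * (\<epsilon> / 4 * m) ^ (d - 1)"
      using d by (cases d) (auto simp: algebra_simps)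
    finally show ?thesis using \<epsilon> mpos by (simp add: pos_divide_le_eq)
  qed
  finally have s0: "(\<Sum>y\<in>Y0. real (card (nb y \<inter> U))) \<le> ?E / 2" by (simp add: algebra_simps)
  have "(\<Sum>y\<in>Y. real (card (nb y \<inter> U))) = (\<Sum>y\<in>Y1. real (card (nb y \<inter> U))) + (\<Sum>y\<in>Y0. real (card (nb y \<inter> U)))"
    unfolding Y1_def using Y0 Y by (intro sum.subset_diff) auto
  with s0 inc have s1: "?E / 2 \<le> (\<Sum>y\<in>Y1. real (card (nb y \<inter> U)))" by simp

  have "\<exists>W. flat W \<and> W \<subset> nb y \<and> card (nb y \<inter> U) \<le> 2 * card (W \<inter> U)" if "y \<in> Y1" for y
    using that by (auto simp: Y1_def Y0_def spread_def not_less)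
  then obtain w where w: "\<And>y. y \<in> Y1 \<Longrightarrow> flat (w y) \<and> w y \<subset> nb y \<and> card (nb y \<inter> U) \<le> 2 * card (w y \<inter> U)"
    by metis
  have nbA: "nb y \<subseteq> A" for y by (auto simp: nb_def)
  \<comment> \<open>\<open>w y\<close> is a proper subflat of a flat of rank at most
    \<open>d\<close>: this is the codimension 2 behind the shorter tuples.\<close>
  have rkw: "flat (w y) \<and> rk (w y) < d" if "y \<in> Y1" for y
    using rk_strict[of "w y" "nb y"] w[OF that] nbA[of y] rk_nb[of y] that Y1 by (meson less_le_trans subsetD)
  define D where "D x = {y \<in> Y1. x \<in> w y}" for x
  have finD: "finite (D x)" for x using Y1 by (simp add: D_def)
  have "?E / 2 \<le> (\<Sum>y\<in>Y1. 2 * real (card (w y \<inter> U)))"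
  proof (rule order_trans[OF s1], rule sum_mono)
    fix y assume "y \<in> Y1"
    then have "real (card (nb y \<inter> U)) \<le> real (2 * card (w y \<inter> U))" using w by (simp only: of_nat_le_iff)
    then show "real (card (nb y \<inter> U)) \<le> 2 * real (card (w y \<inter> U))" by simp
  qed
  then have "?E / 4 \<le> real (\<Sum>y\<in>Y1. card (w y \<inter> U))"
    by (simp flip: sum_distrib_left)
  also have "(\<Sum>y\<in>Y1. card (w y \<inter> U)) = (\<Sum>x\<in>U. card (D x))"
    unfolding D_def using U Y1 by (intro card_diagonal_incidences)
  finally have s2: "?E / 4 \<le> (\<Sum>x\<in>U. real (card (D x)))" by simp

  have "\<exists>V. flat V \<and> x \<in> V \<and> card (D x) \<le> 2 ^ (rk V - 1) * card (above Y1 w V) \<and>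
      (\<forall>V'. flat V' \<longrightarrow> V \<subset> V' \<longrightarrow> 2 * card (above Y1 w V') \<le> card (above Y1 w V))" if "x \<in> U" for x
  proof -
    have "x \<in> A" using that U by auto
    show ?thesis unfolding D_def
      by (rule thick_flat[OF Y1(2) rkw[THEN conjunct1] \<open>x \<in> A\<close>]) auto
  qed
  then obtain V where V: "\<And>x. x \<in> U \<Longrightarrow> flat (V x) \<and> x \<in> V x \<and>
      card (D x) \<le> 2 ^ (rk (V x) - 1) * card (above Y1 w (V x)) \<and>
      (\<forall>V'. flat V' \<longrightarrow> V x \<subset> V' \<longrightarrow> 2 * card (above Y1 w V') \<le> card (above Y1 w (V x)))"
    by metis
  define U1 where "U1 = {x \<in> U. D x \<noteq> {}}"
  define U2 where "U2 = {x \<in> U1. rk (V x) = 1}"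
  define U3 where "U3 = U1 - U2"
  have fins: "finite U1" "finite U2" "finite U3" and subs: "U1 \<subseteq> U" "U2 \<subseteq> U" "U3 \<subseteq> U"
    using U by (auto simp: U1_def U2_def U3_def)
  have above_ne: "above Y1 w (V x) \<noteq> {}" if "x \<in> U1" for x
  proof -
    have "0 < card (D x)" using that finD by (auto simp: U1_def card_gt_0_iff)
    then show ?thesis using V[of x] that by (auto simp: U1_def)
  qed
  \<comment> \<open>The parameter \<open>k\<close> will be 1 for the vertices with
    \<open>V x = {x}\<close> and 2 for the others.\<close>
  have tuples: "(\<Sum>V\<in>V ` F. real (card (above Y1 w V)) ^ (d - k)) \<le> 2 ^ (d - k) * real n ^ (d - k)"
    if F: "F \<subseteq> U1" "\<And>x. x \<in> F \<Longrightarrow> k \<le> rk (V x)" for F k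
  proof -
    have "(\<Sum>V\<in>V ` F. card (above Y1 w V) ^ (d - k)) \<le> 2 ^ (d - k) * card Y1 ^ (d - k)"
    proof (rule sum_above_le[OF Y1(2) rkw])
      show "finite (V ` F)" using F fins by (auto intro: finite_subset)
      show "flat v \<and> k \<le> rk v \<and> above Y1 w v \<noteq> {}" if "v \<in> V ` F" for v
        using that F V above_ne subs by blast
      show "2 * card (above Y1 w V') \<le> card (above Y1 w v)" if "v \<in> V ` F" "flat V'" "v \<subset> V'" for v V'
        using that F V subs by blast
    qed
    also have "\<dots> \<le> 2 ^ (d - k) * n ^ (d - k)" using c0 by (intro mult_left_mono power_mono) auto
    finally have "real (\<Sum>V\<in>V ` F. card (above Y1 w V) ^ (d - k)) \<le> real (2 ^ (d - k) * n ^ (d - k))"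
      by (simp only: of_nat_le_iff)
    then show ?thesis by simp
  qed
  \<comment> \<open>Singletons make \<open>V\<close> injective on \<open>U2\<close>, so a count of
    flats becomes a count of vertices.\<close>
  have V2: "V x = {x}" if "x \<in> U2" for x
  proof -
    have x: "x \<in> U" "rk (V x) = 1" using that by (auto simp: U1_def U2_def)
    then have "a = x" if "a \<in> V x" for a
      using rk_two[of x "V x" a] that V[OF x(1)] U flat_subset by fastforce
    then show ?thesis using V[OF x(1)] by blast
  qed
  have "(\<Sum>x\<in>U2. real (card (D x)) ^ (d - 1)) \<le> (\<Sum>x\<in>U2. real (card (above Y1 w (V x))) ^ (d - 1))"
  proof (intro sum_mono power_mono)
    fix x assume "x \<in> U2"
    then have "x \<in> U" "rk (V x) = 1" by (auto simp: U1_def U2_def)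
    then show "real (card (D x)) \<le> real (card (above Y1 w (V x)))" using V[of x] by simp
  qed simp
  also have "\<dots> = (\<Sum>v\<in>V ` U2. real (card (above Y1 w v)) ^ (d - 1))"
    by (subst sum.reindex) (auto simp: inj_on_def V2)
  also have "\<dots> \<le> 2 ^ (d - 1) * real n ^ (d - 1)"
    by (rule tuples) (auto simp: U2_def)
  finally have p2: "(\<Sum>x\<in>U2. real (card (D x)) ^ (d - 1)) \<le> 2 ^ (d - 1) * real n ^ (d - 1)" .
  have cU: "card F \<le> m" if "F \<subseteq> U" for F
    using card_mono[OF U(2) that] U(3) by simp
  \<comment> \<open>The cut-off \<epsilon>n/16 costs \<open>?E / 16\<close>, and so does the tuple
    term once \<open>m\<close> is at least \<open>(32 / \<epsilon>) ^ (d - 1)\<close>, again covered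
    by the constant 100.\<close>
  have "(\<Sum>x\<in>U2. real (card (D x))) \<le> m * (\<epsilon> / 16 * n) + 2 ^ (d - 1) * real n ^ (d - 1) / (\<epsilon> / 16 * n) ^ (d - 1 - 1)"
    by (rule sum_le_of_power_sum) (use fins cU[OF subs(2)] p2 \<epsilon> npos d in auto)
  also have "2 ^ (d - 1) * real n ^ (d - 1) / (\<epsilon> / 16 * n) ^ (d - 1 - 1) \<le> ?E / 16"
  proof -
    have "(32 / \<epsilon>) ^ (d - 1) \<le> (100 / \<epsilon>) ^ (d - 1)" using \<epsilon> by (intro power_mono divide_right_mono) auto
    then have "(32 / \<epsilon>) ^ (d - 1) * (\<epsilon> / 16) ^ (d - 1) \<le> m * (\<epsilon> / 16) ^ (d - 1)"
      using m \<epsilon> by (intro mult_right_mono) auto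
    moreover have "(32 / \<epsilon>) ^ (d - 1) * (\<epsilon> / 16) ^ (d - 1) = 2 ^ (d - 1)"
      using \<epsilon> by (simp flip: power_mult_distrib)
    ultimately have "2 ^ (d - 1) * real n ^ (d - 1) \<le> m * (\<epsilon> / 16) ^ (d - 1) * real n ^ (d - 1)"
      by (intro mult_right_mono) auto
    also have "\<dots> = m * (\<epsilon> / 16 * n) ^ (d - 1)" by (simp only: power_mult_distrib mult.assoc)
    also have "(\<epsilon> / 16 * n) ^ (d - 1) = (\<epsilon> / 16 * n) * (\<epsilon> / 16 * n) ^ (d - 1 - 1)"
      using d by (cases "d - 1") auto
    finally have "2 ^ (d - 1) * real n ^ (d - 1) \<le> (?E / 16) * (\<epsilon> / 16 * n) ^ (d - 1 - 1)"
      by (simp only: mult_ac times_divide_eq_left times_divide_eq_right)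
    then show ?thesis using \<epsilon> npos by (subst pos_divide_le_eq) auto
  qed
  finally have s3: "(\<Sum>x\<in>U2. real (card (D x))) \<le> ?E / 8" by (simp add: algebra_simps)
  have "(\<Sum>x\<in>U. real (card (D x))) = (\<Sum>x\<in>U1. real (card (D x)))"
    using U by (intro sum.mono_neutral_right) (auto simp: U1_def)
  also have "\<dots> = (\<Sum>x\<in>U3. real (card (D x))) + (\<Sum>x\<in>U2. real (card (D x)))"
    unfolding U3_def using fins by (intro sum.subset_diff) (auto simp: U2_def)
  finally have s4: "?E / 8 \<le> (\<Sum>x\<in>U3. real (card (D x)))" using s2 s3 by simp
  have rk3: "2 \<le> rk (V x)" "rk (V x) < d" if "x \<in> U3" for x
  proof -
    have x: "x \<in> U1" "x \<in> U" "rk (V x) \<noteq> 1" using that by (auto simp: U1_def U2_def U3_def)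
    have Vx: "flat (V x)" "x \<in> V x" using V[OF x(2)] by blast+
    have "x \<in> A" using x(2) U by auto
    then have "1 \<le> rk (V x)" using rk_pos[OF Vx(2)] by simp
    then show "2 \<le> rk (V x)" using x(3) by simp
    obtain y where y: "y \<in> Y1" "V x \<subseteq> w y" using above_ne[OF x(1)] by (auto simp: above_def)
    have "rk (V x) \<le> rk (w y)" using rk_mono[OF Vx(1) y(2)] rkw[OF y(1)] flat_subset by blast
    then show "rk (V x) < d" using rkw[OF y(1)] by simp
  qed
  have D3: "real (card (D x)) \<le> 2 ^ d * real (card (above Y1 w (V x)))" if "x \<in> U3" for x
  proof -
    have "card (D x) \<le> 2 ^ (rk (V x) - 1) * card (above Y1 w (V x))"
      using V[of x] that subs by blast
    also have "\<dots> \<le> 2 ^ d * card (above Y1 w (V x))"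
      using rk3[OF that] by (intro mult_right_mono power_increasing) auto
    finally have "real (card (D x)) \<le> real (2 ^ d * card (above Y1 w (V x)))" by (simp only: of_nat_le_iff)
    then show ?thesis by simp
  qed
  \<comment> \<open>With this value the vertices of \<open>U3\<close> whose flat has fewer than
    \<open>s n\<close> flats \<open>w y\<close> above it carry at most
    \<open>m * 2 ^ d * s n = ?E / 16\<close> incidences.\<close>
  define s where "s = \<epsilon> / (16 * 2 ^ d)"
  have spos: "0 < s" using \<epsilon> by (simp add: s_def)
  define U4 where "U4 = {x \<in> U3. s * n \<le> card (above Y1 w (V x))}"
  have U4: "U4 \<subseteq> U3" "finite U4" using fins by (auto simp: U4_def)
  have "(\<Sum>x\<in>U3 - U4. real (card (D x))) \<le> real (card (U3 - U4)) * (2 ^ d * (s * n))"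
  proof (rule sum_bounded_above)
    fix x assume x: "x \<in> U3 - U4"
    then have "real (card (above Y1 w (V x))) \<le> s * n" by (auto simp: U4_def)
    then have "2 ^ d * real (card (above Y1 w (V x))) \<le> 2 ^ d * (s * n)" by (rule mult_left_mono) simp
    then show "real (card (D x)) \<le> 2 ^ d * (s * n)" using order_trans[OF D3[of x]] x by blast
  qed
  also have "\<dots> \<le> m * (2 ^ d * (s * n))"
    using cU[of "U3 - U4"] subs spos by (intro mult_right_mono) auto
  also have "\<dots> = ?E / 16" by (simp add: s_def)
  finally have "(\<Sum>x\<in>U3 - U4. real (card (D x))) \<le> ?E / 16" .
  moreover have "(\<Sum>x\<in>U3. real (card (D x))) = (\<Sum>x\<in>U3 - U4. real (card (D x))) + (\<Sum>x\<in>U4. real (card (D x)))"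
    using fins U4 by (intro sum.subset_diff)
  ultimately have s5: "?E / 16 \<le> (\<Sum>x\<in>U4. real (card (D x)))" using s4 by simp
  \<comment> \<open>The vertices with the same flat \<open>v\<close>, together with all
    \<open>y\<close> above \<open>v\<close>, form a biclique, so each flat accounts for at most
    \<open>M\<close> up to the factor \<open>2 ^ d\<close>.\<close>
  have "(\<Sum>x\<in>U4. real (card (D x))) \<le> (\<Sum>x\<in>U4. 2 ^ d * real (card (above Y1 w (V x))))"
    using D3 U4 by (intro sum_mono) auto
  also have "\<dots> = (\<Sum>v\<in>V ` U4. \<Sum>x | x \<in> U4 \<and> V x = v. 2 ^ d * real (card (above Y1 w (V x))))"
    by (rule sum.image_gen[OF U4(2)])
  also have "\<dots> \<le> real (card (V ` U4)) * (2 ^ d * real M)"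
  proof (rule sum_bounded_above)
    fix v assume "v \<in> V ` U4"
    have "(\<Sum>x | x \<in> U4 \<and> V x = v. 2 ^ d * real (card (above Y1 w (V x)))) =
        2 ^ d * real (card {x. x \<in> U4 \<and> V x = v} * card (above Y1 w v))" by simp
    also have "card {x. x \<in> U4 \<and> V x = v} * card (above Y1 w v) \<le> M"
    proof (rule M)
      show "{x. x \<in> U4 \<and> V x = v} \<subseteq> U" using U4 subs by auto
      show "above Y1 w v \<subseteq> Y" using Y1 by (auto simp: above_def)
      show "\<forall>a\<in>{x. x \<in> U4 \<and> V x = v}. \<forall>b\<in>above Y1 w v. R a b"
      proof (intro ballI)
        fix a b assume ab: "a \<in> {x. x \<in> U4 \<and> V x = v}" "b \<in> above Y1 w v"
        then have "a \<in> v" using V U4 subs by blast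
        then have "a \<in> nb b" using ab(2) w by (auto simp: above_def)
        then show "R a b" by (simp add: nb_def)
      qed
    qed
    finally show "(\<Sum>x | x \<in> U4 \<and> V x = v. 2 ^ d * real (card (above Y1 w (V x)))) \<le> 2 ^ d * real M"
      by simp
  qed
  finally have s6: "?E / 16 \<le> real (card (V ` U4)) * (2 ^ d * real M)" using s5 by simp
  \<comment> \<open>Each of these flats has at least \<open>s n\<close> flats \<open>w y\<close>
    above it, so the tuple count leaves at most \<open>(2 / s) ^ (d - 2)\<close> of them, whatever
    \<open>m\<close> and \<open>n\<close> are.\<close>
  have "real (card (V ` U4)) * (s * n) ^ (d - 2) \<le> (\<Sum>v\<in>V ` U4. real (card (above Y1 w v)) ^ (d - 2))"
    by (rule sum_bounded_below) (use spos in \<open>auto simp: U4_def intro!: power_mono\<close>)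
  also have "\<dots> \<le> 2 ^ (d - 2) * real n ^ (d - 2)"
    using U4 rk3 by (intro tuples) (auto simp: U3_def)
  finally have "(real (card (V ` U4)) * s ^ (d - 2)) * real n ^ (d - 2) \<le> 2 ^ (d - 2) * real n ^ (d - 2)"
    by (simp add: power_mult_distrib mult_ac)
  then have cV: "real (card (V ` U4)) * s ^ (d - 2) \<le> 2 ^ (d - 2)"
    by (rule mult_right_le_imp_le) (use npos in simp)
  have "s ^ (d - 2) * (?E / 16) \<le> s ^ (d - 2) * (real (card (V ` U4)) * (2 ^ d * real M))"
    using s6 spos by (intro mult_left_mono) auto
  also have "\<dots> = (real (card (V ` U4)) * s ^ (d - 2)) * (2 ^ d * real M)" by simp
  also have "\<dots> \<le> 2 ^ (d - 2) * (2 ^ d * real M)" using cV by (intro mult_right_mono) auto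
  finally have "s ^ (d - 2) * ?E \<le> 16 * (2 ^ (d - 2) * (2 ^ d * real M))" by simp
  then have "(16 * 2 ^ d) ^ (d - 2) * (s ^ (d - 2) * ?E) \<le> (16 * 2 ^ d) ^ (d - 2) * (16 * (2 ^ (d - 2) * (2 ^ d * real M)))"
    by (rule mult_left_mono) simp
  moreover have "(16 * 2 ^ d) ^ (d - 2) * s ^ (d - 2) = \<epsilon> ^ (d - 2)"
  proof -
    have "16 * 2 ^ d * s = \<epsilon>" by (simp add: s_def)
    then show ?thesis unfolding power_mult_distrib[symmetric] by simp
  qed
  moreover have "\<epsilon> ^ (d - 1) = \<epsilon> ^ (d - 2) * \<epsilon>"
  proof -
    have "d - 1 = Suc (d - 2)" using d by simp
    then show ?thesis by simp
  qed
  ultimately show ?thesis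
    unfolding biclique_const_def by (simp only: mult_ac)
qed

end

subsection \<open>The geometry of an affine space\<close>

lemma (in cring) finsum_linear:
  assumes "finite C" "u \<in> C \<rightarrow> carrier R" "v \<in> C \<rightarrow> carrier R" "w \<in> C \<rightarrow> carrier R" "t \<in> carrier R"
  shows "(\<Oplus>k\<in>C. u k \<otimes> (v k \<oplus> t \<otimes> w k)) = (\<Oplus>k\<in>C. u k \<otimes> v k) \<oplus> t \<otimes> (\<Oplus>k\<in>C. u k \<otimes> w k)"
proof -
  have "(\<Oplus>k\<in>C. u k \<otimes> (v k \<oplus> t \<otimes> w k)) = (\<Oplus>k\<in>C. u k \<otimes> v k \<oplus> t \<otimes> (u k \<otimes> w k))"
    by (rule finsum_cong') (use assms in \<open>auto simp: Pi_iff r_distr m_lcomm\<close>)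
  also have "\<dots> = (\<Oplus>k\<in>C. u k \<otimes> v k) \<oplus> (\<Oplus>k\<in>C. t \<otimes> (u k \<otimes> w k))"
    by (rule finsum_addf) (use assms in \<open>auto simp: Pi_iff\<close>)
  also have "(\<Oplus>k\<in>C. t \<otimes> (u k \<otimes> w k)) = t \<otimes> (\<Oplus>k\<in>C. u k \<otimes> w k)"
    using assms by (subst finsum_rdistr) auto
  finally show ?thesis .
qed

text \<open>Elimination of one coordinate \<open>c\<close> with \<open>v r c\<close> nonzero, where
  \<open>r\<close> is the last index: suitable multiples of \<open>v r\<close> are added to the
  other \<open>v j\<close> to make their entry at \<open>c\<close> vanish. The pairings with the
  earlier \<open>u i\<close> do not change, since these are orthogonal to
  \<open>v r\<close>.\<close>

lemma (in field) triangular_le_card: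
  assumes "finite C" "\<forall>i<r. u i \<in> C \<rightarrow> carrier R \<and> v i \<in> C \<rightarrow> carrier R"
    and "\<forall>i<r. (\<Oplus>k\<in>C. u i k \<otimes> v i k) \<noteq> \<zero>"
    and "\<forall>j<r. \<forall>i<j. (\<Oplus>k\<in>C. u i k \<otimes> v j k) = \<zero>"
  shows "r \<le> card C"
  using assms
proof (induction r arbitrary: C v)
  case 0
  then show ?case by simp
next
  case (Suc r)
  have cl: "u i \<in> C \<rightarrow> carrier R" "v i \<in> C \<rightarrow> carrier R" if "i \<le> r" for i
    using Suc.prems(2) that by (auto simp: less_Suc_eq_le)
  have "\<exists>c\<in>C. v r c \<noteq> \<zero>"
  proof (rule ccontr)
    assume "\<not> (\<exists>c\<in>C. v r c \<noteq> \<zero>)"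
    then have "(\<Oplus>k\<in>C. u r k \<otimes> v r k) = (\<Oplus>k\<in>C. \<zero>)"
      using cl[of r] by (intro finsum_cong') (auto simp: Pi_iff)
    then show False using Suc.prems(3) by simp
  qed
  then obtain c where c: "c \<in> C" "v r c \<noteq> \<zero>" by blast
  have vrc: "v r c \<in> carrier R" "v r c \<in> Units R" using cl[of r] c by (auto simp: field_Units)
  define t where "t j = \<ominus> (v j c \<otimes> inv (v r c))" for j
  have t: "t j \<in> carrier R" if "j \<le> r" for j
    using cl[OF that] c vrc by (auto simp: t_def)
  define v' where "v' j k = v j k \<oplus> t j \<otimes> v r k" for j k
  have v': "v' j \<in> C \<rightarrow> carrier R" if "j \<le> r" for j
    using cl[OF that] cl[of r] t[OF that] by (auto simp: v'_def Pi_iff)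
  have v'c: "v' j c = \<zero>" if "j \<le> r" for j
  proof -
    have "v j c \<in> carrier R" using cl[OF that] c by auto
    then show ?thesis using vrc by (simp add: v'_def t_def l_minus m_assoc r_neg)
  qed
  have red: "(\<Oplus>k\<in>C - {c}. u i k \<otimes> v' j k) = (\<Oplus>k\<in>C. u i k \<otimes> v j k)" if "i < r" "j < r" for i j
  proof -
    have ij: "i \<le> r" "j \<le> r" using that by auto
    have "(\<Oplus>k\<in>insert c (C - {c}). u i k \<otimes> v' j k) = u i c \<otimes> v' j c \<oplus> (\<Oplus>k\<in>C - {c}. u i k \<otimes> v' j k)"
      using Suc.prems(1) cl(1)[OF ij(1)] v'[OF ij(2)] c by (intro finsum_insert) auto
    moreover have "insert c (C - {c}) = C" using c by auto
    moreover have "(\<Oplus>k\<in>C - {c}. u i k \<otimes> v' j k) \<in> carrier R"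
      using cl(1)[OF ij(1)] v'[OF ij(2)] by (intro finsum_closed) auto
    moreover have "u i c \<in> carrier R" using cl(1)[OF ij(1)] c by auto
    ultimately have "(\<Oplus>k\<in>C - {c}. u i k \<otimes> v' j k) = (\<Oplus>k\<in>C. u i k \<otimes> v' j k)"
      using v'c[OF ij(2)] by simp
    also have "\<dots> = (\<Oplus>k\<in>C. u i k \<otimes> v j k) \<oplus> t j \<otimes> (\<Oplus>k\<in>C. u i k \<otimes> v r k)"
      unfolding v'_def using Suc.prems(1) cl ij t by (intro finsum_linear) auto
    also have "(\<Oplus>k\<in>C. u i k \<otimes> v r k) = \<zero>" using Suc.prems(4) that by blast
    finally show ?thesis using t[OF ij(2)] cl ij by (simp add: finsum_closed Pi_iff)
  qed
  have "r \<le> card (C - {c})"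
  proof (rule Suc.IH[of _ v'])
    show "finite (C - {c})" using Suc.prems(1) by simp
    show "\<forall>i<r. u i \<in> C - {c} \<rightarrow> carrier R \<and> v' i \<in> C - {c} \<rightarrow> carrier R"
      using cl v' by (auto simp: Pi_iff)
    show "\<forall>i<r. (\<Oplus>k\<in>C - {c}. u i k \<otimes> v' i k) \<noteq> \<zero>" using red Suc.prems(3) by auto
    show "\<forall>j<r. \<forall>i<j. (\<Oplus>k\<in>C - {c}. u i k \<otimes> v' j k) = \<zero>" using red Suc.prems(4) by auto
  qed
  moreover have "card C = Suc (card (C - {c}))"
    using c Suc.prems(1) by (metis card_Suc_Diff1)
  ultimately show ?case by simp
qed

section \<open>Linear forms and hyperplanes in coordinates\<close>

context field
begin

definition lin :: "nat \<Rightarrow> (nat \<Rightarrow> 'a) \<Rightarrow> (nat \<Rightarrow> 'a) \<Rightarrow> 'a" where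
  "lin d a x = (\<Oplus>i\<in>{..<d}. a i \<otimes> x i)"

definition axis :: "nat \<Rightarrow> nat \<Rightarrow> 'a \<Rightarrow> nat \<Rightarrow> 'a" where
  "axis d i c = (\<lambda>j\<in>{..<d}. if j = i then c else \<zero>)"

lemma mem_hyperplane: "x \<in> hyperplane R d a b \<longleftrightarrow> x \<in> aff_space R d \<and> lin d a x = b"
  by (simp add: hyperplane_def lin_def)

lemma aff_spaceD: "x \<in> aff_space R d \<Longrightarrow> i < d \<Longrightarrow> x i \<in> carrier R"
  by (auto simp: aff_space_def)

lemma aff_space_Pi: "x \<in> aff_space R d \<Longrightarrow> x \<in> {..<d} \<rightarrow> carrier R"
  by (auto simp: aff_space_def)

lemma axis_aff: "c \<in> carrier R \<Longrightarrow> axis d i c \<in> aff_space R d"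
  by (auto simp: axis_def aff_space_def)

lemma add_one_neq: "c \<in> carrier R \<Longrightarrow> c \<oplus> \<one> \<noteq> c"
  using add.r_cancel_one[of c \<one>] by simp

lemma lin_closed: "a \<in> aff_space R d \<Longrightarrow> x \<in> aff_space R d \<Longrightarrow> lin d a x \<in> carrier R"
  unfolding lin_def by (rule finsum_closed) (auto dest: aff_spaceD)

lemma lin_comm: "a \<in> aff_space R d \<Longrightarrow> x \<in> aff_space R d \<Longrightarrow> lin d a x = lin d x a"
  unfolding lin_def by (rule finsum_cong') (auto intro: m_comm aff_spaceD)

lemma lin_axis:
  assumes "a \<in> aff_space R d" "c \<in> carrier R" "i < d"
  shows "lin d a (axis d i c) = a i \<otimes> c"
proof -
  have "lin d a (axis d i c) = (\<Oplus>j\<in>{..<d}. if i = j then a j \<otimes> c else \<zero>)"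
    unfolding lin_def by (rule finsum_cong') (use assms in \<open>auto simp: axis_def dest: aff_spaceD\<close>)
  also have "\<dots> = a i \<otimes> c"
    by (rule add.finprod_singleton) (use assms in \<open>auto dest: aff_spaceD\<close>)
  finally show ?thesis .
qed

definition shift :: "nat \<Rightarrow> 'a \<Rightarrow> (nat \<Rightarrow> 'a) \<Rightarrow> (nat \<Rightarrow> 'a) \<Rightarrow> nat \<Rightarrow> 'a" where
  "shift d t x y = (\<lambda>j\<in>{..<d}. x j \<oplus> t \<otimes> y j)"

lemma shift_aff:
  "x \<in> aff_space R d \<Longrightarrow> y \<in> aff_space R d \<Longrightarrow> t \<in> carrier R \<Longrightarrow> shift d t x y \<in> aff_space R d"
  by (auto simp: shift_def aff_space_def)

lemma lin_shift:
  assumes "a \<in> aff_space R d" "x \<in> aff_space R d" "y \<in> aff_space R d" "t \<in> carrier R"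
  shows "lin d a (shift d t x y) = lin d a x \<oplus> t \<otimes> lin d a y"
proof -
  have "lin d a (shift d t x y) = (\<Oplus>k\<in>{..<d}. a k \<otimes> (x k \<oplus> t \<otimes> y k))"
    unfolding lin_def by (rule finsum_cong') (use assms in \<open>auto simp: shift_def intro: aff_spaceD\<close>)
  also have "\<dots> = lin d a x \<oplus> t \<otimes> lin d a y"
    unfolding lin_def by (rule finsum_linear) (use assms aff_space_Pi in auto)
  finally show ?thesis .
qed

lemma hyperplanesE:
  assumes "h \<in> hyperplanes R d"
  obtains a b i where "h = hyperplane R d a b" "a \<in> aff_space R d" "b \<in> carrier R" "i < d" "a i \<noteq> \<zero>"
  using assms unfolding hyperplanes_def by blast

lemma hyperplane_in_hyperplanes:
  "a \<in> aff_space R d \<Longrightarrow> b \<in> carrier R \<Longrightarrow> i < d \<Longrightarrow> a i \<noteq> \<zero> \<Longrightarrow> hyperplane R d a b \<in> hyperplanes R d"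
  unfolding hyperplanes_def by blast

lemma coordinate_hyperplane:
  assumes "i < d" "c \<in> carrier R"
  shows "\<exists>h\<in>hyperplanes R d. \<forall>x\<in>aff_space R d. x \<in> h \<longleftrightarrow> x i = c"
proof
  show "hyperplane R d (axis d i \<one>) c \<in> hyperplanes R d"
    using assms axis_aff[of \<one> d i] by (intro hyperplane_in_hyperplanes[of _ _ _ i]) (auto simp: axis_def)
  show "\<forall>x\<in>aff_space R d. x \<in> hyperplane R d (axis d i \<one>) c \<longleftrightarrow> x i = c"
    using assms by (auto simp: mem_hyperplane lin_comm[OF axis_aff] lin_axis aff_spaceD)
qed

lemma ex_point_value:
  assumes "a \<in> aff_space R d" "i < d" "a i \<noteq> \<zero>" "b \<in> carrier R"
  shows "\<exists>x\<in>aff_space R d. lin d a x = b"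
proof
  have ai: "a i \<in> carrier R" "a i \<in> Units R" using assms aff_spaceD by (auto simp: field_Units)
  show "axis d i (inv (a i) \<otimes> b) \<in> aff_space R d" using ai assms by (intro axis_aff) auto
  show "lin d a (axis d i (inv (a i) \<otimes> b)) = b"
    using ai assms by (simp add: lin_axis flip: m_assoc)
qed

text \<open>If \<open>h\<close> were contained in \<open>h'\<close> and \<open>z\<close> lay in
  \<open>h'\<close> but not in \<open>h\<close>, then every point would be an affine combination of
  \<open>z\<close> and points of \<open>h\<close>. The linear form of \<open>h'\<close> would be
  constant, yet it is nonzero.\<close>

lemma hyperplane_separation:
  assumes "h \<in> hyperplanes R d" "h' \<in> hyperplanes R d" "h \<noteq> h'"
  shows "\<exists>x\<in>aff_space R d. x \<in> h \<and> x \<notin> h'"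
proof (rule ccontr)
  assume "\<not> ?thesis"
  then have sub: "x \<in> h'" if "x \<in> h" for x
    using that assms(1) by (auto simp: hyperplanes_def hyperplane_def)
  obtain a b i where h: "h = hyperplane R d a b" "a \<in> aff_space R d" "b \<in> carrier R" "i < d" "a i \<noteq> \<zero>"
    using hyperplanesE[OF assms(1)] .
  obtain a' b' i' where h': "h' = hyperplane R d a' b'" "a' \<in> aff_space R d" "b' \<in> carrier R" "i' < d" "a' i' \<noteq> \<zero>"
    using hyperplanesE[OF assms(2)] .
  obtain z where z: "z \<in> h'" "z \<notin> h" using sub assms(3) by blast
  have zaff: "z \<in> aff_space R d" "lin d a' z = b'" using z h' by (auto simp: mem_hyperplane)
  obtain p where p: "p \<in> aff_space R d" "lin d a p = b" using ex_point_value[OF h(2,4,5,3)] by blast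
  have "p \<in> h" using p h by (simp add: mem_hyperplane)
  then have p': "lin d a' p = b'" using sub[of p] h' by (simp add: mem_hyperplane)
  define \<delta> where "\<delta> = lin d a z \<ominus> b"
  have az: "lin d a z \<in> carrier R" using h zaff by (intro lin_closed)
  have \<delta>: "\<delta> \<in> carrier R" "\<delta> \<noteq> \<zero>"
    using z zaff h az by (auto simp: \<delta>_def mem_hyperplane)
  have \<delta>u: "\<delta> \<in> Units R" using \<delta> by (simp add: field_Units)
  have all: "lin d a' w = b'" if w: "w \<in> aff_space R d" for w
  proof -
    \<comment> \<open>\<open>w - t(z - p)\<close> lies on \<open>h\<close>, hence on \<open>h'\<close>, and so do \<open>z\<close> and \<open>p\<close>.\<close>
    define t where "t = (lin d a w \<ominus> b) \<otimes> inv \<delta>"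
    have aw: "lin d a w \<in> carrier R" "lin d a' w \<in> carrier R" using h h' w by (auto intro: lin_closed)
    have t: "t \<in> carrier R" using aw h \<delta>u by (auto simp: t_def)
    have t\<delta>: "t \<otimes> \<delta> = lin d a w \<ominus> b" using aw h \<delta>u \<delta> by (simp add: t_def m_assoc)
    define w' where "w' = shift d t (shift d (\<ominus> t) w z) p"
    have w': "w' \<in> aff_space R d" using w zaff p t by (simp add: w'_def shift_aff)
    have "lin d a w' = lin d a w \<oplus> \<ominus> t \<otimes> lin d a z \<oplus> t \<otimes> b"
      using w zaff p t h by (simp add: w'_def lin_shift shift_aff)
    also have "\<dots> = lin d a w \<ominus> t \<otimes> \<delta>"
      unfolding \<delta>_def using aw(1) az t h(3) by algebra
    also have "\<dots> = b" unfolding t\<delta> using aw(1) h(3) by algebra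
    finally have "w' \<in> h" using w' h by (simp add: mem_hyperplane)
    then have "lin d a' w' = b'" using sub h' by (simp add: mem_hyperplane)
    moreover have "lin d a' w' = lin d a' w \<oplus> \<ominus> t \<otimes> b' \<oplus> t \<otimes> b'"
      using w zaff p p' t h' by (simp add: w'_def lin_shift shift_aff)
    moreover have "lin d a' w \<oplus> \<ominus> t \<otimes> b' \<oplus> t \<otimes> b' = lin d a' w"
      using aw(2) t h'(3) by algebra
    ultimately show ?thesis by simp
  qed
  have "b' \<oplus> \<one> = b'" using ex_point_value[OF h'(2,4,5), of "b' \<oplus> \<one>"] all h' by auto
  then show False using add_one_neq h'(3) by blast
qed

text \<open>In homogeneous coordinates a point is \<open>(x, -1)\<close> and a hyperplane
  \<open>(a, b)\<close>; their pairing vanishes exactly on incidence. The additional coordinate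
  accounts for \<open>Suc d\<close>.\<close>

lemma affine_triangular:
  assumes "\<forall>i<r. x i \<in> aff_space R d \<and> y i \<in> hyperplanes R d \<and> x i \<notin> y i"
    and "\<forall>j<r. \<forall>i<j. x i \<in> y j"
  shows "r \<le> Suc d"
proof -
  have "\<forall>i. \<exists>a b. i < r \<longrightarrow> y i = hyperplane R d a b \<and> a \<in> aff_space R d \<and> b \<in> carrier R"
    using assms(1) by (metis hyperplanesE)
  then obtain a b where ab: "\<And>i. i < r \<Longrightarrow> y i = hyperplane R d (a i) (b i) \<and> a i \<in> aff_space R d \<and> b i \<in> carrier R"
    by metis
  define u where "u i k = (if k < d then x i k else \<ominus> \<one>)" for i k
  define v where "v i k = (if k < d then a i k else b i)" for i k
  have u: "u i \<in> {..<Suc d} \<rightarrow> carrier R" if "i < r" for i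
  proof -
    have "x i \<in> aff_space R d" using assms(1) that by blast
    then show ?thesis by (auto simp: u_def aff_spaceD)
  qed
  have v: "v i \<in> {..<Suc d} \<rightarrow> carrier R" if "i < r" for i
    using ab[OF that] by (auto simp: v_def intro: aff_spaceD)
  have dot: "(\<Oplus>k\<in>{..<Suc d}. u i k \<otimes> v j k) = \<zero> \<longleftrightarrow> x i \<in> y j" if "i < r" "j < r" for i j
  proof -
    have xi: "x i \<in> aff_space R d" using assms(1) that by blast
    have bj: "b j \<in> carrier R" and aj: "a j \<in> aff_space R d" using ab[OF that(2)] by auto
    have "(\<Oplus>k\<in>{..<Suc d}. u i k \<otimes> v j k) = u i d \<otimes> v j d \<oplus> (\<Oplus>k\<in>{..<d}. u i k \<otimes> v j k)"
      unfolding lessThan_Suc using u[OF that(1)] v[OF that(2)] by (intro finsum_insert) (auto simp: Pi_iff)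
    also have "(\<Oplus>k\<in>{..<d}. u i k \<otimes> v j k) = lin d (x i) (a j)"
      unfolding lin_def using xi aj by (intro finsum_cong') (auto simp: u_def v_def dest: aff_spaceD)
    also have "\<dots> = lin d (a j) (x i)" using xi aj by (rule lin_comm)
    also have "u i d \<otimes> v j d = \<ominus> b j" using bj by (simp add: u_def v_def l_minus)
    finally have "(\<Oplus>k\<in>{..<Suc d}. u i k \<otimes> v j k) = \<zero> \<longleftrightarrow> lin d (a j) (x i) \<ominus> b j = \<zero>"
      using lin_closed[OF aj xi] bj by (simp add: minus_eq a_comm)
    also have "\<dots> \<longleftrightarrow> lin d (a j) (x i) = b j" using lin_closed[OF aj xi] bj by simp
    finally show ?thesis using ab[OF that(2)] xi by (simp add: mem_hyperplane)
  qed
  have "r \<le> card {..<Suc d}"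
  proof (rule triangular_le_card[of "{..<Suc d}" r u v])
    show "\<forall>i<r. u i \<in> {..<Suc d} \<rightarrow> carrier R \<and> v i \<in> {..<Suc d} \<rightarrow> carrier R"
      using u v by blast
    show "\<forall>i<r. (\<Oplus>k\<in>{..<Suc d}. u i k \<otimes> v i k) \<noteq> \<zero>"
      using dot assms(1) by blast
    show "\<forall>j<r. \<forall>i<j. (\<Oplus>k\<in>{..<Suc d}. u i k \<otimes> v j k) = \<zero>"
      using dot assms(2) by (meson less_trans)
  qed simp
  then show ?thesis by simp
qed

lemma affine_incidence_geometry:
  assumes "1 \<le> d"
  shows "incidence_geometry (aff_space R d) (hyperplanes R d) (\<in>) d"
proof
  fix x y assume xy: "x \<in> aff_space R d" "y \<in> aff_space R d" "x \<noteq> y"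
  then obtain i where "i < d" "x i \<noteq> y i"
    unfolding aff_space_def by (metis PiE_ext lessThan_iff)
  then obtain h where "h \<in> hyperplanes R d" "\<forall>z\<in>aff_space R d. z \<in> h \<longleftrightarrow> z i = x i"
    using coordinate_hyperplane[of i d "x i"] aff_spaceD[OF xy(1)] by blast
  then show "\<exists>h\<in>hyperplanes R d. x \<in> h \<and> y \<notin> h"
    using xy(1,2) \<open>x i \<noteq> y i\<close> by (intro bexI[of _ h]) auto
next
  fix x assume x: "x \<in> aff_space R d"
  have x0: "x 0 \<in> carrier R" using x assms by (simp add: aff_spaceD)
  then obtain h where "h \<in> hyperplanes R d" "\<forall>y\<in>aff_space R d. y \<in> h \<longleftrightarrow> y 0 = x 0 \<oplus> \<one>"
    using coordinate_hyperplane[of 0 d "x 0 \<oplus> \<one>"] assms by auto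
  then show "\<exists>h\<in>hyperplanes R d. x \<notin> h"
    using x add_one_neq[OF x0] by (intro bexI[of _ h]) auto
next
  fix h assume "h \<in> hyperplanes R d"
  then obtain a b i where h: "h = hyperplane R d a b" "a \<in> aff_space R d" "b \<in> carrier R" "i < d" "a i \<noteq> \<zero>"
    by (rule hyperplanesE)
  obtain x where "x \<in> aff_space R d" "lin d a x = b \<oplus> \<one>"
    using ex_point_value[OF h(2,4,5), of "b \<oplus> \<one>"] h(3) by auto
  then show "\<exists>x\<in>aff_space R d. x \<notin> h"
    using add_one_neq[OF h(3)] h(1) mem_hyperplane[of x d a b] by (intro bexI[of _ x]) auto
qed (rule hyperplane_separation affine_triangular; assumption)+

end

section \<open>Bicliques of finite configurations\<close>

lemma finite_rs_set:
  assumes "finite P" "finite H"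
  shows "finite {card A * card B | A B. A \<subseteq> P \<and> B \<subseteq> H \<and> A \<times> B \<subseteq> incidences P H}"
proof -
  have "{card A * card B | A B. A \<subseteq> P \<and> B \<subseteq> H \<and> A \<times> B \<subseteq> incidences P H} \<subseteq>
      (\<lambda>(A, B). card A * card B) ` (Pow P \<times> Pow H)" by auto
  then show ?thesis by (rule finite_subset) (use assms in simp)
qed

lemma biclique_le_rs:
  assumes "finite P" "finite H" "A \<subseteq> P" "B \<subseteq> H" "\<And>x h. x \<in> A \<Longrightarrow> h \<in> B \<Longrightarrow> x \<in> h"
  shows "card A * card B \<le> rs P H"
  unfolding rs_def
proof (rule Max_ge[OF finite_rs_set])
  have "A \<times> B \<subseteq> incidences P H" using assms by (auto simp: incidences_def)
  then show "card A * card B \<in> {card A * card B | A B. A \<subseteq> P \<and> B \<subseteq> H \<and> A \<times> B \<subseteq> incidences P H}"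
    using assms by blast
qed (use assms in auto)

lemma rs_le:
  assumes "finite P" "finite H"
    and "\<And>A B. A \<subseteq> P \<Longrightarrow> B \<subseteq> H \<Longrightarrow> (\<And>x h. x \<in> A \<Longrightarrow> h \<in> B \<Longrightarrow> x \<in> h) \<Longrightarrow> card A * card B \<le> M"
  shows "rs P H \<le> M"
  unfolding rs_def
proof (rule Max.boundedI[OF finite_rs_set])
  show "{card A * card B | A B. A \<subseteq> P \<and> B \<subseteq> H \<and> A \<times> B \<subseteq> incidences P H} \<noteq> {}" by blast
  fix v assume "v \<in> {card A * card B | A B. A \<subseteq> P \<and> B \<subseteq> H \<and> A \<times> B \<subseteq> incidences P H}"
  then obtain A B where v: "v = card A * card B" "A \<subseteq> P" "B \<subseteq> H" "A \<times> B \<subseteq> incidences P H" by blast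
  show "v \<le> M" unfolding v(1)
    by (rule assms(3)[OF v(2,3)]) (use v(4) in \<open>auto simp: incidences_def\<close>)
qed (use assms in auto)

text \<open>The abstract bound wants the side with at most \<open>m\<close> vertices first, so the
  geometry is dualized when that side consists of the hyperplanes.\<close>

theorem config_lower_bound:
  fixes F :: "('a, 'b) ring_scheme" and \<epsilon> :: real
  assumes config: "config F d k l (\<epsilon> * real m * real n) P H" and kl: "(k, l) = (m, n) \<or> (k, l) = (n, m)"
    and d: "2 \<le> d" and \<epsilon>: "0 < \<epsilon>"
    and m: "(100 / \<epsilon>) ^ (d - 1) < real m" and n: "(100 / \<epsilon>) ^ d < real n"
  shows "\<epsilon> ^ (d - 1) * real m * real n \<le> biclique_const d * real (rs P H)"
proof -
  interpret field F using config by (simp add: config_def)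
  interpret G: incidence_geometry "aff_space F d" "hyperplanes F d" "(\<in>)" d
    using d by (intro affine_incidence_geometry) auto
  interpret G': incidence_geometry "hyperplanes F d" "aff_space F d" "\<lambda>h x. x \<in> h" d
    by (rule G.dual)
  have P: "P \<subseteq> aff_space F d" "finite P" "card P \<le> l"
    and H: "H \<subseteq> hyperplanes F d" "finite H" "card H \<le> k"
    and inc: "\<epsilon> * real m * real n \<le> real (card (incidences P H))"
    using config by (simp_all add: config_def)
  show ?thesis
    using kl
  proof
    assume "(k, l) = (n, m)"
    then have kl: "k = n" "l = m" by simp_all
    show ?thesis
    proof (rule G.biclique_lower_bound[OF d P(1,2) _ H(1,2) _ \<epsilon> m n])
      show "\<epsilon> * real m * real n \<le> real (card {(x, y). x \<in> P \<and> y \<in> H \<and> x \<in> y})"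
        using inc by (simp add: incidences_def)
      show "card A * card B \<le> rs P H" if "A \<subseteq> P" "B \<subseteq> H" "\<forall>x\<in>A. \<forall>h\<in>B. x \<in> h" for A B
        by (rule biclique_le_rs[OF P(2) H(2) that(1,2)]) (use that(3) in blast)
    qed (use P(3) H(3) kl in simp_all)
  next
    assume "(k, l) = (m, n)"
    then have kl: "k = m" "l = n" by simp_all
    have "incidences P H = prod.swap ` {(h, x). h \<in> H \<and> x \<in> P \<and> x \<in> h}"
      by (auto simp: incidences_def image_iff)
    then have "card (incidences P H) = card {(h, x). h \<in> H \<and> x \<in> P \<and> x \<in> h}"
      by (simp add: card_image)
    with inc have inc': "\<epsilon> * real m * real n \<le> real (card {(h, x). h \<in> H \<and> x \<in> P \<and> x \<in> h})"
      by simp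
    show ?thesis
    proof (rule G'.biclique_lower_bound[OF d H(1,2) _ P(1,2) _ \<epsilon> m n inc'])
      show "card A * card B \<le> rs P H" if "A \<subseteq> H" "B \<subseteq> P" "\<forall>h\<in>A. \<forall>x\<in>B. x \<in> h" for A B
        unfolding mult.commute[of "card A"]
        by (rule biclique_le_rs[OF P(2) H(2) that(2,1)]) (use that(3) in blast)
    qed (use P(3) H(3) kl in simp_all)
  qed
qed

subsection \<open>Finite fields of characteristic two\<close>

text \<open>One ambient field for all constructions: it is infinite and contains a field with
  \<open>2 ^ j\<close> elements for every positive \<open>j\<close>.\<close>

type_synonym K = "bit alg_closure"

text \<open>Finite subfields, and in addition \<open>{0}\<close>, which plays the part of a field
  with \<open>2 ^ 0 = 1\<close> element. Any other such set contains \<open>x / x = 1\<close>;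
  division by zero gives 0.\<close>

definition division_closed :: "'k::field set \<Rightarrow> bool" where
  "division_closed S \<longleftrightarrow> finite S \<and> 0 \<in> S \<and>
     (\<forall>x\<in>S. \<forall>y\<in>S. x + y \<in> S \<and> x - y \<in> S \<and> x * y \<in> S \<and> x / y \<in> S)"

lemma char_two: "x + x = (0 :: K)"
proof -
  have "(1 :: K) + 1 = to_ac (1 + 1)" by (simp only: to_ac_add to_ac_1)
  also have "\<dots> = 0" by simp
  finally have "x * (1 + 1) = x * 0" by (simp only:)
  then show ?thesis by (simp only: distrib_left mult_1_right mult_zero_right)
qed

lemma uminus_char_two: "- x = (x :: K)"
  using char_two[of x] by (simp add: eq_neg_iff_add_eq_0)

lemma minus_char_two: "x - y = x + (y :: K)"
  by (simp only: diff_conv_add_uminus uminus_char_two)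

lemma power_add_char_two: "(x + y :: K) ^ 2 ^ j = x ^ 2 ^ j + y ^ 2 ^ j"
proof (induction j)
  case (Suc j)
  have sq: "(a + b) ^ 2 = a ^ 2 + b ^ 2" for a b :: K
  proof -
    have "(a + b) ^ 2 = a ^ 2 + b ^ 2 + (a * b + a * b)" by (simp add: power2_eq_square algebra_simps)
    then show ?thesis by (simp add: char_two)
  qed
  have "(x + y) ^ 2 ^ Suc j = ((x + y) ^ 2 ^ j) ^ 2" by (simp add: mult.commute flip: power_mult)
  also have "\<dots> = (x ^ 2 ^ j) ^ 2 + (y ^ 2 ^ j) ^ 2" unfolding Suc.IH by (rule sq)
  finally show ?case by (simp add: mult.commute flip: power_mult)
qed simp

text \<open>The set consists of the roots of \<open>X ^ q - X\<close> with \<open>q = 2 ^ j\<close>.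
  Its derivative is -1 because \<open>q\<close> vanishes in characteristic two, so its
  \<open>q\<close> linear factors over the algebraic closure are distinct. Closure under addition is
  additivity of the Frobenius power.\<close>

lemma division_closed_power_fixed:
  assumes "1 \<le> j"
  shows "division_closed {x :: K. x ^ 2 ^ j = x}" "card {x :: K. x ^ 2 ^ j = x} = 2 ^ j"
proof -
  let ?q = "2 ^ j :: nat"
  have q: "2 \<le> ?q" using power_increasing[OF assms, of "2::nat"] by simp
  define p :: "K poly" where "p = Polynomial.monom 1 ?q - Polynomial.monom 1 1"
  have roots: "{x. poly p x = 0} = {x. x ^ ?q = x}"
    by (auto simp: p_def poly_monom)
  have deg: "Polynomial.degree p = ?q"
    using q unfolding p_def diff_conv_add_uminus
    by (subst degree_add_eq_left) (auto simp: degree_monom_eq)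
  have p0: "p \<noteq> 0" using deg q by auto
  have deriv: "poly (pderiv p) a = -1" for a
  proof -
    obtain i where "j = Suc i" using assms by (cases j) auto
    then have "(of_nat ?q :: K) = 2 ^ i + 2 ^ i" by simp
    then have "(of_nat ?q :: K) = 0" by (simp only: char_two)
    then show ?thesis by (simp add: p_def pderiv_diff pderiv_monom poly_monom)
  qed
  obtain A where A: "size A = Polynomial.degree p" "p = smult (Polynomial.lead_coeff p) (\<Prod>x\<in>#A. [:-x, 1:])"
    using alg_closed_imp_factorization[OF p0] by blast
  have "count A a = 1" if "a \<in># A" for a
  proof (rule ccontr)
    assume "count A a \<noteq> 1"
    with that obtain B where B: "A = add_mset a B" "a \<in># B"
      by (metis count_add_mset count_eq_zero_iff insert_DiffM One_nat_def)
    then obtain C where C: "A = add_mset a (add_mset a C)" by (metis insert_DiffM)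
    define r where "r = smult (Polynomial.lead_coeff p) (\<Prod>x\<in>#C. [:-x, 1:])"
    define l :: "K poly" where "l = [:-a, 1:]"
    have "(\<Prod>x\<in>#A. [:-x, 1:]) = l * (l * (\<Prod>x\<in>#C. [:-x, 1:]))"
      unfolding C l_def by (simp only: image_mset_add_mset prod_mset.add_mset)
    then have "p = l * (l * r)"
      unfolding r_def using A(2) by (metis mult_smult_right)
    moreover have "poly l a = 0" by (simp add: l_def)
    ultimately have "poly (pderiv p) a = 0" by (simp add: pderiv_mult)
    then show False using deriv[of a] by simp
  qed
  then have "card (set_mset A) = size A"
    by (simp add: size_multiset_overloaded_eq)
  moreover have "set_mset A = {x. poly p x = 0}"
    using p0 by (subst A(2)) (auto simp: poly_prod_mset)
  ultimately show card: "card {x :: K. x ^ ?q = x} = ?q"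
    using roots A(1) deg by simp
  have "finite {x :: K. x ^ ?q = x}"
    using poly_roots_finite[OF p0] roots by simp
  then show "division_closed {x :: K. x ^ ?q = x}"
    by (auto simp: division_closed_def minus_char_two power_add_char_two power_mult_distrib power_divide)
qed

lemma ex_division_closed: "\<exists>S :: K set. division_closed S \<and> card S = 2 ^ j"
proof (cases "j = 0")
  case True
  then show ?thesis by (intro exI[of _ "{0}"]) (simp add: division_closed_def)
next
  case False
  then show ?thesis using division_closed_power_fixed[of j] by (intro exI) auto
qed

lemma infinite_K: "infinite (UNIV :: K set)"
proof
  assume fin: "finite (UNIV :: K set)"
  let ?n = "card (UNIV :: K set)"
  obtain S :: "K set" where "card S = 2 ^ ?n" using ex_division_closed by blast
  moreover have "card S \<le> ?n" by (rule card_mono[OF fin]) simp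
  ultimately show False using less_exp[of ?n] by simp
qed

text \<open>For subspaces this is the dimension formula for orthogonal complements. For arbitrary
  sets one coordinate is removed at a time, in such a way that one side loses at most a factor
  \<open>card S\<close> and the other side loses nothing.\<close>

lemma orthogonal_le:
  fixes A B :: "(nat \<Rightarrow> 'k::field) set"
  assumes S: "division_closed S"
  shows "A \<subseteq> {..<N} \<rightarrow>\<^sub>E S \<Longrightarrow> B \<subseteq> {..<N} \<rightarrow>\<^sub>E S \<Longrightarrow> (\<forall>x\<in>A. \<forall>y\<in>B. (\<Sum>i<N. x i * y i) = 0) \<Longrightarrow>
    card A * card B \<le> card S ^ N"
proof (induction N arbitrary: A B)
  case 0
  then have sub: "A \<subseteq> {\<lambda>_. undefined}" "B \<subseteq> {\<lambda>_. undefined}" by simp_all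
  have "card A * card B \<le> 1 * 1"
    using card_mono[OF _ sub(1)] card_mono[OF _ sub(2)] by (intro mult_le_mono) simp_all
  then show ?case by simp
next
  case (Suc N)
  define \<rho> :: "(nat \<Rightarrow> 'k) \<Rightarrow> nat \<Rightarrow> 'k" where "\<rho> x = restrict x {..<N}" for x
  have finS: "finite S" using S by (simp add: division_closed_def)
  have finE: "finite ({..<N} \<rightarrow>\<^sub>E S)" using finS by (intro finite_PiE) auto
  have \<rho>S: "\<rho> x \<in> {..<N} \<rightarrow>\<^sub>E S" if "x \<in> {..<Suc N} \<rightarrow>\<^sub>E S" for x
    by (intro PiE_I) (simp_all add: \<rho>_def PiE_mem[OF that])
  have \<rho>_eq: "x = y" if "x \<in> {..<Suc N} \<rightarrow>\<^sub>E S" "y \<in> {..<Suc N} \<rightarrow>\<^sub>E S" "\<rho> x = \<rho> y" "x N = y N" for x y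
  proof (rule PiE_ext[OF that(1,2)])
    fix i assume "i \<in> {..<Suc N}"
    then show "x i = y i"
      using that(4) fun_cong[OF that(3), of i] by (cases "i = N") (simp_all add: \<rho>_def)
  qed
  \<comment> \<open>The roles are generic: \<open>A\<close> is the side that pays the factor
    \<open>card S\<close>, \<open>B\<close> the side that the restriction preserves. The two cases
    below use it with different sides.\<close>
  have *: "card A * card B \<le> card S ^ Suc N"
    if AB: "A \<subseteq> {..<Suc N} \<rightarrow>\<^sub>E S" "B \<subseteq> {..<Suc N} \<rightarrow>\<^sub>E S" "\<forall>x\<in>A. \<forall>y\<in>B. (\<Sum>i<Suc N. x i * y i) = 0"
      and g: "g ` A \<subseteq> {..<N} \<rightarrow>\<^sub>E S" "inj_on (\<lambda>x. (g x, x N)) A" and h: "inj_on \<rho> B"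
      and orth: "\<And>x y. x \<in> A \<Longrightarrow> y \<in> B \<Longrightarrow> (\<Sum>i<N. g x i * y i) = 0" for A B g
  proof -
    have finA: "finite (g ` A)" using finite_subset[OF g(1) finE] .
    have "card A = card ((\<lambda>x. (g x, x N)) ` A)" using g(2) by (simp add: card_image)
    also have "\<dots> \<le> card (g ` A \<times> S)" using finA finS AB(1) by (intro card_mono) auto
    finally have cA: "card A \<le> card (g ` A) * card S" by (simp add: card_cartesian_product)
    have "card (g ` A) * card (\<rho> ` B) \<le> card S ^ N"
    proof (rule Suc.IH[OF g(1)])
      show "\<rho> ` B \<subseteq> {..<N} \<rightarrow>\<^sub>E S" using AB(2) by (intro image_subsetI \<rho>S) blast
      show "\<forall>x\<in>g ` A. \<forall>y\<in>\<rho> ` B. (\<Sum>i<N. x i * y i) = 0"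
        using orth by (simp add: \<rho>_def)
    qed
    then have gB: "card (g ` A) * card B \<le> card S ^ N" using h by (simp add: card_image)
    have "card A * card B \<le> card (g ` A) * card S * card B" using cA by (rule mult_right_mono) simp
    also have "\<dots> = card S * (card (g ` A) * card B)" by (simp only: mult_ac)
    also have "\<dots> \<le> card S * card S ^ N" using gB by (rule mult_left_mono) simp
    finally show ?thesis by simp
  qed
  have inA: "x \<in> {..<Suc N} \<rightarrow>\<^sub>E S" if "x \<in> A" for x by (rule subsetD[OF Suc.prems(1) that])
  have inB: "x \<in> {..<Suc N} \<rightarrow>\<^sub>E S" if "x \<in> B" for x by (rule subsetD[OF Suc.prems(2) that])
  show ?case
  proof (cases "\<forall>x\<in>A. x N = 0")
    case True
    have "card B * card A \<le> card S ^ Suc N"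
    proof (rule *[of B A \<rho>, OF Suc.prems(2,1)])
      show "inj_on (\<lambda>x. (\<rho> x, x N)) B"
        by (rule inj_onI, rule \<rho>_eq[OF inB inB]) simp_all
      show "inj_on \<rho> A"
        by (rule inj_onI, rule \<rho>_eq[OF inA inA]) (simp_all add: True)
      show "(\<Sum>i<N. \<rho> x i * y i) = 0" if "x \<in> B" "y \<in> A" for x y
      proof -
        have "(\<Sum>i<N. \<rho> x i * y i) = (\<Sum>i<N. y i * x i)"
          by (rule sum.cong) (auto simp: \<rho>_def)
        moreover have "(\<Sum>i<Suc N. y i * x i) = 0" "y N = 0" using Suc.prems(3) True that by blast+
        ultimately show ?thesis by simp
      qed
      show "\<forall>x\<in>B. \<forall>y\<in>A. (\<Sum>i<Suc N. x i * y i) = 0"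
        using Suc.prems(3) by (subst mult.commute) blast
      show "\<rho> ` B \<subseteq> {..<N} \<rightarrow>\<^sub>E S" using Suc.prems(2) by (intro image_subsetI \<rho>S) blast
    qed
    then show ?thesis by (simp add: mult.commute)
  next
    case False
    then obtain z where z: "z \<in> A" "z N \<noteq> 0" by blast
    \<comment> \<open>Subtracting a multiple of \<open>z\<close> clears the last coordinate of
      \<open>x\<close>, and orthogonality to \<open>z\<close> determines the last coordinate of each
      element of \<open>B\<close> from the others.\<close>
    define g where "g x = (\<lambda>i\<in>{..<N}. x i - x N / z N * z i)" for x
    have zS: "z i \<in> S" if "i < Suc N" for i using PiE_mem[OF inA[OF z(1)]] that by simp
    show ?thesis
    proof (rule *[of A B g, OF Suc.prems])
      show "g ` A \<subseteq> {..<N} \<rightarrow>\<^sub>E S"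
      proof (clarsimp simp: g_def)
        fix x i assume "x \<in> A" "i < N"
        then have "x i \<in> S" "x N \<in> S" using PiE_mem[OF inA] by simp_all
        then show "x i - x N * z i / z N \<in> S"
          using S zS[of i] zS[of N] \<open>i < N\<close> by (simp add: division_closed_def)
      qed
      show "inj_on (\<lambda>x. (g x, x N)) A"
      proof (rule inj_onI)
        fix x y assume xy: "x \<in> A" "y \<in> A" "(g x, x N) = (g y, y N)"
        then have gxy: "g x = g y" "x N = y N" by auto
        have "\<rho> x = \<rho> y"
        proof
          fix i show "\<rho> x i = \<rho> y i"
            using fun_cong[OF gxy(1), of i] gxy(2) by (auto simp: \<rho>_def g_def split: if_splits)
        qed
        then show "x = y" using \<rho>_eq[OF inA inA] xy gxy(2) by blast
      qed
      show "inj_on \<rho> B"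
      proof (rule inj_onI)
        fix x y assume xy: "x \<in> B" "y \<in> B" "\<rho> x = \<rho> y"
        have "(\<Sum>i<N. z i * x i) = (\<Sum>i<N. z i * y i)"
        proof (rule sum.cong)
          show "z i * x i = z i * y i" if "i \<in> {..<N}" for i
            using fun_cong[OF xy(3), of i] that by (simp add: \<rho>_def)
        qed simp
        moreover have "(\<Sum>i<Suc N. z i * x i) = 0" "(\<Sum>i<Suc N. z i * y i) = 0"
          using Suc.prems(3) z(1) xy by auto
        ultimately have "(\<Sum>i<N. z i * y i) + z N * x N = (\<Sum>i<N. z i * y i) + z N * y N"
          by (simp only: sum.lessThan_Suc)
        then have "z N * x N = z N * y N" by (rule add_left_imp_eq)
        then have "x N = y N" using z(2) by simp
        then show "x = y" using \<rho>_eq[OF inB inB] xy by blast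
      qed
      show "(\<Sum>i<N. g x i * y i) = 0" if xy: "x \<in> A" "y \<in> B" for x y
      proof -
        have "(\<Sum>i<N. g x i * y i) = (\<Sum>i<N. x i * y i - x N / z N * (z i * y i))"
          by (rule sum.cong) (auto simp: g_def algebra_simps)
        also have "\<dots> = (\<Sum>i<N. x i * y i) - x N / z N * (\<Sum>i<N. z i * y i)"
          by (simp add: sum_subtractf sum_distrib_left)
        also have "(\<Sum>i<N. x i * y i) = - (x N * y N)"
          using Suc.prems(3) xy by (simp add: add_eq_0_iff2)
        also have "(\<Sum>i<N. z i * y i) = - (z N * y N)"
          using Suc.prems(3) xy z(1) by (simp add: add_eq_0_iff2)
        finally show ?thesis using z(2) by simp
      qed
    qed
  qed
qed

subsection \<open>Generic unions of configurations\<close>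

abbreviation KR :: "K ring" where
  "KR \<equiv> ring_of_type_algebra"

lemma type_ring_simps [simp]:
  "carrier (ring_of_type_algebra :: 'k::field ring) = UNIV"
  "\<zero>\<^bsub>ring_of_type_algebra :: 'k ring\<^esub> = 0"
  "x \<otimes>\<^bsub>ring_of_type_algebra :: 'k ring\<^esub> y = x * y"
  "x \<oplus>\<^bsub>ring_of_type_algebra :: 'k ring\<^esub> y = x + y"
  by (simp_all add: ring_of_type_algebra_def)

lemma finsum_type_ring:
  fixes f :: "'c \<Rightarrow> 'k::field"
  assumes "finite C"
  shows "finsum (ring_of_type_algebra :: 'k ring) f C = sum f C"
proof -
  interpret R: cring "ring_of_type_algebra :: 'k ring" by (rule cring_from_type_algebra)
  show ?thesis
    using assms by (induction C rule: finite_induct) (simp_all add: R.finsum_insert)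
qed

lemma aff_space_type: "aff_space (ring_of_type_algebra :: 'k::field ring) d = {..<d} \<rightarrow>\<^sub>E UNIV"
  by (simp add: aff_space_def)

lemma mem_hyperplane_type:
  "x \<in> hyperplane (ring_of_type_algebra :: 'k::field ring) d a b \<longleftrightarrow>
    x \<in> {..<d} \<rightarrow>\<^sub>E UNIV \<and> (\<Sum>i<d. a i * x i) = b"
  by (simp add: hyperplane_def aff_space_type finsum_type_ring)

lemma hyperplanes_type:
  "hyperplanes (ring_of_type_algebra :: 'k::field ring) d =
    {hyperplane ring_of_type_algebra d a b | a b. a \<in> {..<d} \<rightarrow>\<^sub>E UNIV \<and> (\<exists>i<d. a i \<noteq> 0)}"
  by (simp add: hyperplanes_def aff_space_type)

text \<open>Unlike in \<open>config\<close> the cardinalities are exact, so that incidence densities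
  are meaningful when configurations are united or thinned out.\<close>

definition realizable :: "nat \<Rightarrow> nat \<Rightarrow> nat \<Rightarrow> real \<Rightarrow> nat \<Rightarrow> bool" where
  "realizable d p h \<iota> M \<longleftrightarrow> (\<exists>P H. P \<subseteq> aff_space KR d \<and> H \<subseteq> hyperplanes KR d \<and> finite P \<and> finite H \<and>
     card P = p \<and> card H = h \<and> \<iota> \<le> real (card (incidences P H)) \<and> rs P H \<le> M)"

lemma realizable_rs_values:
  assumes "realizable d p h \<iota> M" "h \<le> k" "p \<le> l" "I \<le> \<iota>"
  shows "\<exists>v \<in> rs_values d k l I. v \<le> M"
proof -
  obtain P H where PH: "P \<subseteq> aff_space KR d" "H \<subseteq> hyperplanes KR d" "finite P" "finite H"
    "card P = p" "card H = h" "\<iota> \<le> real (card (incidences P H))" "rs P H \<le> M"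
    using assms(1) by (auto simp: realizable_def)
  then have "config KR d k l I P H"
    using assms(2-4) field_from_type_algebra by (auto simp: config_def)
  then show ?thesis using rs_in_rs_values PH(8) by blast
qed

text \<open>Removing an element whose value is at most the average does not lower the
  average.\<close>

lemma ex_subset_sum_ge:
  fixes f :: "'c \<Rightarrow> real" and c :: real
  assumes "finite P" "c * card P \<le> sum f P" "k \<le> card P"
  shows "\<exists>Q\<subseteq>P. card Q = k \<and> c * k \<le> sum f Q"
  using assms
proof (induction "card P - k" arbitrary: P)
  case 0
  then have "card P = k" by simp
  then show ?case using 0(3) by (intro exI[of _ P]) simp
next
  case (Suc j)
  have ne: "P \<noteq> {}" using Suc.hyps(2) by (cases "P = {}") simp_all
  then have N: "0 < real (card P)" using Suc.prems(1) by (simp add: card_gt_0_iff)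
  have "\<exists>x\<in>P. f x * card P \<le> sum f P"
  proof (rule ccontr)
    assume "\<not> ?thesis"
    then have "(\<Sum>x\<in>P. sum f P) < (\<Sum>x\<in>P. f x * card P)"
      by (intro sum_strict_mono Suc.prems(1) ne) (simp add: not_le)
    then show False by (simp add: mult.commute flip: sum_distrib_right)
  qed
  then obtain x where x: "x \<in> P" "f x * card P \<le> sum f P" by blast
  have "c * card P * (real (card P) - 1) \<le> sum f P * (real (card P) - 1)"
    by (rule mult_right_mono[OF Suc.prems(2)]) (use N in simp)
  also have "\<dots> = sum f P * card P - sum f P" by (simp only: right_diff_distrib mult_1_right)
  also have "\<dots> \<le> (sum f P - f x) * card P" using x(2) unfolding left_diff_distrib by linarith
  finally have "(c * (real (card P) - 1)) * card P \<le> (sum f P - f x) * card P"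
    by (simp only: mult_ac)
  then have "c * (real (card P) - 1) \<le> sum f P - f x"
    using N by (rule mult_right_le_imp_le)
  moreover have "real (card (P - {x})) = real (card P) - 1"
    using x(1) Suc.prems(1) N by (simp add: card_Diff_singleton of_nat_diff)
  moreover have "sum f (P - {x}) = sum f P - f x" using x(1) Suc.prems(1) by (simp add: sum_diff1)
  ultimately have sumPx: "c * card (P - {x}) \<le> sum f (P - {x})" by (simp only:)
  have "card (P - {x}) = card P - 1" using x(1) Suc.prems(1) by simp
  then have "j = card (P - {x}) - k" "k \<le> card (P - {x})" using Suc.hyps(2) by linarith+
  moreover have "finite (P - {x})" using Suc.prems(1) by simp
  ultimately obtain Q where "Q \<subseteq> P - {x}" "card Q = k" "c * k \<le> sum f Q"
    using Suc.hyps(1)[of "P - {x}"] sumPx by blast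
  then show ?case by blast
qed

lemma card_incidences:
  assumes "finite P" "finite H"
  shows "card (incidences P H) = (\<Sum>x\<in>P. card {h \<in> H. x \<in> h})"
    and "card (incidences P H) = (\<Sum>h\<in>H. card {x \<in> P. x \<in> h})"
proof -
  have "incidences P H = (SIGMA x:P. {h \<in> H. x \<in> h})" by (auto simp: incidences_def)
  then show "card (incidences P H) = (\<Sum>x\<in>P. card {h \<in> H. x \<in> h})"
    using assms by simp
  have "incidences P H = prod.swap ` (SIGMA h:H. {x \<in> P. x \<in> h})"
    by (auto simp: incidences_def image_iff)
  then show "card (incidences P H) = (\<Sum>h\<in>H. card {x \<in> P. x \<in> h})"
    using assms by (simp add: card_image)
qed

lemma rs_mono:
  assumes "finite P" "finite H" "P' \<subseteq> P" "H' \<subseteq> H"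
  shows "rs P' H' \<le> rs P H"
proof (rule rs_le)
  show "finite P'" "finite H'" using assms finite_subset by blast+
  show "card A * card B \<le> rs P H"
    if "A \<subseteq> P'" "B \<subseteq> H'" "\<And>x h. x \<in> A \<Longrightarrow> h \<in> B \<Longrightarrow> x \<in> h" for A B
    by (rule biclique_le_rs[OF assms(1,2) subset_trans[OF that(1) assms(3)] subset_trans[OF that(2) assms(4)] that(3)])
qed

lemma realizable_restrict:
  fixes \<delta> :: real
  assumes "realizable d p h (\<delta> * p * h) M" "p' \<le> p" "h' \<le> h"
  shows "realizable d p' h' (\<delta> * p' * h') M"
proof -
  obtain P H where PH: "P \<subseteq> aff_space KR d" "H \<subseteq> hyperplanes KR d" "finite P" "finite H"
    "card P = p" "card H = h" "\<delta> * p * h \<le> real (card (incidences P H))" "rs P H \<le> M"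
    using assms(1) by (auto simp: realizable_def)
  have "(\<delta> * h) * card P \<le> (\<Sum>x\<in>P. real (card {h \<in> H. x \<in> h}))"
    using PH(7) card_incidences(1)[OF PH(3,4)] PH(5) by (simp add: mult_ac)
  from ex_subset_sum_ge[OF PH(3) this, of p'] obtain P'
    where P': "P' \<subseteq> P" "card P' = p'" "(\<delta> * h) * p' \<le> (\<Sum>x\<in>P'. real (card {h \<in> H. x \<in> h}))"
    using PH(5) assms(2) by auto
  have finP': "finite P'" using P'(1) PH(3) by (rule finite_subset)
  have "(\<delta> * p') * card H \<le> (\<Sum>h\<in>H. real (card {x \<in> P'. x \<in> h}))"
    using P'(3) card_incidences[OF finP' PH(4)] PH(6) by (simp add: mult_ac flip: of_nat_sum)
  from ex_subset_sum_ge[OF PH(4) this, of h'] obtain H'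
    where H': "H' \<subseteq> H" "card H' = h'" "(\<delta> * p') * h' \<le> (\<Sum>h\<in>H'. real (card {x \<in> P'. x \<in> h}))"
    using PH(6) assms(3) by auto
  have finH': "finite H'" using H'(1) PH(4) by (rule finite_subset)
  have "\<delta> * p' * h' \<le> real (card (incidences P' H'))"
    using H'(3) card_incidences(2)[OF finP' finH'] by (simp flip: of_nat_sum)
  moreover have "rs P' H' \<le> M" using rs_mono[OF PH(3,4) P'(1) H'(1)] PH(8) by (rule order_trans)
  moreover have "P' \<subseteq> aff_space KR d" "H' \<subseteq> hyperplanes KR d"
    using subset_trans[OF P'(1) PH(1)] subset_trans[OF H'(1) PH(2)] by simp_all
  ultimately show ?thesis
    unfolding realizable_def using P'(2) H'(2) finP' finH'
    by - (intro exI[of _ P'] exI[of _ H'] conjI; assumption)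
qed

text \<open>The vector is sought on the moment curve. Each forbidden equation becomes a polynomial
  in the curve parameter, nonzero because the exponents start at 1 and cannot cancel against the
  constant \<open>c\<close>; an infinite field has a parameter that avoids all the roots.\<close>

lemma avoid_values:
  fixes E :: "((nat \<Rightarrow> K) \<times> K) set"
  assumes "finite E" "\<And>a c. (a, c) \<in> E \<Longrightarrow> \<exists>i<d. a i \<noteq> 0"
  shows "\<exists>v. \<forall>(a, c)\<in>E. (\<Sum>i<d. a i * v i) \<noteq> c"
proof -
  define q where "q = (\<lambda>(a, c). (\<Sum>i<d. Polynomial.monom (a i) (Suc i)) - [:c :: K:])"
  have poly_q: "poly (q (a, c)) s = (\<Sum>i<d. a i * s ^ Suc i) - c" for a c s
    by (simp add: q_def poly_sum poly_monom)
  have "q (a, c) \<noteq> 0" if ac: "(a, c) \<in> E" for a c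
  proof -
    obtain i where i: "i < d" "a i \<noteq> 0" using assms(2)[OF ac] by blast
    have "Polynomial.coeff (q (a, c)) (Suc i) = (\<Sum>j<d. if j = i then a j else 0)"
      by (simp add: q_def coeff_sum coeff_diff cong: if_cong)
    also have "\<dots> = a i" using i by simp
    finally show ?thesis using i by auto
  qed
  then have "finite {s. poly (q e) s = 0}" if "e \<in> E" for e
    using that by (cases e) (auto intro!: poly_roots_finite)
  then have "finite (\<Union>e\<in>E. {s. poly (q e) s = 0})" using assms(1) by blast
  then obtain s where s: "s \<notin> (\<Union>e\<in>E. {s. poly (q e) s = 0})"
    using infinite_K ex_new_if_finite by blast
  have "(\<Sum>i<d. a i * s ^ Suc i) \<noteq> c" if "(a, c) \<in> E" for a c
    using s that poly_q[of a c s] by auto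
  then show ?thesis by (intro exI[of _ "\<lambda>i. s ^ Suc i"]) blast
qed

section \<open>Translates in general position\<close>

definition translate :: "nat \<Rightarrow> (nat \<Rightarrow> 'k::field) \<Rightarrow> (nat \<Rightarrow> 'k) \<Rightarrow> nat \<Rightarrow> 'k" where
  "translate d v x = (\<lambda>i\<in>{..<d}. x i + v i)"

lemma translate_aff: "translate d v x \<in> {..<d} \<rightarrow>\<^sub>E UNIV"
  by (auto simp: translate_def)

lemma translate_inverse:
  "x \<in> {..<d} \<rightarrow>\<^sub>E UNIV \<Longrightarrow> translate d v (translate d (\<lambda>i. - v i) x) = x"
  "x \<in> {..<d} \<rightarrow>\<^sub>E UNIV \<Longrightarrow> translate d (\<lambda>i. - v i) (translate d v x) = x"
  by (auto simp: translate_def fun_eq_iff PiE_def extensional_def)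

lemma inj_translate: "inj_on (translate d v) ({..<d} \<rightarrow>\<^sub>E UNIV)"
  by (rule inj_on_inverseI) (rule translate_inverse(2))

lemma sum_translate: "(\<Sum>i<d. a i * translate d v x i) = (\<Sum>i<d. a i * x i) + (\<Sum>i<d. a i * v i)"
  by (simp add: translate_def distrib_left sum.distrib)

lemma translate_hyperplane:
  "translate d v ` hyperplane ring_of_type_algebra d a b =
    hyperplane ring_of_type_algebra d a (b + (\<Sum>i<d. a i * v i))"
proof (intro equalityI subsetI)
  fix x assume x: "x \<in> hyperplane ring_of_type_algebra d a (b + (\<Sum>i<d. a i * v i))"
  then have "x = translate d v (translate d (\<lambda>i. - v i) x)"
    by (simp add: translate_inverse mem_hyperplane_type)
  moreover have "translate d (\<lambda>i. - v i) x \<in> hyperplane ring_of_type_algebra d a b"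
    using x by (simp add: mem_hyperplane_type translate_aff sum_translate sum_negf)
  ultimately show "x \<in> translate d v ` hyperplane ring_of_type_algebra d a b" by blast
next
  fix x assume "x \<in> translate d v ` hyperplane ring_of_type_algebra d a b"
  then obtain y where "y \<in> hyperplane ring_of_type_algebra d a b" "x = translate d v y" by blast
  then show "x \<in> hyperplane ring_of_type_algebra d a (b + (\<Sum>i<d. a i * v i))"
    by (simp add: mem_hyperplane_type translate_aff sum_translate)
qed

text \<open>The second configuration is moved by a generic vector so that no point of one part lies
  on a hyperplane of the other. Incidences then add up while the largest biclique does not
  grow.\<close>

lemma realizable_union:
  assumes d: "1 \<le> d" and "realizable d p1 h1 \<iota>1 M" "realizable d p2 h2 \<iota>2 M"
  shows "realizable d (p1 + p2) (h1 + h2) (\<iota>1 + \<iota>2) M"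
proof -
  interpret F: field KR by (rule field_from_type_algebra)
  obtain P1 H1 where 1: "P1 \<subseteq> aff_space KR d" "H1 \<subseteq> hyperplanes KR d" "finite P1" "finite H1"
    "card P1 = p1" "card H1 = h1" "\<iota>1 \<le> real (card (incidences P1 H1))" "rs P1 H1 \<le> M"
    using assms(2) by (auto simp: realizable_def)
  obtain P2 H2 where 2: "P2 \<subseteq> aff_space KR d" "H2 \<subseteq> hyperplanes KR d" "finite P2" "finite H2"
    "card P2 = p2" "card H2 = h2" "\<iota>2 \<le> real (card (incidences P2 H2))" "rs P2 H2 \<le> M"
    using assms(3) by (auto simp: realizable_def)
  have "\<forall>h\<in>H1 \<union> H2. \<exists>a b x. h = hyperplane KR d a b \<and> a \<in> {..<d} \<rightarrow>\<^sub>E UNIV \<and> (\<exists>i<d. a i \<noteq> 0) \<and> x \<in> h"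
  proof
    fix h assume "h \<in> H1 \<union> H2"
    then have "h \<in> hyperplanes KR d" using 1(2) 2(2) by blast
    then obtain a b i where h: "h = hyperplane KR d a b" "a \<in> aff_space KR d" "i < d" "a i \<noteq> \<zero>\<^bsub>KR\<^esub>"
      by (rule F.hyperplanesE)
    obtain x where "x \<in> aff_space KR d" "F.lin d a x = b"
      using F.ex_point_value[OF h(2-4), of b] by auto
    then have "x \<in> h" using h(1) by (simp add: F.mem_hyperplane)
    then show "\<exists>a b x. h = hyperplane KR d a b \<and> a \<in> {..<d} \<rightarrow>\<^sub>E UNIV \<and> (\<exists>i<d. a i \<noteq> 0) \<and> x \<in> h"
      using h by (auto simp: aff_space_type)
  qed
  then obtain a b z where h: "\<And>h. h \<in> H1 \<union> H2 \<Longrightarrow> h = hyperplane KR d (a h) (b h) \<and>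
      a h \<in> {..<d} \<rightarrow>\<^sub>E UNIV \<and> (\<exists>i<d. a h i \<noteq> 0) \<and> z h \<in> h"
    by metis
  define dot :: "(nat \<Rightarrow> K) \<Rightarrow> (nat \<Rightarrow> K) \<Rightarrow> K" where "dot a x = (\<Sum>i<d. a i * x i)" for a x
  define e0 :: "nat \<Rightarrow> K" where "e0 i = (if i = 0 then 1 else 0)" for i
  \<comment> \<open>A point on each hyperplane of \<open>H1\<close> is included: translates of
    \<open>H2\<close> that avoid these points differ from all members of \<open>H1\<close>.\<close>
  define Q where "Q = P1 \<union> z ` H1"
  \<comment> \<open>The values to be avoided: a translated point on a hyperplane of
    \<open>H1\<close>, a translated hyperplane through a point of \<open>Q\<close>, and a translated
    point equal to a point of \<open>P1\<close>, the last already prevented in coordinate 0.\<close>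
  define E where "E = (\<lambda>(h, x). (a h, b h - dot (a h) x)) ` (H1 \<times> P2) \<union>
    (\<lambda>(h, x). (a h, dot (a h) x - b h)) ` (H2 \<times> Q) \<union>
    (\<lambda>(x, y). (e0, x 0 - y 0)) ` (P1 \<times> P2)"
  have "finite E" unfolding E_def Q_def using 1 2 by simp
  moreover have "\<exists>i<d. a i \<noteq> 0" if "(a, c) \<in> E" for a c
    using that h d unfolding E_def by (auto simp: e0_def)
  ultimately obtain v where v: "\<And>a c. (a, c) \<in> E \<Longrightarrow> dot a v \<noteq> c"
    using avoid_values[of E d] unfolding dot_def by blast
  define \<tau> where "\<tau> = translate d v"
  have \<tau>_dot: "dot a (\<tau> x) = dot a x + dot a v" for a x
    unfolding dot_def \<tau>_def by (rule sum_translate)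
  have \<tau>_h: "\<tau> ` h = hyperplane KR d (a h) (b h + dot (a h) v)" if "h \<in> H2" for h
  proof -
    have "h = hyperplane KR d (a h) (b h)" using h that by blast
    then show ?thesis unfolding \<tau>_def dot_def by (metis translate_hyperplane)
  qed
  have mem: "x \<in> h \<longleftrightarrow> x \<in> {..<d} \<rightarrow>\<^sub>E UNIV \<and> dot (a h) x = b h" if "h \<in> H1" for h x
  proof -
    have "h = hyperplane KR d (a h) (b h)" using h that by blast
    then show ?thesis using mem_hyperplane_type[of x d "a h" "b h"] unfolding dot_def by simp
  qed
  have avoid1: "\<tau> x \<notin> h" if "x \<in> P2" "h \<in> H1" for x h
  proof
    assume "\<tau> x \<in> h"
    then have "dot (a h) v = b h - dot (a h) x" using mem that by (simp add: \<tau>_dot algebra_simps)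
    moreover have "(a h, b h - dot (a h) x) \<in> E" using that by (force simp: E_def)
    ultimately show False using v by blast
  qed
  have avoid2: "x \<notin> \<tau> ` h" if "x \<in> Q" "h \<in> H2" for x h
  proof
    assume "x \<in> \<tau> ` h"
    then have "dot (a h) x = b h + dot (a h) v"
      using \<tau>_h[OF that(2)] by (simp add: mem_hyperplane_type dot_def)
    then have "dot (a h) v = dot (a h) x - b h" by simp
    moreover have "(a h, dot (a h) x - b h) \<in> E" using that by (force simp: E_def)
    ultimately show False using v by blast
  qed
  have avoid3: "\<tau> y \<noteq> x" if "x \<in> P1" "y \<in> P2" for x y
  proof
    assume "\<tau> y = x"
    then have "x 0 = y 0 + v 0" using d by (auto simp: \<tau>_def translate_def)
    moreover have "dot e0 v = v 0"
    proof -
      have "dot e0 v = (\<Sum>i<d. if i = 0 then v i else 0)"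
        unfolding dot_def e0_def by (rule sum.cong) auto
      then show ?thesis using d by simp
    qed
    moreover have "(e0, x 0 - y 0) \<in> E" using that by (force simp: E_def)
    ultimately show False using v[of e0 "x 0 - y 0"] by simp
  qed
  have aff: "P1 \<subseteq> {..<d} \<rightarrow>\<^sub>E UNIV" "P2 \<subseteq> {..<d} \<rightarrow>\<^sub>E UNIV"
    using 1(1) 2(1) by (simp_all add: aff_space_type)
  have injP: "inj_on \<tau> P2" unfolding \<tau>_def by (rule inj_on_subset[OF inj_translate aff(2)])
  have subH: "h \<subseteq> {..<d} \<rightarrow>\<^sub>E UNIV" if "h \<in> H2" for h
  proof
    fix x assume "x \<in> h"
    moreover have "h = hyperplane KR d (a h) (b h)" using h that by blast
    ultimately show "x \<in> {..<d} \<rightarrow>\<^sub>E UNIV" using mem_hyperplane_type[of x d "a h" "b h"] by simp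
  qed
  have injH: "inj_on ((`) \<tau>) H2"
  proof (rule inj_onI)
    fix h k assume hk: "h \<in> H2" "k \<in> H2" "\<tau> ` h = \<tau> ` k"
    then show "h = k"
      using inj_on_image_eq_iff[OF inj_translate[of d v] subH[OF hk(1)] subH[OF hk(2)]] by (simp add: \<tau>_def)
  qed
  have mem2: "\<tau> x \<in> \<tau> ` h \<longleftrightarrow> x \<in> h" if "x \<in> P2" "h \<in> H2" for x h
    unfolding \<tau>_def by (rule inj_on_image_mem_iff[OF inj_translate _ subH[OF that(2)]]) (use that aff in blast)
  have rs_translate: "rs (\<tau> ` P2) ((`) \<tau> ` H2) = rs P2 H2"
  proof (rule rs_image[OF injP injH])
    fix x h assume "x \<in> P2" "h \<in> H2"
    then show "\<tau> x \<in> \<tau> ` h \<longleftrightarrow> x \<in> h" by (rule mem2)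
  qed
  have inc_translate: "card (incidences (\<tau> ` P2) ((`) \<tau> ` H2)) = card (incidences P2 H2)"
  proof (rule card_incidences_image[OF injP injH])
    fix x h assume "x \<in> P2" "h \<in> H2"
    then show "\<tau> x \<in> \<tau> ` h \<longleftrightarrow> x \<in> h" by (rule mem2)
  qed
  define P where "P = P1 \<union> \<tau> ` P2"
  define H where "H = H1 \<union> (`) \<tau> ` H2"
  have disjP: "P1 \<inter> \<tau> ` P2 = {}" using avoid3 by blast
  have disjH: "H1 \<inter> (`) \<tau> ` H2 = {}"
  proof -
    have "h \<noteq> \<tau> ` k" if hk: "h \<in> H1" "k \<in> H2" for h k
    proof -
      have "z h \<in> h" using h hk(1) by blast
      moreover have "z h \<notin> \<tau> ` k" using hk by (intro avoid2) (auto simp: Q_def)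
      ultimately show ?thesis by blast
    qed
    then show ?thesis by blast
  qed
  have fin: "finite P" "finite H" using 1 2 by (simp_all add: P_def H_def)
  have "card P = p1 + p2"
    unfolding P_def using 1 2 disjP injP by (subst card_Un_disjoint) (auto simp: card_image)
  moreover have "card H = h1 + h2"
    unfolding H_def using 1 2 disjH injH by (subst card_Un_disjoint) (auto simp: card_image)
  moreover have "P \<subseteq> aff_space KR d"
    unfolding P_def aff_space_type \<tau>_def using aff translate_aff by blast
  moreover have "H \<subseteq> hyperplanes KR d"
  proof -
    have "\<tau> ` h \<in> hyperplanes KR d" if hH: "h \<in> H2" for h
      using h[of h] hH unfolding \<tau>_h[OF hH] hyperplanes_type by blast
    then show ?thesis unfolding H_def using 1(2) by blast
  qed
  moreover have "\<iota>1 + \<iota>2 \<le> real (card (incidences P H))"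
  proof -
    have "incidences P1 H1 \<union> incidences (\<tau> ` P2) ((`) \<tau> ` H2) \<subseteq> incidences P H"
      unfolding incidences_def P_def H_def by blast
    moreover have "finite (incidences P H)"
      by (rule finite_subset[of _ "P \<times> H"]) (use fin in \<open>auto simp: incidences_def\<close>)
    ultimately have "card (incidences P1 H1 \<union> incidences (\<tau> ` P2) ((`) \<tau> ` H2)) \<le> card (incidences P H)"
      by (rule card_mono[rotated])
    moreover have "card (incidences P1 H1 \<union> incidences (\<tau> ` P2) ((`) \<tau> ` H2)) =
        card (incidences P1 H1) + card (incidences (\<tau> ` P2) ((`) \<tau> ` H2))"
    proof (rule card_Un_disjoint)
      show "finite (incidences P1 H1)"
        by (rule finite_subset[of _ "P1 \<times> H1"]) (use 1 in \<open>auto simp: incidences_def\<close>)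
      show "finite (incidences (\<tau> ` P2) ((`) \<tau> ` H2))"
        by (rule finite_subset[of _ "\<tau> ` P2 \<times> (`) \<tau> ` H2"]) (use 2 in \<open>auto simp: incidences_def\<close>)
      show "incidences P1 H1 \<inter> incidences (\<tau> ` P2) ((`) \<tau> ` H2) = {}"
        using disjP unfolding incidences_def by blast
    qed
    moreover have "card (incidences (\<tau> ` P2) ((`) \<tau> ` H2)) = card (incidences P2 H2)"
      by (rule inc_translate)
    ultimately show ?thesis using 1(7) 2(7) by linarith
  qed
  moreover have "rs P H \<le> M"
  proof (rule rs_le[OF fin])
    fix A B assume AB: "A \<subseteq> P" "B \<subseteq> H" "\<And>x h. x \<in> A \<Longrightarrow> h \<in> B \<Longrightarrow> x \<in> h"
    have c1: "h \<in> H1" if "x \<in> A" "x \<in> P1" "h \<in> B" for x h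
    proof -
      have "x \<in> h" using AB(3) that by blast
      moreover have "x \<in> Q" using that by (simp add: Q_def)
      ultimately show ?thesis using avoid2[of x] AB(2) that(3) unfolding H_def by blast
    qed
    have c2: "h \<in> (`) \<tau> ` H2" if "x \<in> A" "x \<in> \<tau> ` P2" "h \<in> B" for x h
    proof -
      have "x \<in> h" using AB(3) that by blast
      then show ?thesis using avoid1[of _ h] AB(2) that(2,3) unfolding H_def by blast
    qed
    \<comment> \<open>A single edge decides in which part the whole biclique lies.\<close>
    have "card A * card B \<le> M" if xy: "x \<in> A" "y \<in> B" for x y
    proof (cases "x \<in> P1")
      case True
      have B: "B \<subseteq> H1" using c1[OF xy(1) True] by blast
      have "A \<subseteq> P1"
      proof
        fix w assume w: "w \<in> A"
        have "y \<notin> (`) \<tau> ` H2" using B xy(2) disjH by blast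
        then have "w \<notin> \<tau> ` P2" using c2[OF w] xy(2) by blast
        then show "w \<in> P1" using AB(1) w unfolding P_def by blast
      qed
      then have "card A * card B \<le> rs P1 H1" by (rule biclique_le_rs[OF 1(3,4) _ B AB(3)])
      then show ?thesis using 1(8) by (rule order_trans)
    next
      case False
      then have x: "x \<in> \<tau> ` P2" using AB(1) xy(1) unfolding P_def by blast
      have B: "B \<subseteq> (`) \<tau> ` H2" using c2[OF xy(1) x] by blast
      have "A \<subseteq> \<tau> ` P2"
      proof
        fix w assume w: "w \<in> A"
        have "y \<notin> H1" using B xy(2) disjH by blast
        then have "w \<notin> P1" using c1[OF w] xy(2) by blast
        then show "w \<in> \<tau> ` P2" using AB(1) w unfolding P_def by blast
      qed
      then have "card A * card B \<le> rs (\<tau> ` P2) ((`) \<tau> ` H2)"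
        by (rule biclique_le_rs[OF finite_imageI[OF 2(3)] finite_imageI[OF 2(4)] _ B AB(3)])
      then show ?thesis unfolding rs_translate using 2(8) by (rule order_trans)
    qed
    then show "card A * card B \<le> M"
      by (cases "A = {} \<or> B = {}") auto
  qed
  ultimately show ?thesis
    unfolding realizable_def using fin by - (intro exI[of _ P] exI[of _ H] conjI; assumption)
qed

lemma realizable_copies:
  assumes "1 \<le> d" "realizable d p h \<iota> M"
  shows "realizable d (t * p) (t * h) (real t * \<iota>) M"
proof (induction t)
  case 0
  have "rs ({} :: (nat \<Rightarrow> K) set) {} \<le> M" by (rule rs_le) auto
  then show ?case by (auto simp: realizable_def intro!: exI[of _ "{}"])
next
  case (Suc t)
  show ?case using realizable_union[OF assms(1,2) Suc] by (simp add: algebra_simps)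
qed

subsection \<open>Grids over finite fields\<close>

lemma sum_delta_shift:
  fixes x :: "nat \<Rightarrow> 'k::field"
  shows "(\<Sum>i<Suc e. (a(e := 1)) i * (x(e := y)) i) = (\<Sum>i<e. a i * x i) + y"
proof -
  have "(\<Sum>i<e. (a(e := 1)) i * (x(e := y)) i) = (\<Sum>i<e. a i * x i)"
    by (rule sum.cong) auto
  then show ?thesis by simp
qed

lemma fun_upd_PiE:
  "x \<in> {..<e} \<rightarrow>\<^sub>E UNIV \<Longrightarrow> x(e := y) \<in> {..<Suc e} \<rightarrow>\<^sub>E UNIV"
  by (auto simp: PiE_def extensional_def)

text \<open>
  The incidences between the points \<open>(x, y)\<close> and the hyperplanes \<open>a \<cdot> x + y = b\<close>,
  with \<open>y\<close> and \<open>b\<close> in a finite field containing all \<open>a \<cdot> x\<close>: a biclique forces the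
  differences of the \<open>x\<close> and of the \<open>a\<close> to be orthogonal.
\<close>

lemma graph_realizable:
  fixes S :: "K set" and U W :: "(nat \<Rightarrow> K) set"
  assumes S: "division_closed S" and U: "U \<subseteq> {..<e} \<rightarrow>\<^sub>E UNIV" "finite U"
    and W: "W \<subseteq> {..<e} \<rightarrow>\<^sub>E UNIV" "finite W"
    and dot_S: "\<And>x a. x \<in> U \<Longrightarrow> a \<in> W \<Longrightarrow> (\<Sum>i<e. a i * x i) \<in> S"
    and bound: "\<And>A B x0 a0. A \<subseteq> U \<Longrightarrow> B \<subseteq> W \<Longrightarrow> x0 \<in> A \<Longrightarrow> a0 \<in> B \<Longrightarrow>
      (\<forall>x\<in>A. \<forall>a\<in>B. (\<Sum>i<e. (x i - x0 i) * (a i - a0 i)) = 0) \<Longrightarrow> card A * card B \<le> M"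
  shows "realizable (Suc e) (card U * card S) (card W * card S) (real (card U * card W * card S)) M"
proof -
  define dot :: "(nat \<Rightarrow> K) \<Rightarrow> (nat \<Rightarrow> K) \<Rightarrow> K" where "dot a x = (\<Sum>i<e. a i * x i)" for a x
  define pt :: "(nat \<Rightarrow> K) \<times> K \<Rightarrow> nat \<Rightarrow> K" where "pt = (\<lambda>(x, y). x(e := y))"
  define hyp where "hyp = (\<lambda>(a, b). hyperplane KR (Suc e) (a(e := 1)) b)"
  have finS: "finite S" using S by (simp add: division_closed_def)
  have finUS: "finite (U \<times> S)" "finite (W \<times> S)" using U W finS by simp_all
  have mem: "pt (x, y) \<in> hyp (a, b) \<longleftrightarrow> dot a x + y = b" if "x \<in> {..<e} \<rightarrow>\<^sub>E UNIV" for x y a b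
    unfolding pt_def hyp_def prod.case mem_hyperplane_type sum_delta_shift dot_def
    using fun_upd_PiE[OF that] by simp
  have inj_pt: "inj_on pt (U \<times> S)"
  proof (rule inj_onI, clarify)
    fix x y x' y' assume xy: "x \<in> U" "x' \<in> U" "pt (x, y) = pt (x', y')"
    have "x \<in> {..<e} \<rightarrow>\<^sub>E UNIV" "x' \<in> {..<e} \<rightarrow>\<^sub>E UNIV" using xy U(1) by blast+
    then have "x e = undefined" "x' e = undefined" by (simp_all add: PiE_def extensional_def)
    then have "x i = x' i" for i
      using fun_cong[OF xy(3), of i] by (cases "i = e") (simp_all add: pt_def)
    moreover have "y = y'" using fun_cong[OF xy(3), of e] by (simp add: pt_def)
    ultimately show "x = x' \<and> y = y'" by blast
  qed
  have inj_hyp: "inj_on hyp (W \<times> S)"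
  proof (rule inj_onI, clarify)
    fix a b a' b' assume ab: "a \<in> W" "a' \<in> W" "hyp (a, b) = hyp (a', b')"
    \<comment> \<open>The last coefficient being normalized to 1, a hyperplane is the graph of an
      affine function on the first \<open>e\<close> coordinates; the origin and the unit vectors
      recover its coefficients.\<close>
    have eq: "dot a' x + (b - dot a x) = b'" if x: "x \<in> {..<e} \<rightarrow>\<^sub>E UNIV" for x
    proof -
      have "pt (x, b - dot a x) \<in> hyp (a, b)" using mem[OF x] by simp
      then show ?thesis using ab(3) mem[OF x] by simp
    qed
    have "dot c (\<lambda>i\<in>{..<e}. 0) = 0" for c unfolding dot_def by (intro sum.neutral) simp
    then have b: "b = b'" using eq[of "\<lambda>i\<in>{..<e}. 0"] by simp
    have aa: "a i = a' i" if i: "i < e" for i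
    proof -
      have "dot c (\<lambda>j\<in>{..<e}. if j = i then 1 else 0) = c i" for c
      proof -
        have "dot c (\<lambda>j\<in>{..<e}. if j = i then 1 else 0) = (\<Sum>j<e. if j = i then c j else 0)"
          unfolding dot_def by (rule sum.cong) auto
        then show ?thesis using i by simp
      qed
      then show ?thesis
        using eq[of "\<lambda>j\<in>{..<e}. if j = i then 1 else 0"] b by simp
    qed
    have "a \<in> {..<e} \<rightarrow>\<^sub>E UNIV" "a' \<in> {..<e} \<rightarrow>\<^sub>E UNIV" using ab W(1) by blast+
    then have "a = a'" by (rule PiE_ext) (simp add: aa)
    then show "a = a' \<and> b = b'" using b by blast
  qed
  define P where "P = pt ` (U \<times> S)"
  define H where "H = hyp ` (W \<times> S)"
  have fin: "finite P" "finite H" using finUS by (simp_all add: P_def H_def)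
  have U': "x \<in> {..<e} \<rightarrow>\<^sub>E UNIV" if "x \<in> U" for x using that U(1) by blast
  have W': "x \<in> {..<e} \<rightarrow>\<^sub>E UNIV" if "x \<in> W" for x using that W(1) by blast
  have "card P = card U * card S"
    unfolding P_def card_image[OF inj_pt] by (rule card_cartesian_product)
  moreover have "card H = card W * card S"
    unfolding H_def card_image[OF inj_hyp] by (rule card_cartesian_product)
  moreover have "P \<subseteq> aff_space KR (Suc e)"
    unfolding P_def aff_space_type pt_def using fun_upd_PiE[OF U'] by auto
  moreover have "H \<subseteq> hyperplanes KR (Suc e)"
  proof
    fix h assume "h \<in> H"
    then obtain a b where "a \<in> W" "h = hyperplane KR (Suc e) (a(e := 1)) b"
      by (auto simp: H_def hyp_def)
    moreover have "(a(e := 1)) e \<noteq> 0" by simp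
    ultimately show "h \<in> hyperplanes KR (Suc e)"
      unfolding hyperplanes_type using fun_upd_PiE[OF W'] by blast
  qed
  moreover have "card U * card W * card S \<le> card (incidences P H)"
  proof -
    \<comment> \<open>Given \<open>x\<close>, \<open>a\<close> and \<open>y\<close>, exactly one
      \<open>b\<close> fits, and it lies in \<open>S\<close>.\<close>
    define g where "g = (\<lambda>((x, a), y). (pt (x, y), hyp (a, dot a x + y)))"
    have dS: "dot a x + y \<in> S" if "x \<in> U" "a \<in> W" "y \<in> S" for x a y
      using dot_S[OF that(1,2)] that(3) S by (simp add: dot_def division_closed_def)
    have "inj_on g ((U \<times> W) \<times> S)"
    proof (rule inj_onI)
      fix p p' assume pp: "p \<in> (U \<times> W) \<times> S" "p' \<in> (U \<times> W) \<times> S" "g p = g p'"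
      obtain x a y x' a' y' where p: "p = ((x, a), y)" "p' = ((x', a'), y')" by (metis surj_pair)
      have *: "x \<in> U" "a \<in> W" "y \<in> S" "x' \<in> U" "a' \<in> W" "y' \<in> S"
        using pp unfolding p by simp_all
      have eq: "pt (x, y) = pt (x', y')" "hyp (a, dot a x + y) = hyp (a', dot a' x' + y')"
        using pp(3) unfolding p g_def by simp_all
      have "(x, y) = (x', y')" by (rule inj_onD[OF inj_pt eq(1)]) (use * in simp_all)
      moreover have "(a, dot a x + y) = (a', dot a' x' + y')"
        by (rule inj_onD[OF inj_hyp eq(2)]) (use * dS in simp_all)
      ultimately show "p = p'" unfolding p by simp
    qed
    moreover have "g ` ((U \<times> W) \<times> S) \<subseteq> incidences P H"
    proof (rule image_subsetI, clarify)
      fix x a y assume *: "x \<in> U" "a \<in> W" "y \<in> S"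
      have "pt (x, y) \<in> hyp (a, dot a x + y)" using mem[OF U'[OF *(1)]] by simp
      then show "g ((x, a), y) \<in> incidences P H"
        using * dS[OF *] unfolding g_def incidences_def P_def H_def by simp
    qed
    moreover have "finite (incidences P H)"
      by (rule finite_subset[of _ "P \<times> H"]) (use fin in \<open>auto simp: incidences_def\<close>)
    ultimately have "card ((U \<times> W) \<times> S) \<le> card (incidences P H)"
      by (rule card_inj_on_le)
    then show ?thesis by (simp add: card_cartesian_product)
  qed
  moreover have "rs P H \<le> M"
  proof (rule rs_le[OF fin])
    fix A B assume AB: "A \<subseteq> P" "B \<subseteq> H" "\<And>x h. x \<in> A \<Longrightarrow> h \<in> B \<Longrightarrow> x \<in> h"
    define A' where "A' = {p \<in> U \<times> S. pt p \<in> A}"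
    define B' where "B' = {p \<in> W \<times> S. hyp p \<in> B}"
    have "A = pt ` A'" using AB(1) unfolding A'_def P_def by blast
    moreover have "inj_on pt A'" by (rule inj_on_subset[OF inj_pt]) (auto simp: A'_def)
    ultimately have cA: "card A = card A'" by (simp add: card_image)
    have "B = hyp ` B'" using AB(2) unfolding B'_def H_def by blast
    moreover have "inj_on hyp B'" by (rule inj_on_subset[OF inj_hyp]) (auto simp: B'_def)
    ultimately have cB: "card B = card B'" by (simp add: card_image)
    have inc: "dot a x + y = b" if "(x, y) \<in> A'" "(a, b) \<in> B'" for x y a b
    proof -
      have "pt (x, y) \<in> hyp (a, b)" by (rule AB(3)) (use that in \<open>simp_all add: A'_def B'_def\<close>)
      moreover have "x \<in> U" using that by (simp add: A'_def)
      ultimately show ?thesis using mem[OF U'] by simp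
    qed
    show "card A * card B \<le> M"
    proof (cases "A' = {} \<or> B' = {}")
      case True
      then show ?thesis using cA cB by auto
    next
      case False
      then obtain x0 y0 a0 b0 where 0: "(x0, y0) \<in> A'" "(a0, b0) \<in> B'" by (metis ex_in_conv surj_pair)
      \<comment> \<open>A fixed hyperplane of the biclique determines \<open>y\<close> from
        \<open>x\<close>, and a fixed point determines \<open>b\<close> from \<open>a\<close>, so
        both sides may be counted by their projections.\<close>
      have "inj_on fst A'"
      proof (rule inj_onI, clarify)
        fix x y x' y' assume "(x, y) \<in> A'" "(x', y') \<in> A'" "fst (x, y) = fst (x', y')"
        then show "x = x' \<and> y = y'" using inc[OF _ 0(2)] by (metis add_left_cancel fst_conv)
      qed
      then have cA': "card (fst ` A') = card A'" by (rule card_image)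
      have "inj_on fst B'"
      proof (rule inj_onI, clarify)
        fix a b a' b' assume "(a, b) \<in> B'" "(a', b') \<in> B'" "fst (a, b) = fst (a', b')"
        then show "a = a' \<and> b = b'" using inc[OF 0(1)] by (metis fst_conv)
      qed
      then have cB': "card (fst ` B') = card B'" by (rule card_image)
      have "card (fst ` A') * card (fst ` B') \<le> M"
      proof (rule bound[of _ _ x0 a0])
        show "fst ` A' \<subseteq> U" "fst ` B' \<subseteq> W" by (auto simp: A'_def B'_def)
        show "x0 \<in> fst ` A'" "a0 \<in> fst ` B'" using 0 by force+
        show "\<forall>x\<in>fst ` A'. \<forall>a\<in>fst ` B'. (\<Sum>i<e. (x i - x0 i) * (a i - a0 i)) = 0"
        proof (intro ballI)
          fix x a assume "x \<in> fst ` A'" "a \<in> fst ` B'"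
          then obtain y b where xa: "(x, y) \<in> A'" "(a, b) \<in> B'" by force
          \<comment> \<open>The mixed second difference of \<open>a \<cdot> x = b - y\<close>
            vanishes, since \<open>b\<close> depends on \<open>a\<close> only and \<open>y\<close>
            on \<open>x\<close> only.\<close>
          have "(\<Sum>i<e. (x i - x0 i) * (a i - a0 i)) = (\<Sum>i<e. (a i * x i - a0 i * x i) - (a i * x0 i - a0 i * x0 i))"
            by (rule sum.cong) (simp_all add: algebra_simps)
          also have "\<dots> = (dot a x - dot a0 x) - (dot a x0 - dot a0 x0)"
            unfolding dot_def by (simp only: sum_subtractf)
          also have "\<dots> = ((dot a x + y) - (dot a0 x + y)) - ((dot a x0 + y0) - (dot a0 x0 + y0))"
            by simp
          also have "\<dots> = 0" unfolding inc[OF xa] inc[OF xa(1) 0(2)] inc[OF 0(1) xa(2)] inc[OF 0] by simp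
          finally show "(\<Sum>i<e. (x i - x0 i) * (a i - a0 i)) = 0" .
        qed
      qed
      then show ?thesis using cA cB cA' cB' by simp
    qed
  qed
  ultimately show ?thesis
    unfolding realizable_def of_nat_le_iff using fin
    by - (intro exI[of _ P] exI[of _ H] conjI; assumption)
qed

lemma division_closed_sum:
  assumes "division_closed S" "\<And>i. i \<in> C \<Longrightarrow> f i \<in> S"
  shows "sum f C \<in> S"
  using assms by (induction C rule: infinite_finite_induct) (auto simp: division_closed_def)

lemma card_le_fibres:
  fixes A :: "(nat \<Rightarrow> 'k::field) set"
  assumes A: "A \<subseteq> (\<Pi>\<^sub>E i\<in>{..<e}. T i)" and g: "g \<le> e" and fin: "\<And>i. finite (T i)"
  shows "card A \<le> card ((\<lambda>x. \<lambda>i\<in>{..<g}. x i - x0 i) ` A) * (\<Prod>i=g..<e. card (T i))"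
proof -
  define \<delta> where "\<delta> x = (\<lambda>i\<in>{..<g}. x i - x0 i)" for x
  define \<rho> :: "(nat \<Rightarrow> 'k) \<Rightarrow> nat \<Rightarrow> 'k" where "\<rho> x = restrict x {g..<e}" for x
  have finE: "finite (\<Pi>\<^sub>E i\<in>C. T i)" if "finite C" for C
    using that fin by (intro finite_PiE) simp_all
  have finA: "finite A" using A finE[of "{..<e}"] by (rule finite_subset) simp
  have inA: "x \<in> (\<Pi>\<^sub>E i\<in>{..<e}. T i)" if "x \<in> A" for x using A that by (rule subsetD)
  have "inj_on (\<lambda>x. (\<delta> x, \<rho> x)) A"
  proof (rule inj_onI)
    fix x y assume xy: "x \<in> A" "y \<in> A" "(\<delta> x, \<rho> x) = (\<delta> y, \<rho> y)"
    then have eq: "\<delta> x = \<delta> y" "\<rho> x = \<rho> y" by simp_all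
    show "x = y"
    proof (rule PiE_ext[OF inA[OF xy(1)] inA[OF xy(2)]])
      fix i assume "i \<in> {..<e}"
      then show "x i = y i"
        using fun_cong[OF eq(1), of i] fun_cong[OF eq(2), of i]
        by (cases "i < g") (simp_all add: \<delta>_def \<rho>_def)
    qed
  qed
  moreover have "(\<lambda>x. (\<delta> x, \<rho> x)) ` A \<subseteq> \<delta> ` A \<times> (\<Pi>\<^sub>E i\<in>{g..<e}. T i)"
  proof (rule image_subsetI)
    fix x assume x: "x \<in> A"
    have "\<rho> x \<in> (\<Pi>\<^sub>E i\<in>{g..<e}. T i)"
      unfolding \<rho>_def restrict_PiE_iff using PiE_mem[OF inA[OF x]] by simp
    then show "(\<delta> x, \<rho> x) \<in> \<delta> ` A \<times> (\<Pi>\<^sub>E i\<in>{g..<e}. T i)" using x by blast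
  qed
  ultimately have "card A \<le> card (\<delta> ` A \<times> (\<Pi>\<^sub>E i\<in>{g..<e}. T i))"
    using finA finE[of "{g..<e}"] by (intro card_inj_on_le) simp_all
  then show ?thesis
    by (simp add: card_cartesian_product card_PiE \<delta>_def)
qed

text \<open>The first \<open>g\<close> coordinates range over the finite field. In each further
  coordinate one side is constantly 0, so these coordinates leave the scalar products alone and
  merely multiply the numbers of points by \<open>u\<close> and of hyperplanes by \<open>w\<close>,
  hence the biclique bound \<open>q ^ g\<close> by \<open>u * w\<close>.\<close>

lemma grid_realizable:
  fixes S :: "K set" and T T' :: "nat \<Rightarrow> K set"
  assumes S: "division_closed S" and g: "g \<le> e" and fin: "\<And>i. finite (T i)" "\<And>i. finite (T' i)"
    and zero: "\<And>i. g \<le> i \<Longrightarrow> i < e \<Longrightarrow> T i = {0} \<or> T' i = {0}"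
    and u: "(\<Prod>i=g..<e. card (T i)) = u" and w: "(\<Prod>i=g..<e. card (T' i)) = w"
    and q: "card S = q" "0 < q"
  shows "realizable (Suc e) (q ^ Suc g * u) (q ^ Suc g * w)
    (1 / q * real (q ^ Suc g * u) * real (q ^ Suc g * w)) (q ^ g * u * w)"
proof -
  define R where "R i = (if i < g then S else T i)" for i
  define R' where "R' i = (if i < g then S else T' i)" for i
  define U where "U = (\<Pi>\<^sub>E i\<in>{..<e}. R i)"
  define W where "W = (\<Pi>\<^sub>E i\<in>{..<e}. R' i)"
  have finS: "finite S" using S by (simp add: division_closed_def)
  have finR: "finite (R i)" "finite (R' i)" for i using finS fin by (simp_all add: R_def R'_def)
  have split: "prod f {..<e} = prod f {..<g} * prod f {g..<e}" for f :: "nat \<Rightarrow> nat"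
    using prod.atLeastLessThan_concat[of 0 g e f] g by (simp add: lessThan_atLeast0)
  have split_sum: "sum f {..<e} = sum f {..<g} + sum f {g..<e}" for f :: "nat \<Rightarrow> K"
    using sum.atLeastLessThan_concat[of 0 g e f] g by (simp add: lessThan_atLeast0)
  have prodR: "(\<Prod>i=g..<e. card (R i)) = u" "(\<Prod>i=g..<e. card (R' i)) = w"
    unfolding u[symmetric] w[symmetric] by (rule prod.cong; simp add: R_def R'_def)+
  have prodS: "(\<Prod>i<g. card (R i)) = q ^ g" "(\<Prod>i<g. card (R' i)) = q ^ g"
    by (simp_all add: R_def R'_def q(1))
  have cU: "card U = q ^ g * u" and cW: "card W = q ^ g * w"
    unfolding U_def W_def card_PiE[OF finite_lessThan] split prodR prodS by simp_all
  have finU: "finite U" "finite W" unfolding U_def W_def using finR by (simp_all add: finite_PiE)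
  have U: "x \<in> (\<Pi>\<^sub>E i\<in>{..<e}. R i)" if "x \<in> U" for x using that by (simp add: U_def)
  have W: "x \<in> (\<Pi>\<^sub>E i\<in>{..<e}. R' i)" if "x \<in> W" for x using that by (simp add: W_def)
  have Ug: "x i \<in> S" if "x \<in> U" "i < g" for x i
    using PiE_mem[OF U[OF that(1)], of i] that(2) g by (simp add: R_def)
  have Wg: "x i \<in> S" if "x \<in> W" "i < g" for x i
    using PiE_mem[OF W[OF that(1)], of i] that(2) g by (simp add: R'_def)
  have extra: "(x i = 0 \<and> x0 i = 0) \<or> (a i = 0 \<and> a0 i = 0)"
    if "x \<in> U" "x0 \<in> U" "a \<in> W" "a0 \<in> W" "g \<le> i" "i < e" for x x0 a a0 i
  proof -
    have "x i \<in> T i" "x0 i \<in> T i" "a i \<in> T' i" "a0 i \<in> T' i"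
      using PiE_mem[OF U[OF that(1)], of i] PiE_mem[OF U[OF that(2)], of i]
        PiE_mem[OF W[OF that(3)], of i] PiE_mem[OF W[OF that(4)], of i] that(5,6)
      by (simp_all add: R_def R'_def)
    then show ?thesis using zero[OF that(5,6)] by auto
  qed
  have "realizable (Suc e) (card U * card S) (card W * card S) (real (card U * card W * card S)) (q ^ g * u * w)"
  proof (rule graph_realizable[OF S])
    have "PiE {..<e} Q \<subseteq> {..<e} \<rightarrow>\<^sub>E UNIV" for Q :: "nat \<Rightarrow> K set" by (rule PiE_mono) simp
    then show "U \<subseteq> {..<e} \<rightarrow>\<^sub>E UNIV" "W \<subseteq> {..<e} \<rightarrow>\<^sub>E UNIV" by (simp_all only: U_def W_def)
    show "finite U" "finite W" by (fact finU)+
    show "(\<Sum>i<e. a i * x i) \<in> S" if "x \<in> U" "a \<in> W" for x a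
    proof -
      have "(\<Sum>i=g..<e. a i * x i) = 0"
        by (rule sum.neutral) (use extra[OF that(1,1,2,2)] in force)
      moreover have "(\<Sum>i<g. a i * x i) \<in> S"
        by (rule division_closed_sum[OF S]) (use Ug[OF that(1)] Wg[OF that(2)] S in \<open>simp add: division_closed_def\<close>)
      ultimately show ?thesis unfolding split_sum by simp
    qed
    fix A B :: "(nat \<Rightarrow> K) set" and x0 a0
    assume A: "A \<subseteq> U" and B: "B \<subseteq> W" and 0: "x0 \<in> A" "a0 \<in> B"
      and orth: "\<forall>x\<in>A. \<forall>a\<in>B. (\<Sum>i<e. (x i - x0 i) * (a i - a0 i)) = 0"
    define \<delta> where "\<delta> y x = (\<lambda>i\<in>{..<g}. x i - y i)" for x y :: "nat \<Rightarrow> K"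
    have x0: "x0 \<in> U" and a0: "a0 \<in> W" using 0 A B by blast+
    have "card (\<delta> x0 ` A) * card (\<delta> a0 ` B) \<le> card S ^ g"
    proof (rule orthogonal_le[OF S])
      show "\<delta> x0 ` A \<subseteq> {..<g} \<rightarrow>\<^sub>E S"
      proof (rule image_subsetI)
        fix x assume "x \<in> A"
        then have "x \<in> U" using A by blast
        then show "\<delta> x0 x \<in> {..<g} \<rightarrow>\<^sub>E S"
          using Ug x0 S by (intro PiE_I) (simp_all add: \<delta>_def division_closed_def)
      qed
      show "\<delta> a0 ` B \<subseteq> {..<g} \<rightarrow>\<^sub>E S"
      proof (rule image_subsetI)
        fix x assume "x \<in> B"
        then have "x \<in> W" using B by blast
        then show "\<delta> a0 x \<in> {..<g} \<rightarrow>\<^sub>E S"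
          using Wg a0 S by (intro PiE_I) (simp_all add: \<delta>_def division_closed_def)
      qed
      have "(\<Sum>i<g. \<delta> x0 x i * \<delta> a0 a i) = 0" if "x \<in> A" "a \<in> B" for x a
      proof -
        have xa: "x \<in> U" "a \<in> W" using that A B by blast+
        have "(\<Sum>i=g..<e. (x i - x0 i) * (a i - a0 i)) = 0"
          by (rule sum.neutral) (use extra[OF xa(1) x0 xa(2) a0] in force)
        then have "(\<Sum>i<g. (x i - x0 i) * (a i - a0 i)) = 0"
          using orth that split_sum[of "\<lambda>i. (x i - x0 i) * (a i - a0 i)"] by simp
        moreover have "(\<Sum>i<g. \<delta> x0 x i * \<delta> a0 a i) = (\<Sum>i<g. (x i - x0 i) * (a i - a0 i))"
          by (rule sum.cong) (simp_all add: \<delta>_def)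
        ultimately show ?thesis by simp
      qed
      then show "\<forall>x\<in>\<delta> x0 ` A. \<forall>y\<in>\<delta> a0 ` B. (\<Sum>i<g. x i * y i) = 0" by simp
    qed
    then have orth_le: "card (\<delta> x0 ` A) * card (\<delta> a0 ` B) \<le> q ^ g" by (simp add: q(1))
    have "card A \<le> card (\<delta> x0 ` A) * u"
      using card_le_fibres[OF A[unfolded U_def] g finR(1), of x0] by (simp add: prodR \<delta>_def)
    moreover have "card B \<le> card (\<delta> a0 ` B) * w"
      using card_le_fibres[OF B[unfolded W_def] g finR(2), of a0] by (simp add: prodR \<delta>_def)
    ultimately have "card A * card B \<le> (card (\<delta> x0 ` A) * u) * (card (\<delta> a0 ` B) * w)"
      by (rule mult_le_mono)
    also have "\<dots> = (card (\<delta> x0 ` A) * card (\<delta> a0 ` B)) * (u * w)" by (simp only: mult_ac)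
    also have "\<dots> \<le> q ^ g * (u * w)" by (rule mult_right_mono[OF orth_le]) simp
    finally show "card A * card B \<le> q ^ g * u * w" by (simp only: mult.assoc)
  qed
  moreover have "card U * card S = q ^ Suc g * u" "card W * card S = q ^ Suc g * w"
    unfolding cU cW q(1) by simp_all
  moreover have "real (card U * card W * card S) = 1 / q * real (q ^ Suc g * u) * real (q ^ Suc g * w)"
    unfolding cU cW q(1) using q(2) by simp
  ultimately show ?thesis by (simp only:)
qed

section \<open>Grids with copies, with one multiplicity and with two\<close>

lemma copies_restrict_realizable:
  assumes "1 \<le> d" "realizable d p h (1 / real q * real p * real h) M" "1 \<le> t" "l \<le> t * p" "k \<le> t * h"
  shows "realizable d l k (1 / (real t * real q) * real l * real k) M"
proof -
  have "real t * (1 / real q * real p * real h) = 1 / (real t * real q) * real (t * p) * real (t * h)"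
    using assms(3) by simp
  then have "realizable d (t * p) (t * h) (1 / (real t * real q) * real (t * p) * real (t * h)) M"
    using realizable_copies[OF assms(1,2), of t] by (simp only:)
  then show ?thesis using assms(4,5) by (rule realizable_restrict)
qed

text \<open>For multiplicity 1 the set has to be \<open>{0}\<close>, since a side without
  multiplicity must vanish in the extra coordinate.\<close>

lemma ex_finite_card_K: "\<exists>V :: K set. finite V \<and> card V = n \<and> (n = 1 \<longrightarrow> V = {0})"
proof (cases "n = 1")
  case True
  then show ?thesis by (intro exI[of _ "{0}"]) simp
next
  case False
  then show ?thesis using infinite_arbitrarily_large[OF infinite_K, of n] by blast
qed

lemma realizable_full:
  assumes "1 \<le> d" "1 \<le> t" "l \<le> t * (2 ^ j) ^ d" "k \<le> t * (2 ^ j) ^ d"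
  shows "realizable d l k (1 / (real t * real (2 ^ j)) * real l * real k) ((2 ^ j) ^ (d - 1))"
proof -
  obtain S :: "K set" where S: "division_closed S" "card S = 2 ^ j" using ex_division_closed by blast
  obtain e where e: "d = Suc e" using assms(1) by (cases d) auto
  have "realizable (Suc e) ((2 ^ j) ^ Suc e * 1) ((2 ^ j) ^ Suc e * 1)
    (1 / real (2 ^ j) * real ((2 ^ j) ^ Suc e * 1) * real ((2 ^ j) ^ Suc e * 1)) ((2 ^ j) ^ e * 1 * 1)"
    by (rule grid_realizable[OF S(1), of e e "\<lambda>_. {}" "\<lambda>_. {}"]) (use S in simp_all)
  then have "realizable d ((2 ^ j) ^ d) ((2 ^ j) ^ d)
    (1 / real (2 ^ j) * real ((2 ^ j) ^ d) * real ((2 ^ j) ^ d)) ((2 ^ j) ^ (d - 1))"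
    unfolding e diff_Suc_1 by (simp only: mult_1_right)
  then show ?thesis using assms by (intro copies_restrict_realizable)
qed

lemma realizable_one_multiplicity:
  assumes d: "2 \<le> d" and t: "1 \<le> t" and uw: "u = 1 \<or> w = 1"
    and le: "l \<le> t * ((2 ^ j) ^ (d - 1) * u)" "k \<le> t * ((2 ^ j) ^ (d - 1) * w)"
  shows "realizable d l k (1 / (real t * real (2 ^ j)) * real l * real k) ((2 ^ j) ^ (d - 2) * u * w)"
proof -
  obtain S :: "K set" where S: "division_closed S" "card S = 2 ^ j" using ex_division_closed by blast
  define g where "g = d - 2"
  have g: "d = Suc (Suc g)" using d by (simp add: g_def)
  obtain V :: "K set" where V: "finite V" "card V = u" "u = 1 \<longrightarrow> V = {0}"
    using ex_finite_card_K[of u] by blast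
  obtain V' :: "K set" where V': "finite V'" "card V' = w" "w = 1 \<longrightarrow> V' = {0}"
    using ex_finite_card_K[of w] by blast
  have V0: "V = {0} \<or> V' = {0}" using uw V(3) V'(3) by blast
  have "realizable (Suc (Suc g)) ((2 ^ j) ^ Suc g * u) ((2 ^ j) ^ Suc g * w)
    (1 / real (2 ^ j) * real ((2 ^ j) ^ Suc g * u) * real ((2 ^ j) ^ Suc g * w)) ((2 ^ j) ^ g * u * w)"
    by (rule grid_realizable[OF S(1), of g "Suc g" "\<lambda>_. V" "\<lambda>_. V'"]) (use S(2) V(1,2) V'(1,2) V0 in simp_all)
  then show ?thesis
    using assms unfolding g by (intro copies_restrict_realizable) simp_all
qed

lemma realizable_two_multiplicities:
  assumes d: "3 \<le> d" and le: "l \<le> (2 ^ j) ^ (d - 2) * u" "k \<le> (2 ^ j) ^ (d - 2) * w"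
  shows "realizable d l k (1 / real (2 ^ j) * real l * real k) ((2 ^ j) ^ (d - 3) * u * w)"
proof -
  obtain S :: "K set" where S: "division_closed S" "card S = 2 ^ j" using ex_division_closed by blast
  define g where "g = d - 3"
  have g: "d = Suc (Suc (Suc g))" using d by (simp add: g_def)
  obtain V :: "K set" where V: "finite V" "card V = u" using ex_finite_card_K by blast
  obtain V' :: "K set" where V': "finite V'" "card V' = w" using ex_finite_card_K by blast
  \<comment> \<open>Coordinate \<open>g\<close> carries the multiplicity of the points and
    coordinate \<open>g + 1\<close> that of the hyperplanes, the other side being 0 there.\<close>
  define T where "T i = (if i = g then V else {0})" for i
  define T' where "T' i = (if i = g then {0} else V')" for i
  have "realizable (Suc (Suc (Suc g))) ((2 ^ j) ^ Suc g * u) ((2 ^ j) ^ Suc g * w)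
    (1 / real (2 ^ j) * real ((2 ^ j) ^ Suc g * u) * real ((2 ^ j) ^ Suc g * w)) ((2 ^ j) ^ g * u * w)"
    by (rule grid_realizable[OF S(1), of g "Suc (Suc g)" T T'])
      (use S(2) V V' in \<open>simp_all add: T_def T'_def\<close>)
  moreover have "d - 2 = Suc g" "d - 3 = g" using g by simp_all
  ultimately show ?thesis
    using le unfolding g[symmetric] by (simp only: realizable_restrict)
qed

subsection \<open>Both ranges of the density\<close>

context incidence_geometry
begin

lemma two_left_bound:
  assumes "a \<in> A" "a' \<in> A" "a \<noteq> a'" "b \<in> B" "R a b" "R a' b"
  shows "2 \<le> d"
  using rk_two[of a "nb b" a'] rk_nb[of b] assms by (simp add: nb_def)

lemma two_right_bound:
  assumes "a \<in> A" "b \<in> B" "b' \<in> B" "b \<noteq> b'" "R a b" "R a b'"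
  shows "2 \<le> d" and "a' \<in> A \<Longrightarrow> a \<noteq> a' \<Longrightarrow> R a' b \<Longrightarrow> R a' b' \<Longrightarrow> 3 \<le> d"
proof -
  let ?W = "nb b \<inter> nb b'"
  obtain z where "z \<in> A" "R z b" "\<not> R z b'" using separate_right[OF assms(2-4)] by blast
  then have "?W \<subset> nb b" by (auto simp: nb_def)
  then have "rk ?W < rk (nb b)"
    using assms by (intro rk_strict flat_Int flat_nb) (auto simp: nb_def)
  then have less: "rk ?W < d" using rk_nb[OF assms(2)] by simp
  have a: "a \<in> ?W" using assms by (simp add: nb_def)
  show "2 \<le> d" using rk_pos[OF a assms(1)] less by simp
  assume a': "a' \<in> A" "a \<noteq> a'" "R a' b" "R a' b'"
  then have "a' \<in> ?W" by (simp add: nb_def)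
  then show "3 \<le> d" using rk_two[OF a _ a'(2) assms(1) a'(1)] less by simp
qed

end

lemma card_le_one: "(\<And>x y. x \<in> C \<Longrightarrow> y \<in> C \<Longrightarrow> x = y) \<Longrightarrow> card C \<le> 1"
  by (cases "finite C") (simp_all add: card_le_Suc0_iff_eq)

text \<open>Two lines of the plane share at most one point, so for \<open>d = 2\<close> every
  biclique is a star; for \<open>d = 1\<close> it is a single edge. This gives the upper bounds in
  low dimensions, where the grids lack room for multiplicities.\<close>

lemma rs_config_small_dim:
  assumes config: "config F d k l I P H" and d: "1 \<le> d" "d \<le> 2"
  shows "rs P H \<le> (if d = 1 then 1 else max k l)"
proof -
  interpret field F using config by (simp add: config_def)
  interpret G: incidence_geometry "aff_space F d" "hyperplanes F d" "(\<in>)" d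
    using d by (intro affine_incidence_geometry) auto
  have P: "P \<subseteq> aff_space F d" "finite P" "card P \<le> l" and H: "H \<subseteq> hyperplanes F d" "finite H" "card H \<le> k"
    using config by (simp_all add: config_def)
  show ?thesis
  proof (rule rs_le[OF P(2) H(2)])
    fix A B assume A: "A \<subseteq> P" and B: "B \<subseteq> H" and inc: "\<And>x h. x \<in> A \<Longrightarrow> h \<in> B \<Longrightarrow> x \<in> h"
    have cards: "card A \<le> l" "card B \<le> k"
      using card_mono[OF P(2) A] card_mono[OF H(2) B] P(3) H(3) by simp_all
    have A': "x \<in> aff_space F d" if "x \<in> A" for x using that A P(1) by blast
    have B': "h \<in> hyperplanes F d" if "h \<in> B" for h using that B H(1) by blast
    show "card A * card B \<le> (if d = 1 then 1 else max k l)"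
    proof (cases "A = {} \<or> B = {}")
      case True
      then show ?thesis by auto
    next
      case False
      then obtain a b where ab: "a \<in> A" "b \<in> B" by blast
      have one: "card A \<le> 1 \<or> card B \<le> 1"
      proof (rule ccontr)
        assume "\<not> ?thesis"
        then obtain x x' h h' where *: "x \<in> A" "x' \<in> A" "x \<noteq> x'" "h \<in> B" "h' \<in> B" "h \<noteq> h'"
          using card_le_one[of A] card_le_one[of B] by blast
        have "3 \<le> d"
          by (rule G.two_right_bound(2)[OF A'[OF *(1)] B'[OF *(4)] B'[OF *(5)] *(6) inc[OF *(1,4)] inc[OF *(1,5)]
            A'[OF *(2)] *(3) inc[OF *(2,4)] inc[OF *(2,5)]])
        then show False using d by simp
      qed
      show ?thesis
      proof (cases "d = 1")
        case True
        have "card A \<le> 1"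
        proof (rule card_le_one, rule ccontr)
          fix x y assume *: "x \<in> A" "y \<in> A" "x \<noteq> y"
          have "2 \<le> d"
            by (rule G.two_left_bound[OF A'[OF *(1)] A'[OF *(2)] *(3) B'[OF ab(2)] inc[OF *(1) ab(2)] inc[OF *(2) ab(2)]])
          then show False using True by simp
        qed
        moreover have "card B \<le> 1"
        proof (rule card_le_one, rule ccontr)
          fix x y assume *: "x \<in> B" "y \<in> B" "x \<noteq> y"
          have "2 \<le> d"
            by (rule G.two_right_bound(1)[OF A'[OF ab(1)] B'[OF *(1)] B'[OF *(2)] *(3) inc[OF ab(1) *(1)] inc[OF ab(1) *(2)]])
          then show False using True by simp
        qed
        ultimately have "card A * card B \<le> 1 * 1" by (rule mult_le_mono)
        then show ?thesis using True by simp
      next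
        case False
        have "card A * card B \<le> max k l"
          using one
        proof
          assume "card A \<le> 1"
          then have "card A * card B \<le> 1 * k" using cards(2) by (rule mult_le_mono)
          then show ?thesis by simp
        next
          assume "card B \<le> 1"
          with cards(1) have "card A * card B \<le> l * 1" by (rule mult_le_mono)
          then show ?thesis by simp
        qed
        then show ?thesis using False by simp
      qed
    qed
  qed
qed

text \<open>Stars already give this: some vertex of the side with at most \<open>m\<close> vertices has degree at least \<open>\<epsilon> n\<close>.\<close>

lemma config_star_bound:
  fixes F :: "('a, 'b) ring_scheme" and \<epsilon> :: real
  assumes config: "config F d k l (\<epsilon> * real m * real n) P H" and kl: "(k, l) = (m, n) \<or> (k, l) = (n, m)"
    and pos: "0 < \<epsilon>" "1 \<le> m" "1 \<le> n"
  shows "max 1 (\<epsilon> * n) \<le> real (rs P H)"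
proof -
  have P: "finite P" "card P \<le> l" and H: "finite H" "card H \<le> k"
    and inc: "\<epsilon> * real m * real n \<le> real (card (incidences P H))"
    using config by (simp_all add: config_def)
  have pos': "0 < \<epsilon> * real m * real n" using pos by simp
  then have "card (incidences P H) \<noteq> 0" using inc by linarith
  then have "incidences P H \<noteq> {}" by (metis card.empty)
  then obtain x h where "(x, h) \<in> incidences P H" by auto
  then have xh: "x \<in> P" "h \<in> H" "x \<in> h" by (simp_all add: incidences_def)
  have "card {x} * card {h} \<le> rs P H"
    by (rule biclique_le_rs[OF P(1) H(1)]) (use xh in simp_all)
  then have one: "1 \<le> real (rs P H)" by simp
  have avg: "\<exists>c\<in>C. \<epsilon> * n \<le> f c"
    if "finite C" "card C \<le> m" "\<epsilon> * m * n \<le> sum f C" for C :: "'c set" and f :: "'c \<Rightarrow> real"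
  proof (rule ccontr)
    assume "\<not> ?thesis"
    then have *: "f c < \<epsilon> * n" if "c \<in> C" for c using that by (simp add: not_le)
    have ne: "C \<noteq> {}" using that(3) pos' by (metis not_le sum.empty)
    have "sum f C < (\<Sum>c\<in>C. \<epsilon> * n)" by (rule sum_strict_mono[OF that(1) ne *])
    also have "\<dots> = card C * (\<epsilon> * n)" by simp
    also have "\<dots> \<le> m * (\<epsilon> * n)" using that(2) pos by (intro mult_right_mono) auto
    finally show False using that(3) by (simp add: mult_ac)
  qed
  have "\<epsilon> * n \<le> real (rs P H)"
    using kl
  proof
    assume "(k, l) = (n, m)"
    then have "card P \<le> m" using P(2) by simp
    moreover have "\<epsilon> * m * n \<le> (\<Sum>x\<in>P. real (card {h \<in> H. x \<in> h}))"
      using inc card_incidences(1)[OF P(1) H(1)] by simp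
    ultimately obtain x where x: "x \<in> P" "\<epsilon> * n \<le> real (card {h \<in> H. x \<in> h})"
      using avg[OF P(1), of "\<lambda>x. real (card {h \<in> H. x \<in> h})"] by blast
    have "card {x} * card {h \<in> H. x \<in> h} \<le> rs P H"
      by (rule biclique_le_rs[OF P(1) H(1)]) (use x(1) in \<open>simp_all add: subset_iff\<close>)
    then show ?thesis using x(2) by simp
  next
    assume "(k, l) = (m, n)"
    then have "card H \<le> m" using H(2) by simp
    moreover have "\<epsilon> * m * n \<le> (\<Sum>h\<in>H. real (card {x \<in> P. x \<in> h}))"
      using inc card_incidences(2)[OF P(1) H(1)] by simp
    ultimately obtain h where h: "h \<in> H" "\<epsilon> * n \<le> real (card {x \<in> P. x \<in> h})"
      using avg[OF H(1), of "\<lambda>h. real (card {x \<in> P. x \<in> h})"] by blast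
    have "card {x \<in> P. x \<in> h} * card {h} \<le> rs P H"
      by (rule biclique_le_rs[OF P(1) H(1)]) (use h(1) in \<open>simp_all add: subset_iff\<close>)
    then show ?thesis using h(2) by simp
  qed
  with one show ?thesis by simp
qed

section \<open>Thresholds as polynomial inequalities and the choice of scales\<close>

lemma powr_neg_inverse_less:
  fixes s y :: real
  assumes "0 < s" "0 < y" "1 \<le> e"
  shows "s powr (- 1 / real e) < y \<longleftrightarrow> 1 < s * y ^ e"
    and "y < s powr (- 1 / real e) \<longleftrightarrow> s * y ^ e < 1"
proof -
  have eq: "(s powr (- 1 / real e)) ^ e = 1 / s"
  proof -
    have "(s powr (- 1 / real e)) ^ e = (s powr (- 1 / real e)) powr real e"
      using assms by (intro powr_realpow[symmetric]) simp
    also have "\<dots> = s powr (- 1 / real e * real e)" by (rule powr_powr)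
    also have "- 1 / real e * real e = - 1" using assms(3) by simp
    also have "s powr - 1 = 1 / s" using assms(1) by (simp add: powr_minus_divide)
    finally show ?thesis .
  qed
  have "s powr (- 1 / real e) < y \<longleftrightarrow> (s powr (- 1 / real e)) ^ e < y ^ e"
    unfolding not_le[symmetric] using assms by (subst power_mono_iff) auto
  then show "s powr (- 1 / real e) < y \<longleftrightarrow> 1 < s * y ^ e"
    unfolding eq using assms(1) by (simp add: field_simps)
  have "y < s powr (- 1 / real e) \<longleftrightarrow> y ^ e < (s powr (- 1 / real e)) ^ e"
    unfolding not_le[symmetric] using assms by (subst power_mono_iff) auto
  then show "y < s powr (- 1 / real e) \<longleftrightarrow> s * y ^ e < 1"
    unfolding eq using assms(1) by (simp add: field_simps)
qed

text \<open>Take the least \<open>q = 2 ^ j\<close> with \<open>q ^ (e - 1)\<close> at least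
  \<open>2 \<epsilon> s\<close>, and the integer part \<open>t\<close> of
  \<open>1 / (\<epsilon> q)\<close>. Then \<open>t q\<close> is at least
  \<open>1 / (2 \<epsilon>)\<close>, so \<open>t q ^ e\<close> reaches \<open>s\<close>. Minimality
  bounds \<open>q ^ (e - 1)\<close> from above; together with the factor 4 in the hypothesis it
  gives \<open>\<epsilon> q \<le> 1\<close>, so that \<open>t\<close> is at least 1.\<close>

lemma ex_scale:
  fixes \<epsilon> :: real
  assumes \<epsilon>: "0 < \<epsilon>" "\<epsilon> < 1" and e: "1 \<le> e" and small: "real s * (4 * \<epsilon>) ^ e < 1"
  obtains j t :: nat where "1 \<le> t" "\<epsilon> * (real t * real (2 ^ j)) \<le> 1" "1 \<le> 2 * \<epsilon> * (real t * real (2 ^ j))"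
    "s \<le> t * (2 ^ j) ^ e" "real ((2 ^ j) ^ (e - 1)) \<le> max 1 (2 ^ e * (\<epsilon> * real s))"
proof -
  obtain f where f: "e = Suc f" using e by (cases e) auto
  define P where "P j \<longleftrightarrow> 2 * \<epsilon> * real s \<le> (2 ^ j) ^ f" for j :: nat
  have "\<exists>j. P j"
  proof (cases "f = 0")
    case True
    have "2 * \<epsilon> * real s \<le> real s * (4 * \<epsilon>) ^ e" using True f \<epsilon> by simp
    then show ?thesis using small True by (auto simp: P_def)
  next
    case False
    obtain j where j: "2 * \<epsilon> * real s < 2 ^ j" using real_arch_pow[of 2 "2 * \<epsilon> * real s"] by auto
    have "(2 ^ j :: real) ^ 1 \<le> (2 ^ j) ^ f" using False by (intro power_increasing) auto
    then show ?thesis using j by (auto simp: P_def intro!: exI[of _ j])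
  qed
  define j where "j = (LEAST j. P j)"
  have Pj: "P j" unfolding j_def using \<open>\<exists>j. P j\<close> by (rule LeastI_ex)
  have j: "\<epsilon> * 2 ^ j \<le> 1 \<and> (2 ^ j) ^ f \<le> max 1 (2 ^ e * (\<epsilon> * real s))"
  proof (cases j)
    case 0
    then show ?thesis using \<epsilon> by simp
  next
    case (Suc i)
    then have "\<not> P i" using not_less_Least[of i P] by (simp add: j_def)
    then have i: "(2 ^ i) ^ f < 2 * \<epsilon> * real s" by (simp add: P_def)
    have "(4 * \<epsilon>) ^ f * (2 ^ i) ^ f < (4 * \<epsilon>) ^ f * (2 * \<epsilon> * real s)"
      using i \<epsilon> by (intro mult_strict_left_mono) auto
    also have "\<dots> = real s * (4 * \<epsilon>) ^ e / 2" by (simp add: f)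
    finally have "(4 * \<epsilon> * 2 ^ i) ^ f < 1 ^ f" using small by (simp only: power_mult_distrib power_one)
    then have "4 * \<epsilon> * 2 ^ i < 1" by (rule power_less_imp_less_base) simp
    then have 1: "\<epsilon> * 2 ^ j \<le> 1" using Suc by simp
    have "(2 ^ j :: real) ^ f = 2 ^ f * (2 ^ i) ^ f" by (simp add: Suc power_mult_distrib)
    also have "\<dots> \<le> 2 ^ f * (2 * \<epsilon> * real s)" using i by (intro mult_left_mono) auto
    also have "\<dots> = 2 ^ e * (\<epsilon> * real s)" by (simp add: f)
    finally show ?thesis using 1 by simp
  qed
  define y where "y = 1 / (\<epsilon> * 2 ^ j)"
  have y: "1 \<le> y" using j \<epsilon> by (simp add: y_def)
  define t where "t = nat \<lfloor>y\<rfloor>"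
  have t1: "1 \<le> t" using y by (simp add: t_def le_nat_floor le_nat_iff)
  have ty: "real t \<le> y" using y by (simp add: t_def)
  have yt: "y < real t + 1" using y unfolding t_def by linarith
  moreover have "1 \<le> real t" using t1 by simp
  ultimately have y2: "y \<le> 2 * real t" by linarith
  have \<epsilon>j: "0 < \<epsilon> * 2 ^ j" using \<epsilon> by simp
  have up: "real t * (\<epsilon> * 2 ^ j) \<le> 1" using ty \<epsilon>j unfolding y_def by (simp only: pos_le_divide_eq)
  have low: "1 \<le> 2 * real t * (\<epsilon> * 2 ^ j)" using y2 \<epsilon>j unfolding y_def by (simp only: pos_divide_le_eq)
  have "real s \<le> real (t * (2 ^ j) ^ e)"
  proof -
    have "2 * \<epsilon> * real s \<le> (2 ^ j) ^ f" using Pj by (simp add: P_def)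
    also have "\<dots> \<le> (2 * real t * (\<epsilon> * 2 ^ j)) * (2 ^ j) ^ f"
      using mult_right_mono[OF low, of "(2 ^ j) ^ f"] by simp
    also have "\<dots> = 2 * \<epsilon> * real (t * (2 ^ j) ^ e)" by (simp add: f)
    finally show ?thesis using \<epsilon> by (simp only: mult_le_cancel_left_pos[of "2 * \<epsilon>"])
  qed
  then have s_le: "s \<le> t * (2 ^ j) ^ e" by (simp only: of_nat_le_iff)
  show ?thesis
  proof (rule that[OF t1 _ _ s_le])
    show "\<epsilon> * (real t * real (2 ^ j)) \<le> 1" using up by (simp add: mult_ac)
    show "1 \<le> 2 * \<epsilon> * (real t * real (2 ^ j))" using low by (simp add: mult_ac)
    show "real ((2 ^ j) ^ (e - 1)) \<le> max 1 (2 ^ e * (\<epsilon> * real s))" using j by (simp add: f)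
  qed
qed

lemma le_mult_div_add_one:
  fixes x N :: nat
  assumes "0 < N"
  shows "x \<le> N * (x div N + 1)"
proof -
  have "N * (x div N) + x mod N = x" by (rule mult_div_mod_eq)
  moreover have "N * (x div N + 1) = N * (x div N) + N" by simp
  ultimately show ?thesis using mod_less_divisor[OF assms, of x] by linarith
qed

lemma threshold_one: "1 \<le> m \<Longrightarrow> 1 \<le> threshold 1 m n"
  by (simp add: threshold_def)

lemma sparse_values:
  fixes \<epsilon> :: real
  assumes d: "2 \<le> d" and mn: "1 \<le> m" "m \<le> n" and \<epsilon>: "0 < \<epsilon>" "\<epsilon> < 1"
    and small: "\<epsilon> < 1 / 4 * threshold d m n" and kl: "(k, l) = (m, n) \<or> (k, l) = (n, m)"
  shows "\<exists>v \<in> rs_values d k l (\<epsilon> * real m * real n). real v \<le> (2 ^ d + 2) * max 1 (\<epsilon> * n)"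
proof -
  have kl': "k \<le> n" "l \<le> n" "real l * real k = real m * real n" using kl mn by auto
  have incidences: "\<epsilon> * real m * real n \<le> 1 / (real t * real q) * real l * real k"
    if "1 \<le> t" "1 \<le> q" "\<epsilon> * (real t * real q) \<le> 1" for t q :: nat
  proof -
    have "\<epsilon> \<le> 1 / (real t * real q)" using that by (simp add: pos_le_divide_eq)
    then have "\<epsilon> * (real m * real n) \<le> 1 / (real t * real q) * (real m * real n)"
      by (rule mult_right_mono) simp
    then show ?thesis using kl'(3) by (simp only: mult.assoc)
  qed
  have q1: "1 \<le> (2 ^ j :: nat)" for j by simp
  have d0: "1 \<le> d" using d by simp
  \<comment> \<open>If the term of \<open>n\<close> decides, the full grid accommodates
    \<open>n\<close> vertices on both sides. Otherwise a grid of one dimension less accommodates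
    \<open>m\<close>, and the larger side receives a multiplicity.\<close>
  have "4 * \<epsilon> < real m powr (- 1 / (real d - 1)) \<or> 4 * \<epsilon> < real n powr (- 1 / real d)"
    using small by (auto simp: threshold_def max_def split: if_splits)
  then show ?thesis
  proof
    assume "4 * \<epsilon> < real n powr (- 1 / real d)"
    then have sm: "real n * (4 * \<epsilon>) ^ d < 1"
      using powr_neg_inverse_less(2)[of "real n" "4 * \<epsilon>" d] mn \<epsilon> d by simp
    obtain t j :: nat where tj: "1 \<le> t" "\<epsilon> * (real t * real (2 ^ j)) \<le> 1"
      "n \<le> t * (2 ^ j) ^ d" "real ((2 ^ j) ^ (d - 1)) \<le> max 1 (2 ^ d * (\<epsilon> * real n))"
      using ex_scale[OF \<epsilon> d0 sm] by blast
    have "realizable d l k (1 / (real t * real (2 ^ j)) * real l * real k) ((2 ^ j) ^ (d - 1))"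
      using d tj(1,3) kl'(1,2) by (intro realizable_full) linarith+
    from realizable_rs_values[OF this order_refl order_refl incidences[OF tj(1) q1 tj(2)]]
    obtain v where v: "v \<in> rs_values d k l (\<epsilon> * real m * real n)" "v \<le> (2 ^ j) ^ (d - 1)" by blast
    have "real v \<le> max 1 (2 ^ d * (\<epsilon> * real n))"
      using v(2) tj(4) of_nat_le_iff[of v "(2 ^ j) ^ (d - 1)", where 'a = real] by linarith
    also have "\<dots> \<le> 2 ^ d * max 1 (\<epsilon> * n)"
      by (simp add: max_mult_distrib_left max.coboundedI1)
    also have "\<dots> \<le> (2 ^ d + 2) * max 1 (\<epsilon> * n)" by (intro mult_right_mono) auto
    finally have "real v \<le> (2 ^ d + 2) * max 1 (\<epsilon> * n)" .
    then show ?thesis using v(1) by (rule bexI)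
  next
    assume *: "4 * \<epsilon> < real m powr (- 1 / (real d - 1))"
    have d1: "real d - 1 = real (d - 1)" "1 \<le> d - 1" using d by auto
    have "0 < real m" "0 < 4 * \<epsilon>" using mn \<epsilon> by simp_all
    from powr_neg_inverse_less(2)[OF this d1(2)] have sm: "real m * (4 * \<epsilon>) ^ (d - 1) < 1"
      using * unfolding d1(1) by blast
    obtain t j :: nat where tj: "1 \<le> t" "\<epsilon> * (real t * real (2 ^ j)) \<le> 1"
      "1 \<le> 2 * \<epsilon> * (real t * real (2 ^ j))" "m \<le> t * (2 ^ j) ^ (d - 1)"
      "real ((2 ^ j) ^ (d - 1 - 1)) \<le> max 1 (2 ^ (d - 1) * (\<epsilon> * real m))"
      by (rule ex_scale[OF \<epsilon> d1(2) sm])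
    define N :: nat where "N = t * (2 ^ j) ^ (d - 1)"
    have N: "0 < N" using tj(1) by (simp add: N_def)
    define \<mu> where "\<mu> = n div N + 1"
    have \<mu>N: "n \<le> N * \<mu>"
      unfolding \<mu>_def by (rule le_mult_div_add_one[OF N])
    have "\<exists>u w. (u = 1 \<or> w = 1) \<and> u * w = \<mu> \<and> l \<le> N * u \<and> k \<le> N * w"
      using kl
    proof
      assume "(k, l) = (m, n)"
      then show ?thesis using \<mu>N tj(4) by (intro exI[of _ \<mu>] exI[of _ 1]) (simp add: N_def)
    next
      assume "(k, l) = (n, m)"
      then show ?thesis using \<mu>N tj(4) by (intro exI[of _ 1] exI[of _ \<mu>]) (simp add: N_def)
    qed
    then obtain u w where uw: "u = 1 \<or> w = 1" "u * w = \<mu>" "l \<le> N * u" "k \<le> N * w" by blast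
    have "realizable d l k (1 / (real t * real (2 ^ j)) * real l * real k) ((2 ^ j) ^ (d - 2) * u * w)"
      using uw(3,4) unfolding N_def by (intro realizable_one_multiplicity[OF d tj(1) uw(1)]) (simp_all only: mult.assoc)
    from realizable_rs_values[OF this order_refl order_refl incidences[OF tj(1) q1 tj(2)]]
    obtain v where v: "v \<in> rs_values d k l (\<epsilon> * real m * real n)" "v \<le> (2 ^ j) ^ (d - 2) * u * w" by blast
    define Q :: real where "Q = (2 ^ j) ^ (d - 2)"
    define q :: real where "q = 2 ^ j"
    have Q: "0 < Q" and q: "0 < q" by (simp_all add: Q_def q_def)
    have RN: "real N = real t * q * Q"
    proof -
      have "d - 1 = Suc (d - 2)" using d by simp
      then show ?thesis by (simp add: N_def Q_def q_def)
    qed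
    \<comment> \<open>With \<open>Q = q ^ (d - 2)\<close> the bound is at most
      \<open>n / (t q) + Q\<close>. The first term is at most \<open>2 \<epsilon> n\<close>, the
      second at most \<open>2 ^ d * max 1 (\<epsilon> n)\<close>: hence the constant
      \<open>2 ^ d + 2\<close>.\<close>
    have "real v \<le> real ((2 ^ j) ^ (d - 2) * \<mu>)"
      using v(2) uw(2) unfolding of_nat_le_iff by (simp add: mult.assoc)
    also have "\<dots> = Q * real \<mu>" by (simp add: Q_def)
    also have "\<dots> \<le> Q * (real n / real N + 1)"
      using Q of_nat_div_le_of_nat[of n N, where 'a = real] by (intro mult_left_mono) (simp_all add: \<mu>_def)
    also have "\<dots> = real n * (1 / (real t * q)) + Q"
    proof -
      have "Q * (real n / real N) = real n * (1 / (real t * q))"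
        unfolding RN using Q by simp
      then show ?thesis by (simp only: distrib_left mult_1_right)
    qed
    finally have v_le: "real v \<le> real n * (1 / (real t * q)) + Q" .
    have "real n * (1 / (real t * q)) \<le> real n * (2 * \<epsilon>)"
    proof (rule mult_left_mono)
      have "1 \<le> 2 * \<epsilon> * (real t * q)" using tj(3) by (simp add: q_def)
      then show "1 / (real t * q) \<le> 2 * \<epsilon>" using q tj(1) by (simp add: pos_divide_le_eq)
    qed simp
    moreover have "Q \<le> 2 ^ d * max 1 (\<epsilon> * n)"
    proof -
      have "Q \<le> max 1 (2 ^ (d - 1) * (\<epsilon> * real m))"
      proof -
        have "d - 1 - 1 = d - 2" "real ((2 ^ j) ^ (d - 2)) = Q" by (simp_all add: Q_def)
        then show ?thesis using tj(5) by (simp only:)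
      qed
      also have "\<dots> \<le> max (2 ^ d * 1) (2 ^ d * (\<epsilon> * n))"
      proof (rule max.mono)
        show "1 \<le> 2 ^ d * (1 :: real)" by simp
        have "(2 :: real) ^ (d - 1) \<le> 2 ^ d" by (rule power_increasing) simp_all
        moreover have "\<epsilon> * real m \<le> \<epsilon> * n" using mn \<epsilon> by (intro mult_left_mono) simp_all
        ultimately show "2 ^ (d - 1) * (\<epsilon> * real m) \<le> 2 ^ d * (\<epsilon> * n)"
          using \<epsilon> by (intro mult_mono) simp_all
      qed
      also have "\<dots> = 2 ^ d * max 1 (\<epsilon> * n)" by (simp add: max_mult_distrib_left)
      finally show ?thesis .
    qed
    moreover have "real n * (2 * \<epsilon>) = 2 * (\<epsilon> * n)" by simp
    moreover have "\<epsilon> * n \<le> max 1 (\<epsilon> * n)" by simp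
    ultimately have "real v \<le> (2 ^ d + 2) * max 1 (\<epsilon> * n)"
      using v_le unfolding distrib_right by linarith
    then show ?thesis using v(1) by (rule bexI)
  qed
qed

lemma ex_power_of_two:
  fixes y :: real
  assumes "1 \<le> y"
  obtains j :: nat where "2 ^ j \<le> y" "y < 2 * 2 ^ j"
proof -
  define P where "P j \<longleftrightarrow> y < 2 ^ j" for j :: nat
  have "\<exists>j. P j" using real_arch_pow[of 2 y] by (simp add: P_def)
  then have PL: "P (LEAST j. P j)" by (rule LeastI_ex)
  then obtain j where j: "(LEAST j. P j) = Suc j"
    using assms by (cases "LEAST j. P j") (simp_all add: P_def)
  then have "\<not> P j" using not_less_Least[of j P] by simp
  then show ?thesis using that[of j] PL unfolding j by (simp add: P_def not_less)
qed

text \<open>Here \<open>q\<close> is the largest power of two below 1/\<epsilon>, and both sides are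
  filled up from \<open>q ^ (d - 2)\<close> by multiplicities.\<close>

lemma dense_values:
  fixes \<epsilon> :: real
  assumes d: "3 \<le> d" and mn: "1 \<le> m" "m \<le> n" and \<epsilon>: "0 < \<epsilon>" "\<epsilon> < 1"
    and m: "1 < real m * \<epsilon> ^ (d - 1)" and kl: "(k, l) = (m, n) \<or> (k, l) = (n, m)"
  shows "\<exists>v \<in> rs_values d k l (\<epsilon> * real m * real n). real v \<le> 2 ^ (d + 1) * (\<epsilon> ^ (d - 1) * m * n)"
proof -
  obtain j :: nat where j: "2 ^ j \<le> 1 / \<epsilon>" "1 / \<epsilon> < 2 * 2 ^ j"
    using ex_power_of_two[of "1 / \<epsilon>"] \<epsilon> by auto
  define g where "g = d - 3"
  have dg: "d - 2 = Suc g" "d - 1 = Suc (Suc g)" "d - 3 = g" "d + 1 = g + 4" using d by (simp_all add: g_def)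
  define q :: real where "q = 2 ^ j"
  have q: "1 \<le> q" "\<epsilon> * q \<le> 1" "1 < 2 * \<epsilon> * q"
    using j \<epsilon> by (simp_all add: q_def field_simps)
  define N :: nat where "N = (2 ^ j) ^ (d - 2)"
  have N: "0 < N" by (simp add: N_def)
  have RN: "real N = q ^ Suc g" by (simp add: N_def q_def dg)
  \<comment> \<open>The grid is no larger than the smaller side, so rounding a multiplicity up at
    most doubles a side.\<close>
  have Nm: "real N \<le> real m"
  proof -
    have "q ^ Suc g \<le> q ^ Suc (Suc g) * 1"
      unfolding mult_1_right using q(1) by (intro power_increasing) simp_all
    also have "q ^ Suc (Suc g) * 1 \<le> q ^ Suc (Suc g) * (real m * \<epsilon> ^ Suc (Suc g))"
    proof (rule mult_left_mono)
      show "1 \<le> real m * \<epsilon> ^ Suc (Suc g)" using m unfolding dg(2) by (rule less_imp_le)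
      show "0 \<le> q ^ Suc (Suc g)" using q(1) by (intro zero_le_power) simp
    qed
    also have "\<dots> = real m * (\<epsilon> * q) ^ Suc (Suc g)" by (simp only: power_mult_distrib mult_ac)
    also have "\<dots> \<le> real m * 1"
      using q \<epsilon> by (intro mult_left_mono power_le_one) simp_all
    finally show ?thesis by (simp only: RN mult_1_right)
  qed
  define up where "up x = x div N + 1" for x :: nat
  have up: "x \<le> N * up x" for x
    unfolding up_def by (rule le_mult_div_add_one[OF N])
  have up_le: "real N * real (up x) \<le> 2 * real x" if "m \<le> x" for x
  proof -
    have "N * (x div N) \<le> x" by simp
    then have "N * up x \<le> x + N" by (simp add: up_def)
    then have "real (N * up x) \<le> real (x + N)" by (simp only: of_nat_le_iff)
    then show ?thesis using Nm that by simp
  qed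
  have kl': "m \<le> k" "m \<le> l" "real l * real k = real m * real n" using kl mn by auto
  have "realizable d l k (1 / real (2 ^ j) * real l * real k) ((2 ^ j) ^ (d - 3) * up l * up k)"
    by (rule realizable_two_multiplicities[OF d]) (use up in \<open>simp_all only: N_def\<close>)
  moreover have "\<epsilon> * real m * real n \<le> 1 / real (2 ^ j) * real l * real k"
  proof -
    have "\<epsilon> \<le> 1 / q" using q by (simp add: pos_le_divide_eq)
    then have "\<epsilon> * (real m * real n) \<le> 1 / q * (real m * real n)" by (rule mult_right_mono) simp
    then show ?thesis using kl'(3) by (simp add: q_def mult.assoc)
  qed
  ultimately obtain v where v: "v \<in> rs_values d k l (\<epsilon> * real m * real n)" "v \<le> (2 ^ j) ^ (d - 3) * up l * up k"
    using realizable_rs_values[OF _ order_refl order_refl] by blast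
  have "real v \<le> real ((2 ^ j) ^ (d - 3) * up l * up k)" using v(2) by (simp only: of_nat_le_iff)
  also have "\<dots> = q ^ g * real (up l) * real (up k)" by (simp add: q_def dg)
  finally have v_le: "real v \<le> q ^ g * real (up l) * real (up k)" .
  \<comment> \<open>The exponents match as \<open>q ^ (d - 1) * q ^ (d - 3)\<close> is the square of
    \<open>q ^ (d - 2)\<close>. Rounding costs 4, and replacing \<open>1 / q\<close> by
    \<open>2 \<epsilon>\<close> costs \<open>2 ^ (d - 1)\<close>.\<close>
  have "q ^ (g + 2) * real v \<le> q ^ (g + 2) * (q ^ g * real (up l) * real (up k))"
    using v_le q(1) by (intro mult_left_mono) simp_all
  also have "\<dots> = (real N * real (up l)) * (real N * real (up k))"
    unfolding RN by (simp add: power_add mult_ac power2_eq_square)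
  also have "\<dots> \<le> (2 * real l) * (2 * real k)"
    by (rule mult_mono[OF up_le[OF kl'(2)] up_le[OF kl'(1)]]) simp_all
  also have "\<dots> = 4 * (real m * real n)" using kl'(3) by simp
  finally have 1: "q ^ (g + 2) * real v \<le> 4 * (real m * real n)" .
  have "1 \<le> (2 * \<epsilon> * q) ^ (g + 2)" using q(3) by (intro one_le_power) simp
  then have "1 * real v \<le> (2 * \<epsilon> * q) ^ (g + 2) * real v" by (rule mult_right_mono) simp
  also have "\<dots> = (2 * \<epsilon>) ^ (g + 2) * (q ^ (g + 2) * real v)"
    by (simp only: power_mult_distrib mult_ac)
  also have "\<dots> \<le> (2 * \<epsilon>) ^ (g + 2) * (4 * (real m * real n))"
    using 1 \<epsilon> by (intro mult_left_mono) simp_all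
  also have "\<dots> = 2 ^ (g + 2) * 4 * (\<epsilon> ^ (g + 2) * m * n)" by (simp only: power_mult_distrib mult_ac)
  also have "2 ^ (g + 2) * 4 = (2 :: real) ^ (d + 1)"
    unfolding dg(4) by (simp add: power_add)
  also have "g + 2 = d - 1" using dg by simp
  finally have "real v \<le> 2 ^ (d + 1) * (\<epsilon> ^ (d - 1) * m * n)" by simp
  then show ?thesis using v(1) by (rule bexI)
qed

section \<open>The minimum in both ranges\<close>

lemma rs_min_config:
  assumes "rs_values d k l I \<noteq> {}"
  obtains F :: "nat ring" and P H where "config F d k l I P H" "rs_min d k l I = rs P H"
  using rs_min_in_rs_values[OF assms] unfolding rs_values_def by blast

lemma threshold_bounds:
  fixes \<epsilon> :: real
  assumes d: "2 \<le> d" and mn: "1 \<le> m" "m \<le> n" and \<epsilon>: "0 < \<epsilon>" and large: "100 * threshold d m n < \<epsilon>"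
  shows "(100 / \<epsilon>) ^ (d - 1) < real m" and "(100 / \<epsilon>) ^ d < real n"
proof -
  have th: "real m powr (- 1 / (real d - 1)) < \<epsilon> / 100" "real n powr (- 1 / real d) < \<epsilon> / 100"
    using large by (simp_all add: threshold_def)
  have pos: "0 < real m" "0 < real n" "0 < \<epsilon> / 100" using mn \<epsilon> by simp_all
  have d1: "real d - 1 = real (d - 1)" "1 \<le> d - 1" "1 \<le> d" using d by auto
  have inv: "(100 / \<epsilon>) ^ e < s" if "1 < s * (\<epsilon> / 100) ^ e" for s :: real and e
  proof -
    have "1 < s * \<epsilon> ^ e / 100 ^ e" using that by (simp add: power_divide)
    then have "100 ^ e < s * \<epsilon> ^ e" by (simp add: pos_less_divide_eq)
    then show ?thesis using \<epsilon> by (simp add: power_divide pos_divide_less_eq)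
  qed
  show "(100 / \<epsilon>) ^ (d - 1) < real m"
    using powr_neg_inverse_less(1)[OF pos(1,3) d1(2)] th(1) unfolding d1(1) by (intro inv) blast
  show "(100 / \<epsilon>) ^ d < real n"
    using powr_neg_inverse_less(1)[OF pos(2,3) d1(3)] th(2) by (intro inv) blast
qed

text \<open>The alternative in \<open>ne\<close> concerns the plane: there incidence graphs contain
  no \<open>K_{2,2}\<close>, so at this density counting pairs rules out any configuration, and no
  construction can be given.\<close>

lemma dense_case:
  fixes \<epsilon> :: real
  assumes d: "2 \<le> d" and mn: "1 \<le> m" "m \<le> n" and \<epsilon>: "0 < \<epsilon>" "\<epsilon> < 1"
    and large: "100 * threshold d m n < \<epsilon>" and kl: "(k, l) = (m, n) \<or> (k, l) = (n, m)"
    and ne: "3 \<le> d \<or> rs_values d k l (\<epsilon> * real m * real n) \<noteq> {}"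
  shows "rs_values d k l (\<epsilon> * real m * real n) \<noteq> {}"
    and "\<epsilon> ^ (d - 1) * real m * real n \<le> biclique_const d * real (rs_min d k l (\<epsilon> * real m * real n))"
    and "real (rs_min d k l (\<epsilon> * real m * real n)) \<le> 2 ^ (d + 1) * (\<epsilon> ^ (d - 1) * real m * real n)"
proof -
  let ?I = "\<epsilon> * real m * real n"
  note th = threshold_bounds[OF d mn \<epsilon>(1) large]
  have m1: "1 < real m * \<epsilon> ^ (d - 1)"
  proof -
    have "1 * 1 \<le> 100 ^ (d - 1) * (1 :: real)" by simp
    also have "\<dots> = (100 / \<epsilon>) ^ (d - 1) * \<epsilon> ^ (d - 1)" using \<epsilon> by (simp add: power_divide)
    also have "\<dots> < real m * \<epsilon> ^ (d - 1)" using th(1) \<epsilon> by (intro mult_strict_right_mono) simp_all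
    finally show ?thesis by simp
  qed
  \<comment> \<open>A star has at most \<open>n\<close> edges, and \<open>m \<epsilon> > 1\<close>
    turns this into the required form.\<close>
  have low_dim: "real (rs_min d k l ?I) \<le> 2 ^ (d + 1) * (\<epsilon> ^ (d - 1) * m * n)"
    if d2: "d = 2" and ne2: "rs_values d k l ?I \<noteq> {}"
  proof -
    obtain F :: "nat ring" and P H where F: "config F d k l ?I P H" "rs_min d k l ?I = rs P H"
      by (rule rs_min_config[OF ne2])
    have "rs P H \<le> max k l" using rs_config_small_dim[OF F(1)] d2 by simp
    also have "max k l = n" using kl mn by auto
    finally have "real (rs_min d k l ?I) \<le> 1 * real n" using F(2) by simp
    also have "\<dots> \<le> (real m * \<epsilon> ^ (d - 1)) * real n" using m1 by (intro mult_right_mono) simp_all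
    also have "\<dots> \<le> 2 ^ (d + 1) * ((real m * \<epsilon> ^ (d - 1)) * real n)"
    proof -
      have "1 \<le> (2 :: real) ^ (d + 1)" by (rule one_le_power) simp
      moreover have "0 \<le> (real m * \<epsilon> ^ (d - 1)) * real n" using \<epsilon> by simp
      ultimately have "1 * ((real m * \<epsilon> ^ (d - 1)) * real n) \<le> 2 ^ (d + 1) * ((real m * \<epsilon> ^ (d - 1)) * real n)"
        by (rule mult_right_mono)
      then show ?thesis by (simp only: mult_1_left)
    qed
    finally show ?thesis by (simp only: mult_ac)
  qed
  have high_dim: "\<exists>v \<in> rs_values d k l ?I. real v \<le> 2 ^ (d + 1) * (\<epsilon> ^ (d - 1) * m * n)" if "3 \<le> d"
    by (rule dense_values[OF that mn \<epsilon> m1 kl])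
  show ne': "rs_values d k l ?I \<noteq> {}" using ne high_dim by blast
  show "real (rs_min d k l ?I) \<le> 2 ^ (d + 1) * (\<epsilon> ^ (d - 1) * real m * real n)"
  proof (cases "3 \<le> d")
    case True
    then obtain v where v: "v \<in> rs_values d k l ?I" "real v \<le> 2 ^ (d + 1) * (\<epsilon> ^ (d - 1) * m * n)"
      using high_dim by blast
    have "real (rs_min d k l ?I) \<le> real v" using rs_min_le[OF v(1)] by simp
    then show ?thesis using v(2) by (rule order_trans)
  next
    case False
    then show ?thesis using low_dim ne' d by simp
  qed
  obtain F :: "nat ring" and P H where F: "config F d k l ?I P H" "rs_min d k l ?I = rs P H"
    by (rule rs_min_config[OF ne'])
  show "\<epsilon> ^ (d - 1) * real m * real n \<le> biclique_const d * real (rs_min d k l ?I)"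
    unfolding F(2) by (rule config_lower_bound[OF F(1) kl d \<epsilon>(1) th])
qed

text \<open>The alternative in \<open>ne\<close> concerns \<open>d = 1\<close>: incidences form a
  matching there, so at most \<open>m\<close> of them occur and a value exists only if \<epsilon>n
  is at most 1.\<close>

lemma sparse_case:
  fixes \<epsilon> :: real
  assumes d: "1 \<le> d" and mn: "1 \<le> m" "m \<le> n" and \<epsilon>: "0 < \<epsilon>" "\<epsilon> < 1"
    and small: "\<epsilon> < 1 / 4 * threshold d m n" and kl: "(k, l) = (m, n) \<or> (k, l) = (n, m)"
    and ne: "2 \<le> d \<or> rs_values d k l (\<epsilon> * real m * real n) \<noteq> {}"
  shows "rs_values d k l (\<epsilon> * real m * real n) \<noteq> {}"
    and "max 1 (\<epsilon> * real n) \<le> real (rs_min d k l (\<epsilon> * real m * real n))"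
    and "real (rs_min d k l (\<epsilon> * real m * real n)) \<le> (2 ^ d + 2) * max 1 (\<epsilon> * real n)"
proof -
  let ?I = "\<epsilon> * real m * real n"
  have vals: "\<exists>v \<in> rs_values d k l ?I. real v \<le> (2 ^ d + 2) * max 1 (\<epsilon> * real n)" if "2 \<le> d"
    by (rule sparse_values[OF that mn \<epsilon> small kl])
  show ne': "rs_values d k l ?I \<noteq> {}" using ne vals by blast
  obtain F :: "nat ring" and P H where F: "config F d k l ?I P H" "rs_min d k l ?I = rs P H"
    by (rule rs_min_config[OF ne'])
  have n1: "1 \<le> n" using mn by simp
  show "max 1 (\<epsilon> * real n) \<le> real (rs_min d k l ?I)"
    unfolding F(2) by (rule config_star_bound[OF F(1) kl \<epsilon>(1) mn(1) n1])
  show "real (rs_min d k l ?I) \<le> (2 ^ d + 2) * max 1 (\<epsilon> * real n)"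
  proof (cases "2 \<le> d")
    case True
    then obtain v where v: "v \<in> rs_values d k l ?I" "real v \<le> (2 ^ d + 2) * max 1 (\<epsilon> * real n)"
      using vals by blast
    have "real (rs_min d k l ?I) \<le> real v" using rs_min_le[OF v(1)] by simp
    then show ?thesis using v(2) by (rule order_trans)
  next
    case False
    then have "rs P H \<le> 1" using rs_config_small_dim[OF F(1)] d by simp
    then have "real (rs_min d k l ?I) \<le> 1 * 1" using F(2) by simp
    also have "\<dots> \<le> (2 ^ d + 2) * max 1 (\<epsilon> * real n)"
      by (rule mult_mono) simp_all
    finally show ?thesis .
  qed
qed

text \<open>A single incidence is already a biclique with one edge, while \<epsilon>n may be
  arbitrarily small; the order of magnitude in the sparse range is therefore expressed with
  \<open>max 1\<close>. The conditions on \<open>d\<close> separate the dimensions with a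
  construction from those where the minimum may range over an empty set.\<close>

theorem theorem1p3:
  fixes d :: nat
  assumes "1 \<le> d"
  shows "\<exists>c C :: real. 0 < c \<and> 0 < C \<and>
    (\<forall>(m :: nat) (n :: nat) (\<epsilon> :: real) (I :: real).
      1 \<le> m \<and> m \<le> n \<and> 0 < \<epsilon> \<and> \<epsilon> < 1 \<and> I = \<epsilon> * real m * real n \<longrightarrow>
      (\<forall>(k, l) \<in> {(m, n), (n, m)}.
        (\<epsilon> > 100 * threshold d m n \<and> (3 \<le> d \<or> rs_values d k l I \<noteq> {}) \<longrightarrow>
           rs_values d k l I \<noteq> {} \<and>
           c * (\<epsilon> ^ (d - 1) * real m * real n) \<le> real (rs_min d k l I) \<and>
           real (rs_min d k l I) \<le> C * (\<epsilon> ^ (d - 1) * real m * real n)) \<and>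
        (\<epsilon> < 1 / 4 * threshold d m n \<and> (2 \<le> d \<or> rs_values d k l I \<noteq> {}) \<longrightarrow>
           rs_values d k l I \<noteq> {} \<and>
           c * max 1 (\<epsilon> * real n) \<le> real (rs_min d k l I) \<and>
           real (rs_min d k l I) \<le> C * max 1 (\<epsilon> * real n))))"
proof -
  define c :: real where "c = min 1 (1 / biclique_const d)"
  define C :: real where "C = 2 ^ (d + 1) + 2"
  have B: "0 < biclique_const d" by (simp add: biclique_const_def)
  have c: "0 < c" "c \<le> 1" "c * biclique_const d \<le> 1"
    using B by (simp_all add: c_def min_def field_simps)
  have C: "0 < C" "2 ^ (d + 1) \<le> C" "2 ^ d + 2 \<le> C"
  proof -
    have "0 < (2 :: real) ^ d" by simp
    then show "0 < C" "2 ^ (d + 1) \<le> C" "2 ^ d + 2 \<le> C" unfolding C_def power_add power_one_right by linarith+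
  qed
  have main: "(\<epsilon> > 100 * threshold d m n \<and> (3 \<le> d \<or> rs_values d k l I \<noteq> {}) \<longrightarrow>
           rs_values d k l I \<noteq> {} \<and>
           c * (\<epsilon> ^ (d - 1) * real m * real n) \<le> real (rs_min d k l I) \<and>
           real (rs_min d k l I) \<le> C * (\<epsilon> ^ (d - 1) * real m * real n)) \<and>
        (\<epsilon> < 1 / 4 * threshold d m n \<and> (2 \<le> d \<or> rs_values d k l I \<noteq> {}) \<longrightarrow>
           rs_values d k l I \<noteq> {} \<and>
           c * max 1 (\<epsilon> * real n) \<le> real (rs_min d k l I) \<and>
           real (rs_min d k l I) \<le> C * max 1 (\<epsilon> * real n))"
    if mn: "1 \<le> m" "m \<le> n" and \<epsilon>: "0 < \<epsilon>" "\<epsilon> < 1" and I: "I = \<epsilon> * real m * real n"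
      and kl: "(k, l) = (m, n) \<or> (k, l) = (n, m)"
    for m n k l :: nat and \<epsilon> I :: real
  proof (intro conjI[of "_ \<longrightarrow> _"] impI; elim conjE)
    assume large: "100 * threshold d m n < \<epsilon>" and ne: "3 \<le> d \<or> rs_values d k l I \<noteq> {}"
    \<comment> \<open>In dimension one the threshold is at least 1, so the dense range is
      empty.\<close>
    have "d \<noteq> 1" using threshold_one[OF mn(1), of n] large \<epsilon> by auto
    then have d2: "2 \<le> d" using assms by simp
    note dense = dense_case[OF d2 mn \<epsilon> large kl ne[unfolded I], folded I]
    let ?v = "\<epsilon> ^ (d - 1) * real m * real n"
    have "c * ?v \<le> c * (biclique_const d * real (rs_min d k l I))"
      using dense(2) c(1) by (intro mult_left_mono) simp_all
    also have "\<dots> = (c * biclique_const d) * real (rs_min d k l I)" by simp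
    also have "\<dots> \<le> 1 * real (rs_min d k l I)" by (rule mult_right_mono[OF c(3)]) simp
    finally have "c * ?v \<le> real (rs_min d k l I)" by simp
    moreover have "2 ^ (d + 1) * ?v \<le> C * ?v" using \<epsilon> by (intro mult_right_mono C(2)) simp
    then have "real (rs_min d k l I) \<le> C * ?v" using dense(3) by (rule order_trans[rotated])
    ultimately show "rs_values d k l I \<noteq> {} \<and> c * ?v \<le> real (rs_min d k l I) \<and> real (rs_min d k l I) \<le> C * ?v"
      using dense(1) by blast
  next
    assume small: "\<epsilon> < 1 / 4 * threshold d m n" and ne: "2 \<le> d \<or> rs_values d k l I \<noteq> {}"
    note sparse = sparse_case[OF assms mn \<epsilon> small kl ne[unfolded I], folded I]
    let ?v = "max 1 (\<epsilon> * real n)"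
    have "c * ?v \<le> 1 * ?v" by (rule mult_right_mono[OF c(2)]) simp
    then have "c * ?v \<le> ?v" by (simp only: mult_1_left)
    then have "c * ?v \<le> real (rs_min d k l I)" using sparse(2) by (rule order_trans)
    moreover have "(2 ^ d + 2) * ?v \<le> C * ?v" by (intro mult_right_mono C(3)) simp
    then have "real (rs_min d k l I) \<le> C * ?v" using sparse(3) by (rule order_trans[rotated])
    ultimately show "rs_values d k l I \<noteq> {} \<and> c * ?v \<le> real (rs_min d k l I) \<and> real (rs_min d k l I) \<le> C * ?v"
      using sparse(1) by blast
  qed
  show ?thesis
  proof (rule exI[of _ c], rule exI[of _ C], intro conjI c(1) C(1) allI impI)
    fix m n :: nat and \<epsilon> I :: real
    assume "1 \<le> m \<and> m \<le> n \<and> 0 < \<epsilon> \<and> \<epsilon> < 1 \<and> I = \<epsilon> * real m * real n"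
    then have "1 \<le> m" "m \<le> n" "0 < \<epsilon>" "\<epsilon> < 1" "I = \<epsilon> * real m * real n" by blast+
    note main = main[OF this]
    show "\<forall>(k, l) \<in> {(m, n), (n, m)}.
        (\<epsilon> > 100 * threshold d m n \<and> (3 \<le> d \<or> rs_values d k l I \<noteq> {}) \<longrightarrow>
           rs_values d k l I \<noteq> {} \<and>
           c * (\<epsilon> ^ (d - 1) * real m * real n) \<le> real (rs_min d k l I) \<and>
           real (rs_min d k l I) \<le> C * (\<epsilon> ^ (d - 1) * real m * real n)) \<and>
        (\<epsilon> < 1 / 4 * threshold d m n \<and> (2 \<le> d \<or> rs_values d k l I \<noteq> {}) \<longrightarrow>
           rs_values d k l I \<noteq> {} \<and>
           c * max 1 (\<epsilon> * real n) \<le> real (rs_min d k l I) \<and>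
           real (rs_min d k l I) \<le> C * max 1 (\<epsilon> * real n))"
      unfolding ball_simps prod.case
      by (rule conjI[OF main[OF disjI1[OF refl]] conjI[OF main[OF disjI2[OF refl]] TrueI]])
  qed
qed

end
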